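(* Let $(X_n,d_n)$, $n\in\mathbb{N}$, and $(X_\infty,d_\infty)$ be locally compact geodesic spaces, meaning geodesic spaces in which every closed ball is compact. For each $n$ let $H_n:X_n\times[0,\infty)\to\mathbb{R}$ and $g^n:X_n\to\mathbb{R}$ be continuous, and let $H_\infty:X_\infty\times[0,\infty)\to\mathbb{R}$ and $g^\infty:X_\infty\to\mathbb{R}$ be continuous. Extend the Hamiltonians to $p<0$ by $H_n(x,p):=H_n(x,0)$ and $H_\infty(y,p):=H_\infty(y,0)$. Assume: (i) For each $n$ there is an $\epsilon_n$-isometry $f_n:X_n\to X_\infty$, with $\epsilon_n\to0$ as $n\to\infty$. (ii) For every $n$, every $x\in X_n$ and all real $p\le q$, $H_n(x,p)\le H_n(x,q)$. (iii) Whenever $x\in X_\infty$, $p\in\mathbb{R}$, $x_n\in X_n$, $p_n\in\mathbb{R}$ satisfy $f_n(x_n)\to x$ in $X_\infty$ and $p_n\to p$ as $n\to\infty$, one has $H_n(x_n,p_n)\to H_\infty(x,p)$. (iv) For each $n$, $u^n:[0,\infty)\times X_n\to\mathbb{R}$ is a metric viscosity subsolution (resp. supersolution) of $$\partial_t u^n(t,x)+H_n(x,|\nabla u^n(t,x)|)=0 \ \text{ in } (0,\infty)\times X_n,\qquad u^n(0,x)=g^n(x)\ \text{ on } X_n .$$ (v) For all $0<T_1<T_2<\infty$ there is a constant $M>0$ independent of $n$ such that $|u^n(s,x)|\le M$ for all $n$, all $s\in[T_1,T_2]$ and all $x\in X_n$. (vi) There is a modulus of continuity $\eta$ (independent of $n$)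 with $|g^n(x)-g^n(y)|\le\eta(d_n(x,y))$ for all $n$ and $x,y\in X_n$; and for every $x\in X_\infty$, $g^n(f_n'(x))\to g^\infty(x)$ as $n\to\infty$, where $f_n':X_\infty\to X_n$ is an $\epsilon_n$-inverse of $f_n$. (vii) (Continuity at the initial time.) For every $x\in X_\infty$, $$\sup_{(t_n,x_n)}\limsup_{n\to\infty}(u^n)^*(t_n,x_n)\le\sup_{(x_n)}\limsup_{n\to\infty}(u^n)^*(0,x_n)$$ $$\Bigl(\text{resp. } \inf_{(t_n,x_n)}\liminf_{n\to\infty}(u^n)_*(t_n,x_n)\ge\inf_{(x_n)}\liminf_{n\to\infty}(u^n)_*(0,x_n)\Bigr),$$ where the suprema (resp. infima) are over all sequences $t_n\in[0,\infty)$ with $t_n\to0$ and $x_n\in X_n$ with $f_n(x_n)\to x$ in $X_\infty$ as $n\to\infty$. For $(t,x)\in[0,\infty)\times X_\infty$ define $$u^\infty(t,x):=\sup_{(t_n,x_n)}\limsup_{n\to\infty}(u^n)^*(t_n,x_n)\qquad\Bigl(\text{resp. } u_\infty(t,x):=\inf_{(t_n,x_n)}\liminf_{n\to\infty}(u^n)_*(t_n,x_n)\Bigr),$$ where the supremum (resp. infimum) is over all sequences $t_n\in[0,\infty)$ and $x_n\in X_n$ with $t_n\to t$ and $f_n(x_n)\to x$ in $X_\infty$ as $n\to\infty$. (viii) Assume that $u^\infty$ (resp. $u_\infty$) is an upper (resp. lower) semicontinuous function on $[0,\infty)\times X_\infty$. Then $u^\infty$ (resp. $u_\infty$) is a metric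 viscosity subsolution (resp. supersolution) of $$\partial_t u(t,x)+H_\infty(x,|\nabla u(t,x)|)=0\ \text{ in } (0,\infty)\times X_\infty,\qquad u(0,x)=g^\infty(x)\ \text{ on } X_\infty .$$
   Context: **Geodesic space.** A metric space $(X,d)$ is geodesic if for all $x,y\in X$ there is a continuous $\gamma:[0,1]\to X$ with $\gamma(0)=x$, $\gamma(1)=y$ and $d(\gamma(s),\gamma(t))=|s-t|\,d(x,y)$ for all $s,t\in[0,1]$. **$\epsilon$-isometry and $\epsilon$-inverse.** For metric spaces $(X,d_X)$, $(Y,d_Y)$ and $\epsilon>0$, a map $f:X\to Y$ is an $\epsilon$-isometry if $|d_Y(f(x),f(y))-d_X(x,y)|\le\epsilon$ for all $x,y\in X$ and $d_H(f(X),Y)\le\epsilon$, where $d_H$ is the Hausdorff distance in $Y$. An $\epsilon$-inverse of an $\epsilon$-isometry $f$ is a map $f':Y\to X$ which is a $4\epsilon$-isometry and satisfies $d_X(f'(f(x)),x)\le3\epsilon$ for all $x\in X$ and $d_Y(f(f'(y)),y)\le\epsilon$ for all $y\in Y$. **Envelopes.** For $f:[0,\infty)\times X\to\mathbb{R}$, $f^*(t,x):=\limsup_{(s,y)\to(t,x)}f(s,y)$ and $f_*(t,x):=\liminf_{(s,y)\to(t,x)}f(s,y)$ (upper and lower semicontinuous envelopes; $(s,y)$ ranges over $[0,\infty)\times X$, with $(s,y)=(t,x)$ allowed). The same notation is used for functions on $(0,\infty)\times X$. **Slopes.** For locally Lipschitz $\phi:(0,\infty)\times X\to\mathbb{R}$,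 $$|\nabla\phi(t,x)|:=\limsup_{y\to x}\frac{|\phi(t,y)-\phi(t,x)|}{d(y,x)},\quad |\nabla^-\phi(t,x)|:=\limsup_{y\to x}\frac{\max\{0,\phi(t,x)-\phi(t,y)\}}{d(y,x)},$$ $$|\nabla^+\phi(t,x)|:=\limsup_{y\to x}\frac{\max\{0,\phi(t,y)-\phi(t,x)\}}{d(y,x)}.$$ **Test functions.** A pair $(\phi_1,\phi_2)$ of locally Lipschitz functions on $(0,\infty)\times X$ is a subsolution (resp. supersolution) test function if (1) $|\nabla\phi_1|=|\nabla^-\phi_1|$ (resp. $|\nabla\phi_1|=|\nabla^+\phi_1|$) on $(0,\infty)\times X$ and $|\nabla\phi_1|$ is continuous on $(0,\infty)\times X$; (2) $\partial_t\phi_1$ and $\partial_t\phi_2$ are continuous on $(0,\infty)\times X$. Let $\underline{C}$ (resp. $\overline{C}$) be the set of all subsolution (resp. supersolution) test functions. **Metric viscosity solutions.** Let $H:X\times[0,\infty)\to\mathbb{R}$ be continuous, extended by $H(x,p):=H(x,0)$ for $p<0$, and let $g:X\to\mathbb{R}$ be continuous. For $\eta\ge0$ put $H_\eta(x,p):=\inf_{|s-p|\le\eta}H(x,s)$ and $H^\eta(x,p):=\sup_{|s-p|\le\eta}H(x,s)$ (the notation $H_\eta$ is distinct from the Hamiltonians $H_n$ indexed by $n$). A locally bounded $u:[0,\infty)\times X\to\mathbb{R}$ is a metric viscosity subsolution (resp. supersolution) of $\partial_tu+H(x,|\nabla u|)=0$ in $(0,\infty)\times X$ if, whenever $(\phi_1,\phi_2)\in\underline{C}$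 (resp. $\overline{C}$) and $u^*-\phi_1-\phi_2$ attains a local maximum (resp. $u_*-\phi_1-\phi_2$ attains a local minimum) at $(t,x)\in(0,\infty)\times X$, then $$\partial_t\phi_1(t,x)+\partial_t\phi_2(t,x)+H_{|\nabla\phi_2(t,x)|^*}(x,|\nabla\phi_1(t,x)|)\le0$$ $$\bigl(\text{resp. }\partial_t\phi_1(t,x)+\partial_t\phi_2(t,x)+H^{|\nabla\phi_2(t,x)|^*}(x,|\nabla\phi_1(t,x)|)\ge0\bigr),$$ where $|\nabla\phi_2(t,x)|^*$ is the value at $(t,x)$ of the upper semicontinuous envelope of $|\nabla\phi_2|$. It is a metric viscosity subsolution (resp. supersolution) of the initial value problem $\partial_tu+H(x,|\nabla u|)=0$, $u(0,\cdot)=g$, if in addition $u(0,x)\le g(x)$ (resp. $u(0,x)\ge g(x)$) for all $x\in X$.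
   Formalization: Two hypotheses are added, as the claim fails without them: in (iv) the initial inequality is also required of the envelope, (u^n)^*(0,x) ≤ g^n(x) (resp. (u^n)_*(0,x) ≥ g^n(x)); and in the supersolution case u_∞ is assumed locally bounded on [0,∞)×X_∞. *)

theory Defs
  imports "HOL-Analysis.Analysis"
begin

text \<open>
  Metric spaces are elements of the library type \<open>'a metric\<close>, so that a sequence of spaces is a
  function \<open>nat \<Rightarrow> 'a metric\<close>. Functions on a space are total functions on the carrier type; only
  their values on \<^term>\<open>mspace X\<close> are ever used. Functions of time and space take pairs \<open>(t, x)\<close>.
\<close>

section \<open>Metric geometry\<close>

definition geodesic_space :: "'a metric \<Rightarrow> bool" where
  "geodesic_space X \<longleftrightarrow>
     (\<forall>x\<in>mspace X. \<forall>y\<in>mspace X. \<exists>\<gamma>.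
        continuous_map (top_of_set {0..1::real}) (mtopology_of X) \<gamma> \<and> \<gamma> 0 = x \<and> \<gamma> 1 = y \<and>
        (\<forall>s\<in>{0..1}. \<forall>t\<in>{0..1}. mdist X (\<gamma> s) (\<gamma> t) = \<bar>s - t\<bar> * mdist X x y))"

text \<open>``Locally compact geodesic space'' in the strong sense: all closed balls are compact.\<close>

definition lc_geodesic_space :: "'a metric \<Rightarrow> bool" where
  "lc_geodesic_space X \<longleftrightarrow>
     geodesic_space X \<and> (\<forall>x\<in>mspace X. \<forall>r. compactin (mtopology_of X) (mcball_of X x r))"

text \<open>With values in \<^typ>\<open>ennreal\<close>, the distance from a nonempty set to the empty one is \<open>\<infinity>\<close>.\<close>

definition hausdorff_distance :: "'a metric \<Rightarrow> 'a set \<Rightarrow> 'a set \<Rightarrow> ennreal" where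
  "hausdorff_distance X A B =
     max (SUP a\<in>A. INF b\<in>B. ennreal (mdist X a b)) (SUP b\<in>B. INF a\<in>A. ennreal (mdist X a b))"

definition eps_isometry :: "real \<Rightarrow> 'a metric \<Rightarrow> 'b metric \<Rightarrow> ('a \<Rightarrow> 'b) \<Rightarrow> bool" where
  "eps_isometry \<epsilon> X Y f \<longleftrightarrow>
     \<epsilon> > 0 \<and> f \<in> mspace X \<rightarrow> mspace Y \<and>
     (\<forall>x\<in>mspace X. \<forall>y\<in>mspace X. \<bar>mdist Y (f x) (f y) - mdist X x y\<bar> \<le> \<epsilon>) \<and>
     hausdorff_distance Y (f ` mspace X) (mspace Y) \<le> ennreal \<epsilon>"

definition eps_inverse ::
    "real \<Rightarrow> 'a metric \<Rightarrow> 'b metric \<Rightarrow> ('a \<Rightarrow> 'b) \<Rightarrow> ('b \<Rightarrow> 'a) \<Rightarrow> bool" where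
  "eps_inverse \<epsilon> X Y f f' \<longleftrightarrow>
     eps_isometry (4 * \<epsilon>) Y X f' \<and>
     (\<forall>x\<in>mspace X. mdist X (f' (f x)) x \<le> 3 * \<epsilon>) \<and>
     (\<forall>y\<in>mspace Y. mdist Y (f (f' y)) y \<le> \<epsilon>)"

section \<open>Space-time cylinders, envelopes, slopes\<close>

definition closed_cyl :: "'a metric \<Rightarrow> (real \<times> 'a) metric" where
  "closed_cyl X = prod_metric (submetric euclidean_metric {0..}) X"

definition open_cyl :: "'a metric \<Rightarrow> (real \<times> 'a) metric" where
  "open_cyl X = prod_metric (submetric euclidean_metric {0<..}) X"

text \<open>
  The filter \<^const>\<open>nhdsin\<close> is not punctured, so the base point takes part in the limsup and
  liminf. The first argument is the domain over which they are taken.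
\<close>

definition upper_env :: "'c metric \<Rightarrow> ('c \<Rightarrow> real) \<Rightarrow> 'c \<Rightarrow> ereal" where
  "upper_env C f p = Limsup (nhdsin (mtopology_of C) p) (\<lambda>q. ereal (f q))"

definition lower_env :: "'c metric \<Rightarrow> ('c \<Rightarrow> real) \<Rightarrow> 'c \<Rightarrow> ereal" where
  "lower_env C f p = Liminf (nhdsin (mtopology_of C) p) (\<lambda>q. ereal (f q))"

definition usc_fun :: "'c metric \<Rightarrow> ('c \<Rightarrow> ereal) \<Rightarrow> bool" where
  "usc_fun C F \<longleftrightarrow> (\<forall>p\<in>mspace C. Limsup (nhdsin (mtopology_of C) p) F \<le> F p)"

definition lsc_fun :: "'c metric \<Rightarrow> ('c \<Rightarrow> ereal) \<Rightarrow> bool" where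
  "lsc_fun C F \<longleftrightarrow> (\<forall>p\<in>mspace C. F p \<le> Liminf (nhdsin (mtopology_of C) p) F)"

definition finite_fun :: "'c metric \<Rightarrow> ('c \<Rightarrow> ereal) \<Rightarrow> bool" where
  "finite_fun C F \<longleftrightarrow> (\<forall>p\<in>mspace C. \<bar>F p\<bar> \<noteq> \<infinity>)"

definition locally_bounded :: "'c metric \<Rightarrow> ('c \<Rightarrow> real) \<Rightarrow> bool" where
  "locally_bounded C f \<longleftrightarrow>
     (\<forall>p\<in>mspace C. \<exists>U. openin (mtopology_of C) U \<and> p \<in> U \<and> bounded (f ` U))"

definition locally_Lipschitz :: "'c metric \<Rightarrow> ('c \<Rightarrow> real) \<Rightarrow> bool" where
  "locally_Lipschitz C f \<longleftrightarrow>
     (\<forall>p\<in>mspace C. \<exists>U. openin (mtopology_of C) U \<and> p \<in> U \<and>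
        Lipschitz_continuous_map (submetric C U) euclidean_metric f)"

text \<open>
  The limsup in a slope is over \<open>y \<noteq> x\<close>. The outer maximum only matters at an isolated point, where
  the limsup is over the trivial filter and the slope is \<open>0\<close>. For locally Lipschitz functions
  the limsup is finite, so that \<^const>\<open>real_of_ereal\<close> loses nothing.
\<close>

definition slope :: "'a metric \<Rightarrow> (real \<times> 'a \<Rightarrow> real) \<Rightarrow> real \<times> 'a \<Rightarrow> real" where
  "slope X \<phi> = (\<lambda>(t, x). real_of_ereal (max 0
     (Limsup (atin (mtopology_of X) x) (\<lambda>y. ereal (\<bar>\<phi> (t, y) - \<phi> (t, x)\<bar> / mdist X y x)))))"

definition slope_minus :: "'a metric \<Rightarrow> (real \<times> 'a \<Rightarrow> real) \<Rightarrow> real \<times> 'a \<Rightarrow> real" where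
  "slope_minus X \<phi> = (\<lambda>(t, x). real_of_ereal (max 0
     (Limsup (atin (mtopology_of X) x) (\<lambda>y. ereal (max 0 (\<phi> (t, x) - \<phi> (t, y)) / mdist X y x)))))"

definition slope_plus :: "'a metric \<Rightarrow> (real \<times> 'a \<Rightarrow> real) \<Rightarrow> real \<times> 'a \<Rightarrow> real" where
  "slope_plus X \<phi> = (\<lambda>(t, x). real_of_ereal (max 0
     (Limsup (atin (mtopology_of X) x) (\<lambda>y. ereal (max 0 (\<phi> (t, y) - \<phi> (t, x)) / mdist X y x)))))"

definition slope_env :: "'a metric \<Rightarrow> (real \<times> 'a \<Rightarrow> real) \<Rightarrow> real \<times> 'a \<Rightarrow> real" where
  "slope_env X \<phi> p = real_of_ereal (upper_env (open_cyl X) (slope X \<phi>) p)"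

section \<open>Test functions\<close>

definition dt :: "(real \<times> 'a \<Rightarrow> real) \<Rightarrow> real \<times> 'a \<Rightarrow> real" where
  "dt \<phi> = (\<lambda>(t, x). deriv (\<lambda>s. \<phi> (s, x)) t)"

definition continuous_dt :: "'a metric \<Rightarrow> (real \<times> 'a \<Rightarrow> real) \<Rightarrow> bool" where
  "continuous_dt X \<phi> \<longleftrightarrow>
     (\<forall>(t, x)\<in>mspace (open_cyl X). (\<lambda>s. \<phi> (s, x)) differentiable (at t)) \<and>
     continuous_map (mtopology_of (open_cyl X)) euclideanreal (dt \<phi>)"

definition sub_test :: "'a metric \<Rightarrow> ((real \<times> 'a \<Rightarrow> real) \<times> (real \<times> 'a \<Rightarrow> real)) set" where
  "sub_test X = {(\<phi>1, \<phi>2).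
     locally_Lipschitz (open_cyl X) \<phi>1 \<and> locally_Lipschitz (open_cyl X) \<phi>2 \<and>
     (\<forall>p\<in>mspace (open_cyl X). slope X \<phi>1 p = slope_minus X \<phi>1 p) \<and>
     continuous_map (mtopology_of (open_cyl X)) euclideanreal (slope X \<phi>1) \<and>
     continuous_dt X \<phi>1 \<and> continuous_dt X \<phi>2}"

definition super_test :: "'a metric \<Rightarrow> ((real \<times> 'a \<Rightarrow> real) \<times> (real \<times> 'a \<Rightarrow> real)) set" where
  "super_test X = {(\<phi>1, \<phi>2).
     locally_Lipschitz (open_cyl X) \<phi>1 \<and> locally_Lipschitz (open_cyl X) \<phi>2 \<and>
     (\<forall>p\<in>mspace (open_cyl X). slope X \<phi>1 p = slope_plus X \<phi>1 p) \<and>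
     continuous_map (mtopology_of (open_cyl X)) euclideanreal (slope X \<phi>1) \<and>
     continuous_dt X \<phi>1 \<and> continuous_dt X \<phi>2}"

section \<open>Hamiltonians and metric viscosity solutions\<close>

text \<open>A Hamiltonian \<open>H x p\<close> is given for \<open>p \<ge> 0\<close>; its values at \<open>p < 0\<close> are ignored.\<close>

definition continuous_ham :: "'a metric \<Rightarrow> ('a \<Rightarrow> real \<Rightarrow> real) \<Rightarrow> bool" where
  "continuous_ham X H \<longleftrightarrow>
     continuous_map (mtopology_of (prod_metric X (submetric euclidean_metric {0..})))
       euclideanreal (\<lambda>(x, p). H x p)"

definition ext_ham :: "('a \<Rightarrow> real \<Rightarrow> real) \<Rightarrow> 'a \<Rightarrow> real \<Rightarrow> real" where
  "ext_ham H x p = (if p < 0 then H x 0 else H x p)"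

definition ham_lower :: "('a \<Rightarrow> real \<Rightarrow> real) \<Rightarrow> real \<Rightarrow> 'a \<Rightarrow> real \<Rightarrow> real" where
  "ham_lower H \<eta> x p = (INF s\<in>{s. \<bar>s - p\<bar> \<le> \<eta>}. ext_ham H x s)"

definition ham_upper :: "('a \<Rightarrow> real \<Rightarrow> real) \<Rightarrow> real \<Rightarrow> 'a \<Rightarrow> real \<Rightarrow> real" where
  "ham_upper H \<eta> x p = (SUP s\<in>{s. \<bar>s - p\<bar> \<le> \<eta>}. ext_ham H x s)"

definition local_max_at :: "'c metric \<Rightarrow> ('c \<Rightarrow> ereal) \<Rightarrow> 'c \<Rightarrow> bool" where
  "local_max_at C F p \<longleftrightarrow>
     (\<exists>U. openin (mtopology_of C) U \<and> p \<in> U \<and> (\<forall>q\<in>U. F q \<le> F p))"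

definition local_min_at :: "'c metric \<Rightarrow> ('c \<Rightarrow> ereal) \<Rightarrow> 'c \<Rightarrow> bool" where
  "local_min_at C F p \<longleftrightarrow>
     (\<exists>U. openin (mtopology_of C) U \<and> p \<in> U \<and> (\<forall>q\<in>U. F p \<le> F q))"

definition mv_subsolution ::
    "'a metric \<Rightarrow> ('a \<Rightarrow> real \<Rightarrow> real) \<Rightarrow> (real \<times> 'a \<Rightarrow> real) \<Rightarrow> bool" where
  "mv_subsolution X H u \<longleftrightarrow>
     locally_bounded (closed_cyl X) u \<and>
     (\<forall>(\<phi>1, \<phi>2)\<in>sub_test X. \<forall>(t, x)\<in>mspace (open_cyl X).
        local_max_at (open_cyl X)
          (\<lambda>q. upper_env (closed_cyl X) u q - ereal (\<phi>1 q) - ereal (\<phi>2 q)) (t, x) \<longrightarrow>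
        dt \<phi>1 (t, x) + dt \<phi>2 (t, x)
          + ham_lower H (slope_env X \<phi>2 (t, x)) x (slope X \<phi>1 (t, x)) \<le> 0)"

definition mv_supersolution ::
    "'a metric \<Rightarrow> ('a \<Rightarrow> real \<Rightarrow> real) \<Rightarrow> (real \<times> 'a \<Rightarrow> real) \<Rightarrow> bool" where
  "mv_supersolution X H u \<longleftrightarrow>
     locally_bounded (closed_cyl X) u \<and>
     (\<forall>(\<phi>1, \<phi>2)\<in>super_test X. \<forall>(t, x)\<in>mspace (open_cyl X).
        local_min_at (open_cyl X)
          (\<lambda>q. lower_env (closed_cyl X) u q - ereal (\<phi>1 q) - ereal (\<phi>2 q)) (t, x) \<longrightarrow>
        dt \<phi>1 (t, x) + dt \<phi>2 (t, x)
          + ham_upper H (slope_env X \<phi>2 (t, x)) x (slope X \<phi>1 (t, x)) \<ge> 0)"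

definition mv_subsolution_ivp ::
    "'a metric \<Rightarrow> ('a \<Rightarrow> real \<Rightarrow> real) \<Rightarrow> ('a \<Rightarrow> real) \<Rightarrow> (real \<times> 'a \<Rightarrow> real) \<Rightarrow> bool" where
  "mv_subsolution_ivp X H g u \<longleftrightarrow>
     mv_subsolution X H u \<and> (\<forall>x\<in>mspace X. u (0, x) \<le> g x)"

definition mv_supersolution_ivp ::
    "'a metric \<Rightarrow> ('a \<Rightarrow> real \<Rightarrow> real) \<Rightarrow> ('a \<Rightarrow> real) \<Rightarrow> (real \<times> 'a \<Rightarrow> real) \<Rightarrow> bool" where
  "mv_supersolution_ivp X H g u \<longleftrightarrow>
     mv_supersolution X H u \<and> (\<forall>x\<in>mspace X. u (0, x) \<ge> g x)"

section \<open>Data of the stability theorem\<close>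

definition modulus_of_continuity :: "(real \<Rightarrow> real) \<Rightarrow> bool" where
  "modulus_of_continuity \<eta> \<longleftrightarrow>
     \<eta> 0 = 0 \<and> (\<forall>r\<ge>0. \<eta> r \<ge> 0) \<and> (\<eta> \<longlongrightarrow> 0) (at_right 0)"

text \<open>Sequences \<open>x\<^sub>n \<in> X\<^sub>n\<close> with \<open>f\<^sub>n(x\<^sub>n) \<rightarrow> x\<close>, and with times \<open>t\<^sub>n \<rightarrow> t\<close> in addition.\<close>

definition space_seqs ::
    "(nat \<Rightarrow> 'a metric) \<Rightarrow> 'b metric \<Rightarrow> (nat \<Rightarrow> 'a \<Rightarrow> 'b) \<Rightarrow> 'b \<Rightarrow> (nat \<Rightarrow> 'a) set" where
  "space_seqs X Y f x =
     {\<xi>. (\<forall>n. \<xi> n \<in> mspace (X n)) \<and>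
         limitin (mtopology_of Y) (\<lambda>n. f n (\<xi> n)) x sequentially}"

definition time_seqs :: "real \<Rightarrow> (nat \<Rightarrow> real) set" where
  "time_seqs t = {\<tau>. (\<forall>n. \<tau> n \<ge> 0) \<and> \<tau> \<longlonglongrightarrow> t}"

definition upper_limit_fun ::
    "(nat \<Rightarrow> 'a metric) \<Rightarrow> 'b metric \<Rightarrow> (nat \<Rightarrow> 'a \<Rightarrow> 'b) \<Rightarrow> (nat \<Rightarrow> real \<times> 'a \<Rightarrow> real)
       \<Rightarrow> real \<times> 'b \<Rightarrow> ereal" where
  "upper_limit_fun X Y f u = (\<lambda>(t, x).
     SUP (\<tau>, \<xi>)\<in>time_seqs t \<times> space_seqs X Y f x.
       limsup (\<lambda>n. upper_env (closed_cyl (X n)) (u n) (\<tau> n, \<xi> n)))"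

definition lower_limit_fun ::
    "(nat \<Rightarrow> 'a metric) \<Rightarrow> 'b metric \<Rightarrow> (nat \<Rightarrow> 'a \<Rightarrow> 'b) \<Rightarrow> (nat \<Rightarrow> real \<times> 'a \<Rightarrow> real)
       \<Rightarrow> real \<times> 'b \<Rightarrow> ereal" where
  "lower_limit_fun X Y f u = (\<lambda>(t, x).
     INF (\<tau>, \<xi>)\<in>time_seqs t \<times> space_seqs X Y f x.
       liminf (\<lambda>n. lower_env (closed_cyl (X n)) (u n) (\<tau> n, \<xi> n)))"

text \<open>
  The stability theorem carries two hypotheses beyond \<^const>\<open>mv_subsolution_ivp\<close> and
  \<^const>\<open>mv_supersolution_ivp\<close> for \<open>u\<^sub>n\<close> and semicontinuity of the limit; it is false without them.

  \<^item> The initial inequality is also required of the envelope of \<open>u\<^sub>n\<close>. On a one-point space with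
    zero Hamiltonian and \<open>g = 0\<close>, the function that is \<open>0\<close> at \<open>t = 0\<close> and \<open>5\<close> for \<open>t > 0\<close> is a
    subsolution in the above sense, but the upper limit of the constant sequence is \<open>5\<close> at \<open>t = 0\<close>.
    For semicontinuous \<open>u\<^sub>n\<close> the requirement is part of the definition of a solution.

  \<^item> The limit of supersolutions is required to be locally bounded, as in the definition of
    a supersolution. On the real line with \<open>H(x, p) = p\<^sup>2\<close> and \<open>g = 0\<close>, let \<open>h \<ge> 0\<close> be lower
    semicontinuous, vanishing at \<open>0\<close>, at all \<open>1/k\<close> and outside \<open>(0, 1)\<close>, with a continuous bump of
    height \<open>k\<close> on \<open>(1/(k+1), 1/k)\<close>. The Hopf-Lax evolutions of \<open>min n h\<close> converge to that of \<open>h\<close>,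
    which is real-valued and lower semicontinuous but unbounded near \<open>(0, 0)\<close>.
    For subsolutions, local boundedness of the limit is a consequence of the other hypotheses.
\<close>

end

theory Submission
  imports Defs
begin

text \<open>
  Test functions on \<open>Y\<close> cannot be pulled back along the discontinuous maps \<open>f\<^sub>n\<close>, but squared distances
  can be transferred, since \<open>d\<^sub>n (x, f'\<^sub>n z)\<close> and \<open>d (f\<^sub>n x, z)\<close> differ by at most \<open>2\<epsilon>\<^sub>n\<close>. So suppose that
  \<open>u - \<phi>\<^sub>1 - \<phi>\<^sub>2\<close> has a local maximum at \<open>(t\<^sub>0, x\<^sub>0)\<close>, where \<open>\<phi>\<^sub>1\<close> has slope \<open>p\<close>. Near \<open>x\<^sub>0\<close> the function
  \<open>\<phi>\<^sub>1\<close> is \<open>(p + \<delta>)\<close>-Lipschitz along geodesics, and because its slope is a descending slope there is a nearby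
  point \<open>z\<close> with \<open>\<phi>\<^sub>1(z) \<le> \<phi>\<^sub>1(x\<^sub>0) - (p - \<delta>) d(x\<^sub>0, z)\<close>. Hence \<open>\<phi>\<^sub>1\<close> lies below a multiple of
  \<open>d(\<cdot>, z)\<^sup>2\<close> of slope about \<open>p\<close> and almost touches it at \<open>x\<^sub>0\<close>, while \<open>\<phi>\<^sub>2\<close> lies below a multiple of
  \<open>d(\<cdot>, x\<^sub>0)\<close>. In geodesic spaces these are test functions; transferred to \<open>X\<^sub>n\<close> they produce maxima of
  the upper envelopes of \<open>u\<^sub>n\<close> near \<open>(t\<^sub>0, x\<^sub>0)\<close>, and convergence of the Hamiltonians gives the limit
  inequality. This argument does not use monotonicity of the Hamiltonians, so supersolutions are covered by
  passing to \<open>-u\<close> and \<open>-H\<close>. Monotonicity enters only for local boundedness of the limit of subsolutions: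
  it makes a subsolution grow at a bounded rate in time, so that a lower bound at a positive time persists
  down to the initial time.
\<close>

section \<open>Filters and continuity on cylinders\<close>

text \<open>The replaced test function, shifted by a constant, touches the limit function at
  \<open>(t0, x0)\<close>, but since it only almost touches \<phi>1 it need not stay above the limit
  function nearby. What is kept instead is a gap \<gamma> on the boundary of a small box around
  \<open>(t0, x0)\<close>. The gap forces maxima into the interior, where a viscosity inequality is
  available, and it survives the errors of the transfer to \<open>X n\<close>. The maximum may sit
  anywhere in the box, so the box must be so small that the slope of the squared distance and the
  time derivative hardly vary on it, yet so large that the penalties on its boundary beat the
  contact error. This conflict decides the scales. Second components of test pairs only enlarge the
  interval of momenta over which the Hamiltonian is minimized. Each \<open>X n\<close> thus
  contributes a momentum \<open>s\<close> rather than a slope, and a limit momentum is found by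
  compactness. Closed balls must be compact in \<open>X n\<close> for maxima to exist, and in
  \<open>Y\<close> for these maxima to have limit points.\<close>

lemma mdist_self [simp]: "x \<in> mspace m \<Longrightarrow> mdist m x x = 0"
  by simp

text \<open>A single family for both time domains: envelopes of solutions live over
  \<open>{0..}\<close>, test functions over \<open>{0<..}\<close>.\<close>

definition cyl :: "real set \<Rightarrow> 'a metric \<Rightarrow> (real \<times> 'a) metric" where
  "cyl S X = prod_metric (submetric euclidean_metric S) X"

lemma closed_cyl_eq: "closed_cyl X = cyl {0..} X"
  and open_cyl_eq: "open_cyl X = cyl {0<..} X"
  by (simp_all add: closed_cyl_def open_cyl_def cyl_def)

lemma mspace_cyl [simp]: "mspace (cyl S X) = S \<times> mspace X"
  by (simp add: cyl_def)

lemma mdist_cyl [simp]: "mdist (cyl S X) = prod_dist dist (mdist X)"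
  by (simp add: cyl_def)

lemma eventually_nhdsin_metric:
  assumes "a \<in> mspace m"
  shows "eventually P (nhdsin (mtopology_of m) a) \<longleftrightarrow>
    (\<exists>r>0. \<forall>y\<in>mspace m. mdist m a y < r \<longrightarrow> P y)"
proof -
  interpret Metric_space "mspace m" "mdist m" by simp
  have o: "openin mtopology S \<longleftrightarrow> S \<subseteq> mspace m \<and> (\<forall>x\<in>S. \<exists>r>0. mball x r \<subseteq> S)" for S
    by (auto simp: openin_mtopology)
  show ?thesis
  proof
    assume "eventually P (nhdsin (mtopology_of m) a)"
    then obtain S where "openin mtopology S" "a \<in> S" "\<forall>x\<in>S. P x"
      using assms by (auto simp: eventually_nhdsin mtopology_of_def)
    moreover then obtain r where "r > 0" "mball a r \<subseteq> S" using o by blast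
    ultimately show "\<exists>r>0. \<forall>y\<in>mspace m. mdist m a y < r \<longrightarrow> P y"
      using assms by (intro exI[of _ r]) auto
  next
    assume "\<exists>r>0. \<forall>y\<in>mspace m. mdist m a y < r \<longrightarrow> P y"
    then obtain r where "r>0" "\<forall>y\<in>mspace m. mdist m a y < r \<longrightarrow> P y" by blast
    then show "eventually P (nhdsin (mtopology_of m) a)"
      using assms unfolding eventually_nhdsin mtopology_of_def
      by (intro disjI2 exI[of _ "mball a r"]) auto
  qed
qed

lemma eventually_atin_metric:
  assumes "a \<in> mspace m"
  shows "eventually P (atin (mtopology_of m) a) \<longleftrightarrow>
    (\<exists>r>0. \<forall>y\<in>mspace m. y \<noteq> a \<longrightarrow> mdist m y a < r \<longrightarrow> P y)"
  using eventually_nhdsin_metric[OF assms, of "\<lambda>y. y \<noteq> a \<longrightarrow> P y"] assms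
  by (auto simp: eventually_atin eventually_nhdsin mdist_commute[of m a])

text \<open>The product metric is Euclidean in the pair of distances. These bounds replace its balls
  by boxes, in which time and space are treated separately.\<close>

lemma abs_le_prod_dist:
  "\<bar>s - t\<bar> \<le> prod_dist dist (mdist X) (s, x) (t, y)" "mdist X x y \<le> prod_dist dist (mdist X) (s, x) (t, y)"
  "prod_dist dist (mdist X) (s, x) (t, y) \<le> \<bar>s - t\<bar> + mdist X x y"
  for s t :: real
  unfolding prod_dist_def dist_real_def
  by (auto simp: real_le_rsqrt intro!: sqrt_sum_squares_le_sum_abs[THEN order_trans])

lemma eventually_nhdsin_cyl:
  assumes "t \<in> S" "x \<in> mspace X"
  shows "eventually P (nhdsin (mtopology_of (cyl S X)) (t, x)) \<longleftrightarrow>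
    (\<exists>r>0. \<forall>s\<in>S. \<forall>y\<in>mspace X. \<bar>s - t\<bar> < r \<longrightarrow> mdist X y x < r \<longrightarrow> P (s, y))"
proof
  assume "eventually P (nhdsin (mtopology_of (cyl S X)) (t, x))"
  then obtain r where r: "r>0" "\<forall>q\<in>mspace (cyl S X). mdist (cyl S X) (t, x) q < r \<longrightarrow> P q"
    using assms by (auto simp: eventually_nhdsin_metric)
  show "\<exists>r>0. \<forall>s\<in>S. \<forall>y\<in>mspace X. \<bar>s - t\<bar> < r \<longrightarrow> mdist X y x < r \<longrightarrow> P (s, y)"
  proof (intro exI[of _ "r/2"] conjI ballI impI)
    fix s y assume "s \<in> S" "y \<in> mspace X" "\<bar>s - t\<bar> < r/2" "mdist X y x < r/2"
    moreover then have "mdist (cyl S X) (t, x) (s, y) < r"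
      using abs_le_prod_dist(3)[of X t x s y] by (simp add: mdist_commute abs_minus_commute)
    ultimately show "P (s, y)" using r by auto
  qed (use r in auto)
next
  assume "\<exists>r>0. \<forall>s\<in>S. \<forall>y\<in>mspace X. \<bar>s - t\<bar> < r \<longrightarrow> mdist X y x < r \<longrightarrow> P (s, y)"
  then obtain r where r: "r>0" "\<forall>s\<in>S. \<forall>y\<in>mspace X. \<bar>s - t\<bar> < r \<longrightarrow> mdist X y x < r \<longrightarrow> P (s, y)" by blast
  have "P q" if "q \<in> mspace (cyl S X)" "mdist (cyl S X) (t, x) q < r" for q
    using that r abs_le_prod_dist(1,2)[where X=X and x=x and y="snd q" and s=t and t="fst q"]
    by (cases q) (auto simp: mdist_commute abs_minus_commute)
  then show "eventually P (nhdsin (mtopology_of (cyl S X)) (t, x))"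
    using assms r(1) by (subst eventually_nhdsin_metric) auto
qed

lemma local_max_at_iff:
  assumes "p \<in> mspace C"
  shows "local_max_at C F p \<longleftrightarrow> (\<forall>\<^sub>F q in nhdsin (mtopology_of C) p. F q \<le> F p)"
  using assms by (auto simp: local_max_at_def eventually_nhdsin)

lemma continuous_map_real_iff:
  "continuous_map (mtopology_of m) euclideanreal f \<longleftrightarrow>
    (\<forall>p\<in>mspace m. \<forall>e>0. \<forall>\<^sub>F q in nhdsin (mtopology_of m) p. \<bar>f q - f p\<bar> < e)"
proof -
  have "continuous_map (mtopology_of m) euclideanreal f \<longleftrightarrow>
      (\<forall>x\<in>mspace m. \<forall>V. open V \<and> f x \<in> V \<longrightarrow> (\<exists>U. openin (mtopology_of m) U \<and> x \<in> U \<and> f ` U \<subseteq> V))"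
    by (auto simp: continuous_map_eq_topcontinuous_at topcontinuous_at_def image_subset_iff)
  also have "\<dots> \<longleftrightarrow> (\<forall>x\<in>mspace m. \<forall>V. open V \<and> f x \<in> V \<longrightarrow> (\<forall>\<^sub>F q in nhdsin (mtopology_of m) x. f q \<in> V))"
    by (rule ball_cong[OF refl], simp add: eventually_nhdsin image_subset_iff)
  also have "\<dots> \<longleftrightarrow> (\<forall>x\<in>mspace m. (f \<longlongrightarrow> f x) (nhdsin (mtopology_of m) x))"
    by (auto simp: tendsto_def)
  finally show ?thesis by (simp add: tendsto_iff dist_real_def)
qed

lemma continuous_map_cylI:
  assumes "\<And>t x e. t \<in> S \<Longrightarrow> x \<in> mspace X \<Longrightarrow> e > 0 \<Longrightarrow>
    \<exists>r>0. \<forall>s\<in>S. \<forall>y\<in>mspace X. \<bar>s - t\<bar> < r \<longrightarrow> mdist X y x < r \<longrightarrow> \<bar>f (s, y) - f (t, x)\<bar> < e"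
  shows "continuous_map (mtopology_of (cyl S X)) euclideanreal f"
  unfolding continuous_map_real_iff using assms by (auto simp: eventually_nhdsin_cyl)

lemma continuous_map_cylD:
  assumes "continuous_map (mtopology_of (cyl S X)) euclideanreal f" "t \<in> S" "x \<in> mspace X" "e > 0"
  obtains r where "r > 0"
    "\<And>s y. s\<in>S \<Longrightarrow> y\<in>mspace X \<Longrightarrow> \<bar>s - t\<bar> < r \<Longrightarrow> mdist X y x < r \<Longrightarrow> \<bar>f (s, y) - f (t, x)\<bar> < e"
proof -
  have "\<forall>\<^sub>F q in nhdsin (mtopology_of (cyl S X)) (t,x). \<bar>f q - f (t,x)\<bar> < e"
    using assms unfolding continuous_map_real_iff by auto
  then show ?thesis using that assms unfolding eventually_nhdsin_cyl[OF assms(2,3)] by metis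
qed

lemma locally_Lipschitz_cylI:
  assumes "\<And>t x. t \<in> S \<Longrightarrow> x \<in> mspace X \<Longrightarrow> \<exists>r>0. \<exists>K. \<forall>s\<in>S. \<forall>s'\<in>S. \<forall>y\<in>mspace X. \<forall>y'\<in>mspace X.
     \<bar>s - t\<bar> < r \<longrightarrow> \<bar>s' - t\<bar> < r \<longrightarrow> mdist X y x < r \<longrightarrow> mdist X y' x < r \<longrightarrow>
     \<bar>\<phi> (s, y) - \<phi> (s', y')\<bar> \<le> K * (\<bar>s - s'\<bar> + mdist X y y')"
  shows "locally_Lipschitz (cyl S X) \<phi>"
  unfolding locally_Lipschitz_def
proof
  fix p assume p: "p \<in> mspace (cyl S X)"
  obtain t x where [simp]: "p = (t, x)" by fastforce
  have tx: "t \<in> S" "x \<in> mspace X" using p by auto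
  then obtain r K where r: "r > 0" and K: "\<And>s s' y y'. s\<in>S \<Longrightarrow> s'\<in>S \<Longrightarrow> y\<in>mspace X \<Longrightarrow> y'\<in>mspace X \<Longrightarrow>
     \<bar>s - t\<bar> < r \<Longrightarrow> \<bar>s' - t\<bar> < r \<Longrightarrow> mdist X y x < r \<Longrightarrow> mdist X y' x < r \<Longrightarrow>
     \<bar>\<phi> (s, y) - \<phi> (s', y')\<bar> \<le> K * (\<bar>s - s'\<bar> + mdist X y y')" using assms[OF tx] by metis
  have "\<forall>\<^sub>F q in nhdsin (mtopology_of (cyl S X)) p. fst q \<in> S \<and> snd q \<in> mspace X \<and> \<bar>fst q - t\<bar> < r \<and> mdist X (snd q) x < r"
    using tx r by (auto simp: eventually_nhdsin_cyl)
  then obtain U where U: "openin (mtopology_of (cyl S X)) U" "p \<in> U"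
    "\<And>q. q \<in> U \<Longrightarrow> fst q \<in> S \<and> snd q \<in> mspace X \<and> \<bar>fst q - t\<bar> < r \<and> mdist X (snd q) x < r"
    using p by (auto simp: eventually_nhdsin)
  have "\<bar>\<phi> q - \<phi> q'\<bar> \<le> (2 * \<bar>K\<bar>) * mdist (cyl S X) q q'" if "q \<in> U" "q' \<in> U" for q q'
  proof -
    obtain s y s' y' where [simp]: "q = (s,y)" "q' = (s',y')" by fastforce
    have "\<bar>\<phi> q - \<phi> q'\<bar> \<le> K * (\<bar>s - s'\<bar> + mdist X y y')" using U(3)[OF that(1)] U(3)[OF that(2)] K by simp
    also have "\<dots> \<le> \<bar>K\<bar> * (2 * prod_dist dist (mdist X) (s,y) (s',y'))"
      using abs_le_prod_dist(1,2)[where X=X and s=s and t=s' and x=y and y=y'] by (intro mult_mono) auto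
    finally show ?thesis by simp
  qed
  then show "\<exists>U. openin (mtopology_of (cyl S X)) U \<and> p \<in> U \<and>
        Lipschitz_continuous_map (submetric (cyl S X) U) euclidean_metric \<phi>"
    using U(1,2) unfolding Lipschitz_continuous_map_def
    by (intro exI[of _ U] conjI exI[of _ "2*\<bar>K\<bar>"]) (auto simp: dist_real_def)
qed

lemma locally_Lipschitz_cylD:
  assumes "locally_Lipschitz (cyl S X) \<phi>" "t \<in> S" "x \<in> mspace X"
  obtains r K where "r > 0" "K \<ge> 0" "\<And>s s' y y'. s\<in>S \<Longrightarrow> s'\<in>S \<Longrightarrow> y\<in>mspace X \<Longrightarrow> y'\<in>mspace X \<Longrightarrow>
     \<bar>s - t\<bar> < r \<Longrightarrow> \<bar>s' - t\<bar> < r \<Longrightarrow> mdist X y x < r \<Longrightarrow> mdist X y' x < r \<Longrightarrow>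
     \<bar>\<phi> (s, y) - \<phi> (s', y')\<bar> \<le> K * (\<bar>s - s'\<bar> + mdist X y y')"
proof -
  obtain U where U: "openin (mtopology_of (cyl S X)) U" "(t,x) \<in> U"
     "Lipschitz_continuous_map (submetric (cyl S X) U) euclidean_metric \<phi>"
    using assms unfolding locally_Lipschitz_def by force
  have "\<forall>\<^sub>F q in nhdsin (mtopology_of (cyl S X)) (t,x). q \<in> U"
    using U by (auto simp: eventually_nhdsin)
  then obtain r where r: "r > 0" "\<And>s y. s\<in>S \<Longrightarrow> y\<in>mspace X \<Longrightarrow> \<bar>s - t\<bar> < r \<Longrightarrow> mdist X y x < r \<Longrightarrow> (s,y) \<in> U"
    unfolding eventually_nhdsin_cyl[OF assms(2,3)] by blast
  obtain K where K: "\<And>q q'. q \<in> U \<Longrightarrow> q' \<in> U \<Longrightarrow> q \<in> mspace (cyl S X) \<Longrightarrow> q' \<in> mspace (cyl S X) \<Longrightarrow>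
     \<bar>\<phi> q - \<phi> q'\<bar> \<le> K * mdist (cyl S X) q q'"
    using U(3) unfolding Lipschitz_continuous_map_def by (auto simp: dist_real_def)
  show ?thesis
  proof (rule that[of r "\<bar>K\<bar>"])
    fix s s' y y' assume *: "s\<in>S" "s'\<in>S" "y\<in>mspace X" "y'\<in>mspace X"
     "\<bar>s - t\<bar> < r" "\<bar>s' - t\<bar> < r" "mdist X y x < r" "mdist X y' x < r"
    have "\<bar>\<phi> (s,y) - \<phi> (s',y')\<bar> \<le> K * prod_dist dist (mdist X) (s,y) (s',y')" using K[of "(s,y)" "(s',y')"] r * by auto
    also have "\<dots> \<le> \<bar>K\<bar> * (\<bar>s - s'\<bar> + mdist X y y')"
      using abs_le_prod_dist(3)[where X=X and s=s and t=s' and x=y and y=y']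
      by (intro mult_mono order_trans[OF _ abs_le_prod_dist(3)]) (auto simp: prod_dist_def)
    finally show "\<bar>\<phi> (s,y) - \<phi> (s',y')\<bar> \<le> \<bar>K\<bar> * (\<bar>s - s'\<bar> + mdist X y y')" .
  qed (use r in auto)
qed

section \<open>Slopes\<close>

text \<open>\<open>real_of_ereal\<close> sends \<infinity> to 0, so a small value says something
  about the limsup only when the limsup is known to be finite. This is the role of \<open>K\<close>
  here and in the lemmas below that carry it.\<close>

lemma Limsup_pos_part_lessD:
  assumes "real_of_ereal (max 0 (Limsup F (\<lambda>y. ereal (q y)))) < c" "\<forall>\<^sub>F y in F. q y \<le> K"
  shows "\<forall>\<^sub>F y in F. q y < c"
proof -
  have "Limsup F (\<lambda>y. ereal (q y)) \<le> ereal K"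
    using assms(2) by (intro Limsup_bounded) (auto elim: eventually_mono)
  then have "Limsup F (\<lambda>y. ereal (q y)) < ereal c"
    using assms(1) by (cases "Limsup F (\<lambda>y. ereal (q y))") (auto simp: max_def split: if_splits)
  from Limsup_lessD[OF this] show ?thesis by simp
qed

lemma Limsup_pos_part_le:
  assumes "\<forall>\<^sub>F y in F. q y \<le> c" "c \<ge> 0"
  shows "real_of_ereal (max 0 (Limsup F (\<lambda>y. ereal (q y)))) \<le> c"
proof -
  have "Limsup F (\<lambda>y. ereal (q y)) \<le> ereal c"
    using assms(1) by (intro Limsup_bounded) (auto elim: eventually_mono)
  then show ?thesis
    using assms(2) by (cases "Limsup F (\<lambda>y. ereal (q y))") (auto simp: max_def split: if_splits)
qed

lemma less_Limsup_pos_partD: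
  assumes "c < real_of_ereal (max 0 (Limsup F (\<lambda>y. ereal (q y))))" "c \<ge> 0"
  shows "\<exists>\<^sub>F y in F. q y > c"
proof (rule ccontr)
  assume "\<not> ?thesis"
  then have "\<forall>\<^sub>F y in F. q y \<le> c" by (simp add: not_frequently not_less)
  from Limsup_pos_part_le[OF this assms(2)] assms(1) show False by simp
qed

lemma le_Limsup_pos_part:
  assumes "\<exists>\<^sub>F y in F. q y \<ge> c" "\<forall>\<^sub>F y in F. q y \<le> K"
  shows "c \<le> real_of_ereal (max 0 (Limsup F (\<lambda>y. ereal (q y))))"
proof (rule ccontr)
  assume "\<not> ?thesis"
  then have "\<forall>\<^sub>F y in F. q y < c" using assms(2) by (intro Limsup_pos_part_lessD) auto
  with assms(1) show False by (auto simp: frequently_def not_le)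
qed

lemma slope_nonneg: "0 \<le> slope X \<phi> p"
  by (auto simp: slope_def real_of_ereal_pos split: prod.split)

lemma slope_leI:
  assumes "x \<in> mspace X" "r > 0" "c \<ge> 0"
    and "\<And>y. y \<in> mspace X \<Longrightarrow> mdist X y x < r \<Longrightarrow> \<bar>\<phi> (t, y) - \<phi> (t, x)\<bar> \<le> c * mdist X y x"
  shows "slope X \<phi> (t, x) \<le> c" "slope_minus X \<phi> (t, x) \<le> c"
proof -
  have pos: "mdist X y x > 0" if "y \<in> mspace X" "y \<noteq> x" for y
    using assms(1) that by (metis less_eq_real_def mdist_nonneg mdist_zero)
  have q: "\<bar>\<phi> (t, y) - \<phi> (t, x)\<bar> / mdist X y x \<le> c" "max 0 (\<phi> (t, x) - \<phi> (t, y)) / mdist X y x \<le> c"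
    if "y \<in> mspace X" "y \<noteq> x" "mdist X y x < r" for y
    using pos[OF that(1,2)] assms(4)[OF that(1,3)] assms(3) by (auto simp: divide_simps)
  show "slope X \<phi> (t, x) \<le> c" unfolding slope_def prod.case
    using assms(1,2) q by (intro Limsup_pos_part_le assms) (auto simp: eventually_atin_metric)
  show "slope_minus X \<phi> (t, x) \<le> c" unfolding slope_minus_def prod.case
    using assms(1,2) q by (intro Limsup_pos_part_le assms) (auto simp: eventually_atin_metric)
qed

text \<open>The local Lipschitz property bounds the difference quotients, so that the slope is an
  honest limsup.\<close>

lemma slope_lessD:
  assumes "locally_Lipschitz (open_cyl X) \<phi>" "t > 0" "x \<in> mspace X" "slope X \<phi> (t, x) < c"
  obtains r where "r > 0"
    "\<And>y. y \<in> mspace X \<Longrightarrow> mdist X y x < r \<Longrightarrow> \<bar>\<phi> (t, y) - \<phi> (t, x)\<bar> \<le> c * mdist X y x"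
proof -
  have pos: "mdist X y x > 0" if "y \<in> mspace X" "y \<noteq> x" for y
    using assms(3) that by (metis less_eq_real_def mdist_nonneg mdist_zero)
  obtain r K where r: "r > 0" "K \<ge> 0" "\<And>s s' y y'. s\<in>{0<..} \<Longrightarrow> s'\<in>{0<..} \<Longrightarrow> y\<in>mspace X \<Longrightarrow> y'\<in>mspace X \<Longrightarrow>
     \<bar>s - t\<bar> < r \<Longrightarrow> \<bar>s' - t\<bar> < r \<Longrightarrow> mdist X y x < r \<Longrightarrow> mdist X y' x < r \<Longrightarrow>
     \<bar>\<phi> (s, y) - \<phi> (s', y')\<bar> \<le> K * (\<bar>s - s'\<bar> + mdist X y y')"
    using locally_Lipschitz_cylD[of "{0<..}" X \<phi> t x] assms by (auto simp: open_cyl_eq)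
  have x0: "mdist X x x = 0" using assms by simp
  have "\<forall>\<^sub>F y in atin (mtopology_of X) x. \<bar>\<phi> (t, y) - \<phi> (t, x)\<bar> / mdist X y x \<le> K"
    unfolding eventually_atin_metric[OF assms(3)]
    using r(3)[of t t _ x] assms(2,3) pos r(1) x0 by (intro exI[of _ r]) (auto simp: divide_simps)
  with assms(4) have "\<forall>\<^sub>F y in atin (mtopology_of X) x. \<bar>\<phi> (t, y) - \<phi> (t, x)\<bar> / mdist X y x < c"
    unfolding slope_def prod.case by (rule Limsup_pos_part_lessD)
  then obtain r where "r>0"
    "\<And>y. y \<in> mspace X \<Longrightarrow> y \<noteq> x \<Longrightarrow> mdist X y x < r \<Longrightarrow> \<bar>\<phi> (t, y) - \<phi> (t, x)\<bar> / mdist X y x < c"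
    unfolding eventually_atin_metric[OF assms(3)] by blast
  note r = this
  show ?thesis
  proof (rule that[OF r(1)])
    fix y assume y: "y \<in> mspace X" "mdist X y x < r"
    show "\<bar>\<phi> (t, y) - \<phi> (t, x)\<bar> \<le> c * mdist X y x"
      using r(2)[OF y(1) _ y(2)] pos[OF y(1)] x0 by (cases "y = x") (auto simp: divide_simps)
  qed
qed

lemma less_slope_minusD:
  assumes "x \<in> mspace X" "c < slope_minus X \<phi> (t, x)" "c \<ge> 0" "r > 0"
  obtains y where "y \<in> mspace X" "y \<noteq> x" "mdist X y x < r" "\<phi> (t, x) - \<phi> (t, y) > c * mdist X y x"
proof -
  have "\<exists>\<^sub>F y in atin (mtopology_of X) x. max 0 (\<phi> (t, x) - \<phi> (t, y)) / mdist X y x > c"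
    using assms(2,3) unfolding slope_minus_def prod.case by (rule less_Limsup_pos_partD)
  then obtain y where y: "y \<in> mspace X" "y \<noteq> x" "mdist X y x < r" "c < max 0 (\<phi> (t, x) - \<phi> (t, y)) / mdist X y x"
    unfolding frequently_def eventually_atin_metric[OF assms(1)] using assms(4) by blast
  moreover have "mdist X y x > 0"
    using assms(1) y by (metis less_eq_real_def mdist_nonneg mdist_zero)
  ultimately have "c * mdist X y x < max 0 (\<phi> (t, x) - \<phi> (t, y))" by (simp add: divide_simps split: if_splits)
  moreover have "c * mdist X y x \<ge> 0" using assms by simp
  ultimately show ?thesis using that y by (auto simp: max_def split: if_splits)
qed

lemma slope_minus_geI:
  assumes "x \<in> mspace X" "\<rho> > 0"
    and "\<And>y. y \<in> mspace X \<Longrightarrow> mdist X y x < \<rho> \<Longrightarrow> \<bar>\<phi> (t, y) - \<phi> (t, x)\<bar> \<le> K * mdist X y x"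
    and "\<And>r. r > 0 \<Longrightarrow> \<exists>y\<in>mspace X. y \<noteq> x \<and> mdist X y x < r \<and> \<phi> (t, x) - \<phi> (t, y) \<ge> c * mdist X y x"
  shows "c \<le> slope_minus X \<phi> (t, x)"
  unfolding slope_minus_def prod.case
proof (rule le_Limsup_pos_part)
  have pos: "mdist X y x > 0" if "y \<in> mspace X" "y \<noteq> x" for y
    using assms(1) that by (metis less_eq_real_def mdist_nonneg mdist_zero)
  have K: "max 0 (\<phi> (t, x) - \<phi> (t, y)) / mdist X y x \<le> K"
    if "y \<in> mspace X" "y \<noteq> x" "mdist X y x < \<rho>" for y
    using assms(3)[OF that(1,3)] pos[OF that(1,2)] by (auto simp: divide_simps)
  show "\<forall>\<^sub>F y in atin (mtopology_of X) x. max 0 (\<phi> (t, x) - \<phi> (t, y)) / mdist X y x \<le> K"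
    unfolding eventually_atin_metric[OF assms(1)] using assms(2) K by blast
  show "\<exists>\<^sub>F y in atin (mtopology_of X) x. c \<le> max 0 (\<phi> (t, x) - \<phi> (t, y)) / mdist X y x"
    unfolding frequently_def eventually_atin_metric[OF assms(1)]
  proof (clarsimp simp: not_le)
    fix r :: real assume "r > 0"
    then obtain y where y: "y\<in>mspace X" "y \<noteq> x" "mdist X y x < r" "\<phi> (t, x) - \<phi> (t, y) \<ge> c * mdist X y x"
      using assms(4) by blast
    then show "\<exists>y\<in>mspace X. y \<noteq> x \<and> mdist X y x < r \<and> \<not> max 0 (\<phi> (t, x) - \<phi> (t, y)) / mdist X y x < c"
      using pos[OF y(1,2)] by (intro bexI[of _ y]) (auto simp: divide_simps not_less)
  qed
qed

lemma geodesicD: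
  assumes "geodesic_space X" "x \<in> mspace X" "y \<in> mspace X"
  obtains \<gamma> where "\<gamma> 0 = x" "\<gamma> 1 = y" "\<And>s. s \<in> {0..1} \<Longrightarrow> \<gamma> s \<in> mspace X"
    "\<And>s t. s \<in> {0..1} \<Longrightarrow> t \<in> {0..1} \<Longrightarrow> mdist X (\<gamma> s) (\<gamma> t) = \<bar>s - t\<bar> * mdist X x y"
proof -
  obtain \<gamma> where g: "continuous_map (top_of_set {0..1::real}) (mtopology_of X) \<gamma>" "\<gamma> 0 = x" "\<gamma> 1 = y"
     "\<forall>s\<in>{0..1}. \<forall>t\<in>{0..1}. mdist X (\<gamma> s) (\<gamma> t) = \<bar>s - t\<bar> * mdist X x y"
    using assms unfolding geodesic_space_def by meson
  have "\<gamma> s \<in> mspace X" if "s \<in> {0..1}" for s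
    using continuous_map_funspace[OF g(1)] that by auto
  with g that show ?thesis by blast
qed

text \<open>A pointwise slope bound integrates along a geodesic: near each of its points the
  increment is at most \<open>c + e\<close> times the length, and interval bisection glues these
  local estimates. A geodesic between two points of the half ball stays in the full ball.\<close>

lemma Lipschitz_of_slope_bound:
  assumes X: "geodesic_space X" and lip: "locally_Lipschitz (open_cyl X) \<phi>" and t: "t > 0"
    and "x0 \<in> mspace X" "x \<in> mspace X" "y \<in> mspace X"
    and "mdist X x x0 < \<rho> / 2" "mdist X y x0 < \<rho> / 2"
    and bound: "\<And>z. z \<in> mspace X \<Longrightarrow> mdist X z x0 < \<rho> \<Longrightarrow> slope X \<phi> (t, z) \<le> c"
  shows "\<bar>\<phi> (t, x) - \<phi> (t, y)\<bar> \<le> c * mdist X x y"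
proof -
  obtain \<gamma> where g: "\<gamma> 0 = x" "\<gamma> 1 = y" "\<And>s. s \<in> {0..1} \<Longrightarrow> \<gamma> s \<in> mspace X"
    "\<And>s t. s \<in> {0..1} \<Longrightarrow> t \<in> {0..1} \<Longrightarrow> mdist X (\<gamma> s) (\<gamma> t) = \<bar>s - t\<bar> * mdist X x y"
    using geodesicD[OF X assms(5,6)] by blast
  define D where "D = mdist X x y"
  have D0: "D \<ge> 0" by (simp add: D_def)
  \<comment> \<open>The distances of \<open>\<gamma> s\<close> to \<open>x\<close> and
    \<open>y\<close> add up to \<open>D\<close>, so the two triangle inequalities sum to at most
    \<open>D\<close> plus the two distances to \<open>x0\<close>, which is below 2 \<rho>.\<close>
  have near: "mdist X (\<gamma> s) x0 < \<rho>" if s: "s \<in> {0..1}" for s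
  proof -
    have "mdist X (\<gamma> s) x0 \<le> mdist X (\<gamma> s) x + mdist X x x0" "mdist X (\<gamma> s) x0 \<le> mdist X (\<gamma> s) y + mdist X y x0"
      by (rule mdist_triangle[OF g(3)[OF s]]; use assms in simp)+
    moreover have "mdist X (\<gamma> s) x + mdist X (\<gamma> s) y = D"
      using g(4)[OF s, of 0] g(4)[OF s, of 1] g(1,2) s by (simp add: D_def algebra_simps)
    moreover have "D \<le> mdist X x x0 + mdist X y x0"
      unfolding D_def using mdist_triangle[of x X x0 y] assms by (simp add: mdist_commute)
    ultimately show ?thesis using assms(7,8) by linarith
  qed
  have main: "\<bar>\<phi> (t, x) - \<phi> (t, y)\<bar> \<le> (c + e) * D" if e: "e > 0" for e
  proof -
    \<comment> \<open>\<open>Bolzano\<close> also tests intervals that reach outside [0, 1], where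
      nothing is known about \<gamma>; there \<open>P\<close> holds vacuously.\<close>
    define P where "P = (\<lambda>a b. 0 \<le> a \<longrightarrow> b \<le> 1 \<longrightarrow> \<bar>\<phi> (t, \<gamma> b) - \<phi> (t, \<gamma> a)\<bar> \<le> (c + e) * D * (b - a))"
    have "P 0 1"
    proof (rule Bolzano)
      fix a b d assume "P a b" "P b d" "a \<le> b" "b \<le> d"
      show "P a d"
        unfolding P_def
      proof (intro impI)
        assume "0 \<le> a" "d \<le> 1"
        with \<open>P a b\<close> \<open>P b d\<close> \<open>a \<le> b\<close> \<open>b \<le> d\<close>
        have "\<bar>\<phi> (t, \<gamma> b) - \<phi> (t, \<gamma> a)\<bar> \<le> (c + e) * D * (b - a)" "\<bar>\<phi> (t, \<gamma> d) - \<phi> (t, \<gamma> b)\<bar> \<le> (c + e) * D * (d - b)"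
          by (auto simp: P_def)
        then have "\<bar>\<phi> (t, \<gamma> d) - \<phi> (t, \<gamma> a)\<bar> \<le> (c + e) * D * (b - a) + (c + e) * D * (d - b)" by linarith
        also have "\<dots> = (c + e) * D * (d - a)" by (simp add: algebra_simps)
        finally show "\<bar>\<phi> (t, \<gamma> d) - \<phi> (t, \<gamma> a)\<bar> \<le> (c + e) * D * (d - a)" .
      qed
    next
      fix s :: real assume "0 \<le> s" "s \<le> 1"
      then have s: "s \<in> {0..1}" by simp
      have "slope X \<phi> (t, \<gamma> s) < c + e" using bound[OF g(3)[OF s] near[OF s]] e by simp
      then obtain r where r: "r > 0"
        "\<And>z. z \<in> mspace X \<Longrightarrow> mdist X z (\<gamma> s) < r \<Longrightarrow> \<bar>\<phi> (t, z) - \<phi> (t, \<gamma> s)\<bar> \<le> (c + e) * mdist X z (\<gamma> s)"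
        using slope_lessD[OF lip t g(3)[OF s]] by blast
      \<comment> \<open>Dividing by \<open>D + 1\<close> instead of \<open>D\<close> covers the
        degenerate case \<open>x = y\<close>.\<close>
      have q: "\<bar>\<phi> (t, \<gamma> b) - \<phi> (t, \<gamma> s)\<bar> \<le> (c + e) * D * \<bar>b - s\<bar>" if "b \<in> {0..1}" "\<bar>b - s\<bar> < r / (D + 1)" for b
      proof -
        have "\<bar>b - s\<bar> * (D + 1) < r" using that(2) D0 by (simp add: field_simps)
        then have "\<bar>b - s\<bar> * D < r" using D0 by (simp add: algebra_simps)
        then show ?thesis using r(2)[OF g(3)[OF that(1)]] g(4)[OF that(1) s] by (simp add: D_def mult.commute mult.left_commute)
      qed
      show "\<exists>d>0. \<forall>a b. a \<le> s \<and> s \<le> b \<and> b - a < d \<longrightarrow> P a b" unfolding P_def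
      proof (intro exI[of _ "r / (D + 1)"] conjI allI impI)
        show "r / (D + 1) > 0" using r D0 by simp
        fix a b assume *: "a \<le> s \<and> s \<le> b \<and> b - a < r / (D + 1)" "0 \<le> a" "b \<le> 1"
        have "\<bar>\<phi> (t, \<gamma> b) - \<phi> (t, \<gamma> s)\<bar> \<le> (c + e) * D * (b - s)" "\<bar>\<phi> (t, \<gamma> a) - \<phi> (t, \<gamma> s)\<bar> \<le> (c + e) * D * (s - a)"
          using q[of a] q[of b] * s by auto
        then have "\<bar>\<phi> (t, \<gamma> b) - \<phi> (t, \<gamma> a)\<bar> \<le> (c + e) * D * (b - s) + (c + e) * D * (s - a)" by linarith
        also have "\<dots> = (c + e) * D * (b - a)" by (simp add: algebra_simps)
        finally show "\<bar>\<phi> (t, \<gamma> b) - \<phi> (t, \<gamma> a)\<bar> \<le> (c + e) * D * (b - a)" .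
      qed
    qed simp
    then show ?thesis using g(1,2) by (simp add: P_def abs_minus_commute)
  qed
  show ?thesis
  proof (rule field_le_epsilon)
    fix e :: real assume "e > 0"
    have "e / (D + 1) * D \<le> e" using D0 \<open>e > 0\<close> by (simp add: field_simps)
    then show "\<bar>\<phi> (t, x) - \<phi> (t, y)\<bar> \<le> c * mdist X x y + e"
      using main[of "e / (D + 1)"] D0 \<open>e > 0\<close> unfolding D_def[symmetric] by (simp add: distrib_right)
  qed
qed

text \<open>Mean value inequality for the map \<open>\<lambda>s. \<phi> (s, x) - a * s\<close>,
  whose derivative is at most \<delta> in absolute value between \<open>t0\<close> and
  \<open>t\<close>.\<close>

lemma dt_linearization:
  assumes "continuous_dt X \<phi>" "x \<in> mspace X"
    and "\<And>s. \<bar>s - t0\<bar> \<le> \<bar>t - t0\<bar> \<Longrightarrow> s > 0 \<and> \<bar>dt \<phi> (s, x) - a\<bar> \<le> \<delta>"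
  shows "\<bar>\<phi> (t, x) - \<phi> (t0, x) - a * (t - t0)\<bar> \<le> \<delta> * \<bar>t - t0\<bar>"
proof -
  let ?g = "\<lambda>s. \<phi> (s, x) - a * s"
  have d: "(?g has_field_derivative dt \<phi> (s, x) - a) (at s within cball t0 \<bar>t - t0\<bar>)"
    if "s \<in> cball t0 \<bar>t - t0\<bar>" for s
  proof -
    have "s > 0" using assms(3)[of s] that by (auto simp: dist_real_def abs_minus_commute)
    then have "(\<lambda>s. \<phi> (s, x)) differentiable (at s)"
      using assms(1,2) by (auto simp: continuous_dt_def open_cyl_eq)
    then have "((\<lambda>s. \<phi> (s, x)) has_field_derivative dt \<phi> (s, x)) (at s)"
      by (simp add: dt_def DERIV_deriv_iff_real_differentiable)
    then have "(?g has_field_derivative dt \<phi> (s, x) - a) (at s)"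
      by (auto intro!: derivative_eq_intros)
    then show ?thesis by (rule has_field_derivative_at_within)
  qed
  have "norm (?g t - ?g t0) \<le> \<delta> * norm (t - t0)"
    using assms(3) by (intro field_differentiable_bound[OF convex_cball d])
      (auto simp: dist_real_def abs_minus_commute)
  then show ?thesis by (simp add: algebra_simps)
qed

lemma Limsup_pos_part_mono:
  assumes "\<forall>\<^sub>F y in F. q y \<le> q' y" "\<forall>\<^sub>F y in F. q' y \<le> K"
  shows "real_of_ereal (max 0 (Limsup F (\<lambda>y. ereal (q y)))) \<le> real_of_ereal (max 0 (Limsup F (\<lambda>y. ereal (q' y))))"
proof -
  have "Limsup F (\<lambda>y. ereal (q' y)) \<le> ereal K"
    using assms(2) by (intro Limsup_bounded) (auto elim: eventually_mono)
  moreover have "Limsup F (\<lambda>y. ereal (q y)) \<le> Limsup F (\<lambda>y. ereal (q' y))"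
    using assms(1) by (intro Limsup_mono) (auto elim: eventually_mono)
  ultimately show ?thesis
    by (cases "Limsup F (\<lambda>y. ereal (q y))"; cases "Limsup F (\<lambda>y. ereal (q' y))") (auto simp: max_def)
qed

lemma slope_minus_le_slope:
  assumes "x \<in> mspace X" "r > 0"
    and "\<And>y. y \<in> mspace X \<Longrightarrow> mdist X y x < r \<Longrightarrow> \<bar>\<phi> (t, y) - \<phi> (t, x)\<bar> \<le> K * mdist X y x"
  shows "slope_minus X \<phi> (t, x) \<le> slope X \<phi> (t, x)"
proof -
  have "\<bar>\<phi> (t, y) - \<phi> (t, x)\<bar> / mdist X y x \<le> K" if "y \<in> mspace X" "y \<noteq> x" "mdist X y x < r" for y
  proof -
    have "mdist X y x > 0" using assms(1) that by (metis less_eq_real_def mdist_nonneg mdist_zero)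
    then show ?thesis using assms(3)[OF that(1,3)] by (simp add: divide_simps)
  qed
  then have "\<forall>\<^sub>F y in atin (mtopology_of X) x. \<bar>\<phi> (t, y) - \<phi> (t, x)\<bar> / mdist X y x \<le> K"
    unfolding eventually_atin_metric[OF assms(1)] using assms(2) by blast
  then show ?thesis
    unfolding slope_minus_def slope_def prod.case
    by (intro Limsup_pos_part_mono) (auto intro!: always_eventually divide_right_mono)
qed

section \<open>Envelopes of functions and of slopes\<close>

lemma nhdsin_self:
  assumes "p \<in> mspace C" "eventually P (nhdsin (mtopology_of C) p)" shows "P p"
  using assms by (auto simp: eventually_nhdsin)

lemma upper_env_ge: "p \<in> mspace C \<Longrightarrow> ereal (f p) \<le> upper_env C f p"
  unfolding upper_env_def Limsup_def
  by (auto intro!: INF_greatest SUP_upper dest: nhdsin_self)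

lemma upper_env_le:
  assumes "\<forall>\<^sub>F q in nhdsin (mtopology_of C) p. f q \<le> c"
  shows "upper_env C f p \<le> ereal c"
  unfolding upper_env_def by (rule Limsup_bounded) (use assms in \<open>auto elim: eventually_mono\<close>)

lemma slope_env_nonneg: "p \<in> mspace (open_cyl X) \<Longrightarrow> 0 \<le> slope_env X \<phi> p"
  using upper_env_ge[of p "open_cyl X" "slope X \<phi>"] slope_nonneg[of X \<phi> p]
  unfolding slope_env_def by (metis ereal_less_eq(5) order_trans real_of_ereal_pos)

lemma slope_env_le:
  assumes "p \<in> mspace (open_cyl X)" "\<And>q. q \<in> mspace (open_cyl X) \<Longrightarrow> slope X \<phi> q \<le> c"
  shows "slope_env X \<phi> p \<le> c"
proof -
  have "upper_env (open_cyl X) (slope X \<phi>) p \<le> ereal c"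
    by (rule upper_env_le, subst eventually_nhdsin_metric) (use assms in \<open>auto intro: exI[of _ 1]\<close>)
  moreover have "0 \<le> c" using assms(2)[OF assms(1)] slope_nonneg[of X \<phi> p] by linarith
  ultimately show ?thesis
    unfolding slope_env_def by (cases "upper_env (open_cyl X) (slope X \<phi>) p") auto
qed

text \<open>Near \<open>(t, x)\<close> all slopes are bounded by the Lipschitz constant, so the
  envelope is finite and its real value can be compared with \<open>c\<close>.\<close>

lemma slope_env_lessD:
  assumes lip: "locally_Lipschitz (open_cyl X) \<phi>" and "t > 0" "x \<in> mspace X" "slope_env X \<phi> (t, x) < c"
  obtains r where "r > 0"
    "\<And>s y. s > 0 \<Longrightarrow> y \<in> mspace X \<Longrightarrow> \<bar>s - t\<bar> < r \<Longrightarrow> mdist X y x < r \<Longrightarrow> slope X \<phi> (s, y) < c"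
proof -
  let ?N = "nhdsin (mtopology_of (open_cyl X)) (t, x)"
  obtain r K where r: "r > 0" "K \<ge> 0" "\<And>s s' y y'. s\<in>{0<..} \<Longrightarrow> s'\<in>{0<..} \<Longrightarrow> y\<in>mspace X \<Longrightarrow> y'\<in>mspace X \<Longrightarrow>
     \<bar>s - t\<bar> < r \<Longrightarrow> \<bar>s' - t\<bar> < r \<Longrightarrow> mdist X y x < r \<Longrightarrow> mdist X y' x < r \<Longrightarrow>
     \<bar>\<phi> (s, y) - \<phi> (s', y')\<bar> \<le> K * (\<bar>s - s'\<bar> + mdist X y y')"
    using locally_Lipschitz_cylD[of "{0<..}" X \<phi> t x] assms by (auto simp: open_cyl_eq)
  have K: "slope X \<phi> (s, y) \<le> K" if "s > 0" "y \<in> mspace X" "\<bar>s - t\<bar> < r/2" "mdist X y x < r/2" for s y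
  proof (rule slope_leI(1)[of y X "r/2" K \<phi> s, OF that(2)])
    fix y' assume y': "y' \<in> mspace X" "mdist X y' y < r / 2"
    have "mdist X y' x < r" using mdist_triangle[OF y'(1) that(2) assms(3)] y'(2) that(4) by linarith
    then show "\<bar>\<phi> (s, y') - \<phi> (s, y)\<bar> \<le> K * mdist X y' y"
      using r(3)[of s s y' y] that y' r(1) by auto
  qed (use r in auto)
  have "\<forall>\<^sub>F q in ?N. slope X \<phi> q \<le> K"
    unfolding open_cyl_eq using K assms(2,3) r(1) by (subst eventually_nhdsin_cyl) (auto intro!: exI[of _ "r/2"])
  then have le: "upper_env (open_cyl X) (slope X \<phi>) (t, x) \<le> ereal K" by (rule upper_env_le)
  moreover have "ereal 0 \<le> upper_env (open_cyl X) (slope X \<phi>) (t, x)"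
    using upper_env_ge[of "(t,x)" "open_cyl X" "slope X \<phi>"] slope_nonneg[of X \<phi> "(t,x)"] assms
    by (simp add: open_cyl_eq order_trans[of 0 "ereal (slope X \<phi> (t, x))"] zero_ereal_def[symmetric])
  ultimately have "upper_env (open_cyl X) (slope X \<phi>) (t, x) < ereal c"
    using assms(4) unfolding slope_env_def by (cases "upper_env (open_cyl X) (slope X \<phi>) (t, x)") auto
  then have "\<forall>\<^sub>F q in ?N. ereal (slope X \<phi> q) < ereal c"
    unfolding upper_env_def by (rule Limsup_lessD)
  then show ?thesis using that assms(2,3) unfolding open_cyl_eq
    by (subst (asm) eventually_nhdsin_cyl) auto
qed

section \<open>Distance functions as test functions\<close>

text \<open>The square, not the distance itself, serves as first component. For nonnegative
  \<open>A\<close> in a geodesic space its slope is continuous also at \<open>z\<close> and is a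
  descending slope everywhere, whereas a cone over a space with more than one point has slope 1 but
  descending slope 0 at its vertex.\<close>

definition sq_dist_fun :: "'a metric \<Rightarrow> real \<Rightarrow> 'a \<Rightarrow> real \<times> 'a \<Rightarrow> real" where
  "sq_dist_fun X A z = (\<lambda>(t, x). A * (mdist X x z)\<^sup>2)"

text \<open>Serves as second component, where no condition relates slope and descending slope, so
  that the cone is admissible. Its slope is at most \<open>B\<close> even at the vertex
  \<open>w\<close>, and \<open>h\<close> carries the time dependence of the whole pair.\<close>

definition time_dist_fun :: "'a metric \<Rightarrow> (real \<Rightarrow> real) \<Rightarrow> real \<Rightarrow> 'a \<Rightarrow> real \<times> 'a \<Rightarrow> real" where
  "time_dist_fun X h B w = (\<lambda>(t, x). h t + B * mdist X x w)"

lemma mdist_diff_le: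
  assumes "x \<in> mspace X" "y \<in> mspace X" "z \<in> mspace X"
  shows "\<bar>mdist X x z - mdist X y z\<bar> \<le> mdist X x y"
  using mdist_triangle[of x X y z] mdist_triangle[of y X x z] assms
  by (simp add: mdist_commute)

lemma sq_mdist_diff_le:
  assumes "x \<in> mspace X" "y \<in> mspace X" "z \<in> mspace X"
  shows "\<bar>(mdist X x z)\<^sup>2 - (mdist X y z)\<^sup>2\<bar> \<le> mdist X x y * (mdist X x z + mdist X y z)"
proof -
  have "\<bar>(mdist X x z)\<^sup>2 - (mdist X y z)\<^sup>2\<bar> = \<bar>mdist X x z - mdist X y z\<bar> * (mdist X x z + mdist X y z)"
    by (simp add: power2_eq_square square_diff_square_factored abs_mult mult.commute)
  also have "\<dots> \<le> mdist X x y * (mdist X x z + mdist X y z)"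
    using mdist_diff_le[OF assms] by (intro mult_right_mono) auto
  finally show ?thesis .
qed

text \<open>The upper bounds come from the triangle inequality alone. The lower bound needs a
  geodesic: moving from \<open>x\<close> towards \<open>z\<close> decreases the distance to
  \<open>z\<close> at full rate.\<close>

lemma slope_sq_dist_fun:
  assumes X: "geodesic_space X" and A: "A \<ge> 0" and "x \<in> mspace X" "z \<in> mspace X"
  shows "slope X (sq_dist_fun X A z) (t, x) = 2 * A * mdist X x z" (is ?s)
    and "slope_minus X (sq_dist_fun X A z) (t, x) = 2 * A * mdist X x z" (is ?m)
proof -
  let ?\<phi> = "sq_dist_fun X A z" let ?d = "mdist X x z"
  have near: "\<bar>?\<phi> (t, y) - ?\<phi> (t, x)\<bar> \<le> A * (2 * ?d + r) * mdist X y x"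
    if "y \<in> mspace X" "mdist X y x < r" for y r
  proof -
    have "\<bar>?\<phi> (t, y) - ?\<phi> (t, x)\<bar> = A * \<bar>(mdist X y z)\<^sup>2 - ?d\<^sup>2\<bar>"
      using A by (simp add: sq_dist_fun_def abs_mult flip: right_diff_distrib)
    also have "\<dots> \<le> A * (mdist X y x * (mdist X y z + ?d))"
      using sq_mdist_diff_le[OF that(1) assms(3,4)] A by (rule mult_left_mono)
    also have "\<dots> \<le> A * (mdist X y x * (2 * ?d + r))"
      using mdist_triangle[OF that(1) assms(3,4)] that(2) A by (intro mult_left_mono) auto
    finally show ?thesis by (simp add: mult.commute mult.left_commute)
  qed
  have up: "slope X ?\<phi> (t, x) \<le> 2 * A * ?d + A * e \<and> slope_minus X ?\<phi> (t, x) \<le> 2 * A * ?d + A * e" if "e > 0" for e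
  proof -
    have *: "A * (2 * ?d + e) = 2 * A * ?d + A * e" by (simp add: algebra_simps)
    have n: "\<bar>?\<phi> (t, y) - ?\<phi> (t, x)\<bar> \<le> (2 * A * ?d + A * e) * mdist X y x"
      if "y \<in> mspace X" "mdist X y x < e" for y
      using near[of y e] that * by simp
    show ?thesis
      using slope_leI[OF assms(3) that _ n] A that by simp
  qed
  have up': "c \<le> 2 * A * ?d" if c: "\<And>e. e > 0 \<Longrightarrow> c \<le> 2 * A * ?d + A * e" for c
  proof (rule field_le_epsilon)
    fix e :: real assume "e > 0"
    have "A * (e / (A + 1)) \<le> e" using A \<open>e > 0\<close> by (simp add: field_simps)
    then show "c \<le> 2 * A * ?d + e" using c[of "e / (A + 1)"] A \<open>e > 0\<close> by simp
  qed
  have lo: "2 * A * ?d - e \<le> slope_minus X ?\<phi> (t, x)" if "e > 0" "?d > 0" for e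
  proof (rule slope_minus_geI[where \<rho> = 1 and K = "A * (2 * mdist X x z + 1)", OF assms(3)])
    fix r :: real assume r: "r > 0"
    obtain \<gamma> where g: "\<gamma> 0 = x" "\<gamma> 1 = z" "\<And>s. s \<in> {0..1} \<Longrightarrow> \<gamma> s \<in> mspace X"
      "\<And>s t. s \<in> {0..1} \<Longrightarrow> t \<in> {0..1} \<Longrightarrow> mdist X (\<gamma> s) (\<gamma> t) = \<bar>s - t\<bar> * mdist X x z"
      using geodesicD[OF X assms(3,4)] by blast
    \<comment> \<open>The first entry keeps \<open>\<gamma> s\<close> inside the geodesic, the
      second brings it within \<open>r\<close> of \<open>x\<close>, the third makes the second-order
      loss in the difference quotient at most \<open>e\<close>.\<close>
    define s where "s = min (1/2) (min (r / (2 * ?d)) (e / ((A + 1) * ?d)))"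
    have s: "s > 0" "s \<le> 1/2" "s * ?d < r" "A * (s * ?d) \<le> e"
    proof -
      show "s > 0" using r that A by (simp add: s_def)
      show "s \<le> 1/2" unfolding s_def by (rule min.cobounded1)
      have "s \<le> r / (2 * ?d)" "s \<le> e / ((A + 1) * ?d)" by (auto simp: s_def)
      then have *: "s * (2 * ?d) \<le> r" "s * ((A + 1) * ?d) \<le> e" using that A by (simp_all add: pos_le_divide_eq)
      from *(1) show "s * ?d < r" using r by (simp add: algebra_simps)
      from *(2) show "A * (s * ?d) \<le> e" using mult_pos_pos[OF \<open>s > 0\<close> that(2)] by (simp add: algebra_simps)
    qed
    have d: "mdist X (\<gamma> s) x = s * ?d" "mdist X (\<gamma> s) z = (1 - s) * ?d" "\<gamma> s \<in> mspace X"
      using g(4)[of s 0] g(4)[of s 1] g(1,2) g(3)[of s] s by auto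
    show "\<exists>y\<in>mspace X. y \<noteq> x \<and> mdist X y x < r \<and> (2 * A * ?d - e) * mdist X y x \<le> ?\<phi> (t, x) - ?\<phi> (t, y)"
    proof (intro bexI[of _ "\<gamma> s"] conjI)
      show "\<gamma> s \<noteq> x"
      proof
        assume "\<gamma> s = x"
        then have "mdist X (\<gamma> s) x = 0" using assms(3) by simp
        then show False unfolding d(1) using s(1) that(2) by simp
      qed
      have "?\<phi> (t, x) - ?\<phi> (t, \<gamma> s) = (2 * A * ?d - A * (s * ?d)) * (s * ?d)"
        unfolding sq_dist_fun_def by (simp add: d power2_eq_square algebra_simps)
      also have "\<dots> \<ge> (2 * A * ?d - e) * (s * ?d)"
        using s that by (intro mult_right_mono) auto
      finally show "(2 * A * ?d - e) * mdist X (\<gamma> s) x \<le> ?\<phi> (t, x) - ?\<phi> (t, \<gamma> s)" using d by simp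
    qed (use d s in auto)
  qed (use near[of _ 1] in auto)
  have lo': "2 * A * ?d \<le> slope_minus X ?\<phi> (t, x)"
  proof (cases "?d > 0")
    case True
    show ?thesis
    proof (rule field_le_epsilon)
      fix e :: real assume "e > 0"
      then show "2 * A * ?d \<le> slope_minus X ?\<phi> (t, x) + e" using lo[OF _ True, of e] by linarith
    qed
  next
    case False
    then have "?d = 0" using mdist_nonneg[of X x z] by linarith
    then show ?thesis by (auto simp: slope_minus_def real_of_ereal_pos)
  qed
  have le: "slope_minus X ?\<phi> (t, x) \<le> 2 * A * ?d" "slope X ?\<phi> (t, x) \<le> 2 * A * ?d"
    by (rule up', use up in blast)+
  show ?m using le lo' by simp
  have "slope_minus X ?\<phi> (t, x) \<le> slope X ?\<phi> (t, x)"
    by (rule slope_minus_le_slope[where r = 1 and K = "A * (2 * mdist X x z + 1)", OF assms(3)]) (use near[of _ 1] in auto)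
  then show ?s using le lo' by simp
qed

lemma locally_Lipschitz_sq_dist_fun:
  assumes "z \<in> mspace X"
  shows "locally_Lipschitz (cyl S X) (sq_dist_fun X A z)"
proof (rule locally_Lipschitz_cylI)
  fix t x assume tx: "t \<in> S" "x \<in> mspace X"
  have "\<bar>A * (mdist X y z)\<^sup>2 - A * (mdist X y' z)\<^sup>2\<bar> \<le> \<bar>A\<bar> * (2 * mdist X x z + 2) * (\<bar>s - s'\<bar> + mdist X y y')"
    if "y \<in> mspace X" "y' \<in> mspace X" "mdist X y x < 1" "mdist X y' x < 1" for s s' y y'
  proof -
    have "\<bar>A * (mdist X y z)\<^sup>2 - A * (mdist X y' z)\<^sup>2\<bar> = \<bar>A\<bar> * \<bar>(mdist X y z)\<^sup>2 - (mdist X y' z)\<^sup>2\<bar>"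
      by (simp add: abs_mult flip: right_diff_distrib)
    also have "\<dots> \<le> \<bar>A\<bar> * (mdist X y y' * (mdist X y z + mdist X y' z))"
      using sq_mdist_diff_le[OF that(1,2) assms] by (intro mult_left_mono) auto
    also have "\<dots> \<le> \<bar>A\<bar> * ((\<bar>s - s'\<bar> + mdist X y y') * (2 * mdist X x z + 2))"
      using mdist_triangle[OF that(1) tx(2) assms] mdist_triangle[OF that(2) tx(2) assms] that
      by (intro mult_left_mono mult_mono) auto
    finally show ?thesis by (simp add: mult.commute mult.left_commute)
  qed
  then show "\<exists>r>0. \<exists>K. \<forall>s\<in>S. \<forall>s'\<in>S. \<forall>y\<in>mspace X. \<forall>y'\<in>mspace X. \<bar>s - t\<bar> < r \<longrightarrow> \<bar>s' - t\<bar> < r \<longrightarrow>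
      mdist X y x < r \<longrightarrow> mdist X y' x < r \<longrightarrow>
      \<bar>sq_dist_fun X A z (s, y) - sq_dist_fun X A z (s', y')\<bar> \<le> K * (\<bar>s - s'\<bar> + mdist X y y')"
    by (intro exI[of _ 1] conjI exI[of _ "\<bar>A\<bar> * (2 * mdist X x z + 2)"]) (auto simp: sq_dist_fun_def)
qed

lemma locally_Lipschitz_time_dist_fun:
  assumes "w \<in> mspace X" and h: "\<And>t. (h has_real_derivative h' t) (at t)" "continuous_on UNIV h'"
  shows "locally_Lipschitz (cyl S X) (time_dist_fun X h B w)"
proof (rule locally_Lipschitz_cylI)
  fix t x assume tx: "t \<in> S" "x \<in> mspace X"
  \<comment> \<open>A continuous derivative is bounded on a compact interval, which makes
    \<open>h\<close> Lipschitz near \<open>t\<close>.\<close>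
  have "bounded (h' ` cball t 1)"
    by (intro compact_imp_bounded compact_continuous_image continuous_on_subset[OF h(2)]) auto
  then obtain K where "\<forall>s\<in>cball t 1. \<bar>h' s\<bar> \<le> K"
    by (auto simp: bounded_iff)
  then have K: "\<And>s. s \<in> cball t 1 \<Longrightarrow> \<bar>h' s\<bar> \<le> K" by blast
  have hK: "\<bar>h s - h s'\<bar> \<le> K * \<bar>s - s'\<bar>" if "s \<in> cball t 1" "s' \<in> cball t 1" for s s'
  proof -
    have "norm (h s - h s') \<le> K * norm (s - s')"
      by (rule field_differentiable_bound[OF convex_cball, of t 1 h h'])
        (use that K in \<open>auto intro: has_field_derivative_at_within[OF h(1)]\<close>)
    then show ?thesis by simp
  qed
  have "\<bar>h s + B * mdist X y w - (h s' + B * mdist X y' w)\<bar> \<le> (\<bar>K\<bar> + \<bar>B\<bar>) * (\<bar>s - s'\<bar> + mdist X y y')"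
    if "y \<in> mspace X" "y' \<in> mspace X" "\<bar>s - t\<bar> < 1" "\<bar>s' - t\<bar> < 1" for s s' y y'
  proof -
    have "\<bar>B * mdist X y w - B * mdist X y' w\<bar> = \<bar>B\<bar> * \<bar>mdist X y w - mdist X y' w\<bar>"
      by (simp add: abs_mult flip: right_diff_distrib)
    also have "\<dots> \<le> \<bar>B\<bar> * mdist X y y'"
      using mdist_diff_le[OF that(1,2) assms(1)] by (intro mult_left_mono) auto
    finally have "\<bar>h s + B * mdist X y w - (h s' + B * mdist X y' w)\<bar> \<le> \<bar>h s - h s'\<bar> + \<bar>B\<bar> * mdist X y y'"
      by linarith
    also have "\<dots> \<le> \<bar>K\<bar> * \<bar>s - s'\<bar> + \<bar>B\<bar> * mdist X y y'"
      using hK[of s s'] that mult_right_mono[OF abs_ge_self[of K] abs_ge_zero, of "s - s'"]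
      by (auto simp: dist_real_def abs_minus_commute)
    also have "\<dots> \<le> (\<bar>K\<bar> + \<bar>B\<bar>) * (\<bar>s - s'\<bar> + mdist X y y')"
      by (simp add: algebra_simps)
    finally show ?thesis .
  qed
  then show "\<exists>r>0. \<exists>K. \<forall>s\<in>S. \<forall>s'\<in>S. \<forall>y\<in>mspace X. \<forall>y'\<in>mspace X. \<bar>s - t\<bar> < r \<longrightarrow> \<bar>s' - t\<bar> < r \<longrightarrow>
      mdist X y x < r \<longrightarrow> mdist X y' x < r \<longrightarrow>
      \<bar>time_dist_fun X h B w (s, y) - time_dist_fun X h B w (s', y')\<bar> \<le> K * (\<bar>s - s'\<bar> + mdist X y y')"
    by (intro exI[of _ 1] conjI exI[of _ "\<bar>K\<bar> + \<bar>B\<bar>"]) (auto simp: time_dist_fun_def)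
qed

lemma slope_time_dist_fun_le:
  assumes "w \<in> mspace X" "B \<ge> 0" "q \<in> mspace (open_cyl X)"
  shows "slope X (time_dist_fun X h B w) q \<le> B"
proof -
  obtain t x where q: "q = (t, x)" "x \<in> mspace X" using assms(3) by (auto simp: open_cyl_eq)
  have "\<bar>B * mdist X y w - B * mdist X x w\<bar> \<le> B * mdist X y x" if "y \<in> mspace X" for y
    using mdist_diff_le[OF that q(2) assms(1)] assms(2) mult_left_mono[of "\<bar>mdist X y w - mdist X x w\<bar>" "mdist X y x" B]
    by (simp add: abs_mult flip: right_diff_distrib)
  then show ?thesis unfolding q(1)
    by (intro slope_leI(1)[OF q(2), of 1]) (use assms in \<open>auto simp: time_dist_fun_def\<close>)
qed

lemma dt_sq_dist_fun: "dt (sq_dist_fun X A z) p = 0"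
  by (cases p) (simp add: dt_def sq_dist_fun_def)

lemma dt_time_dist_fun:
  assumes "(h has_real_derivative h' t) (at t)"
  shows "dt (time_dist_fun X h B w) (t, x) = h' t"
  unfolding dt_def time_dist_fun_def prod.case
  by (rule DERIV_imp_deriv) (auto intro!: derivative_eq_intros assms)

lemma sq_time_dist_sub_test:
  assumes X: "geodesic_space X" and "z \<in> mspace X" "w \<in> mspace X" "A \<ge> 0"
    and h: "\<And>t. (h has_real_derivative h' t) (at t)" "continuous_on UNIV h'"
  shows "(sq_dist_fun X A z, time_dist_fun X h B w) \<in> sub_test X"
proof -
  have [simp]: "dt (time_dist_fun X h B w) (t, x) = h' t" for t x
    by (rule dt_time_dist_fun[OF h(1)])
  have 1: "continuous_map (mtopology_of (open_cyl X)) euclideanreal (slope X (sq_dist_fun X A z))"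
    unfolding open_cyl_eq
  proof (rule continuous_map_cylI)
    fix t :: real and x and e :: real assume tx: "t \<in> {0<..}" "x \<in> mspace X" "e > 0"
    have "\<bar>2 * A * mdist X y z - 2 * A * mdist X x z\<bar> < e" if "y \<in> mspace X" "mdist X y x < e / (2 * A + 1)" for y
    proof -
      have "\<bar>2 * A * mdist X y z - 2 * A * mdist X x z\<bar> = 2 * A * \<bar>mdist X y z - mdist X x z\<bar>"
        using assms(4) by (simp add: abs_mult flip: right_diff_distrib)
      also have "\<dots> \<le> 2 * A * mdist X y x"
        using mdist_diff_le[OF that(1) tx(2) assms(2)] assms(4) by (intro mult_left_mono) auto
      also have "\<dots> \<le> 2 * A * (e / (2 * A + 1))" using that assms(4) by (intro mult_left_mono) auto
      also have "\<dots> < e" using tx(3) assms(4) by (simp add: field_simps)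
      finally show ?thesis .
    qed
    then show "\<exists>r>0. \<forall>s\<in>{0<..}. \<forall>y\<in>mspace X. \<bar>s - t\<bar> < r \<longrightarrow> mdist X y x < r \<longrightarrow>
         \<bar>slope X (sq_dist_fun X A z) (s, y) - slope X (sq_dist_fun X A z) (t, x)\<bar> < e"
      using assms tx by (intro exI[of _ "e / (2 * A + 1)"]) (auto simp: slope_sq_dist_fun)
  qed
  have 2: "continuous_dt X (sq_dist_fun X A z)"
    unfolding continuous_dt_def open_cyl_eq
    by (auto intro!: continuous_map_cylI exI[of _ 1] simp: dt_sq_dist_fun) (auto simp: sq_dist_fun_def)
  have "continuous_map (mtopology_of (open_cyl X)) euclideanreal (dt (time_dist_fun X h B w))"
    unfolding open_cyl_eq
  proof (rule continuous_map_cylI)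
    fix t :: real and x and e :: real assume tx: "t \<in> {0<..}" "x \<in> mspace X" "e > 0"
    then obtain d where "d > 0" "\<And>s. \<bar>s - t\<bar> < d \<Longrightarrow> \<bar>h' s - h' t\<bar> < e"
      using h(2) unfolding continuous_on_iff dist_real_def by (metis UNIV_I)
    then show "\<exists>r>0. \<forall>s\<in>{0<..}. \<forall>y\<in>mspace X. \<bar>s - t\<bar> < r \<longrightarrow> mdist X y x < r \<longrightarrow>
        \<bar>dt (time_dist_fun X h B w) (s, y) - dt (time_dist_fun X h B w) (t, x)\<bar> < e" by auto
  qed
  moreover have "(\<lambda>s. h s + B * mdist X x w) differentiable (at t)" for t x
    unfolding real_differentiable_def by (auto intro!: exI derivative_eq_intros h)
  ultimately have 3: "continuous_dt X (time_dist_fun X h B w)"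
    by (auto simp: continuous_dt_def time_dist_fun_def)
  show ?thesis
    unfolding sub_test_def
    using 1 2 3 locally_Lipschitz_sq_dist_fun[OF assms(2)] locally_Lipschitz_time_dist_fun[OF assms(3) h]
    by (auto simp: open_cyl_eq slope_sq_dist_fun assms)
qed

section \<open>Majorants of test functions\<close>

text \<open>The Lipschitz bound from the descent point \<open>z\<close> gives the cone
  \<open>\<phi> (t, z) + (p + \<delta>) * mdist X x z\<close>. The inequality
  \<open>2 * r * d \<le> d\<^sup>2 + r\<^sup>2\<close> replaces it by a parabola that agrees with it
  at distance \<open>r = mdist X x0 z\<close>, which fixes
  \<open>A = (p + \<delta>) / (2 * r)\<close>. The contact error \<open>2 * \<delta> * r\<close> at
  \<open>x0\<close> comes from the two deviations \<delta> from \<open>p\<close>.\<close>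

lemma descent_majorant:
  assumes X: "geodesic_space X" and x0: "x0 \<in> mspace X" and "\<rho> > 0" "\<delta> > 0"
    and lip: "\<And>x y. x \<in> mspace X \<Longrightarrow> y \<in> mspace X \<Longrightarrow> mdist X x x0 < \<rho> \<Longrightarrow> mdist X y x0 < \<rho> \<Longrightarrow>
      \<bar>\<phi> (t, x) - \<phi> (t, y)\<bar> \<le> (p + \<delta>) * mdist X x y"
    and p: "p \<ge> 0" "p > 0 \<Longrightarrow> \<delta> \<le> p" "slope_minus X \<phi> (t, x0) = p"
  obtains z A r where "z \<in> mspace X" "A \<ge> 0" "0 < r" "r < \<rho>" "\<bar>2 * A * mdist X x0 z - p\<bar> \<le> \<delta>"
    "2 * A * r \<le> p + \<delta>"
    "\<And>x. x \<in> mspace X \<Longrightarrow> mdist X x x0 < \<rho> \<Longrightarrow>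
      \<phi> (t, x) \<le> \<phi> (t, x0) + A * ((mdist X x z)\<^sup>2 - (mdist X x0 z)\<^sup>2) + \<delta> * mdist X x x0 + 2 * \<delta> * r"
proof (cases "p = 0")
  \<comment> \<open>Without descent \<open>z = x0\<close> and \<open>A = 0\<close> suffice, and
    \<phi> is \<delta>-Lipschitz near \<open>x0\<close>; the term
    \<open>\<delta> * mdist X x x0\<close> of the majorant stems from this case.\<close>
  case True
  have "\<phi> (t, x) \<le> \<phi> (t, x0) + \<delta> * mdist X x x0" if "x \<in> mspace X" "mdist X x x0 < \<rho>" for x
    using lip[OF that(1) x0 that(2)] True x0 \<open>\<rho> > 0\<close> by simp
  then show ?thesis
    using assms(3,4) x0 True by (intro that[of x0 0 "\<rho> / 2"]) (auto simp: add_increasing2)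
next
  case False
  then have "p > 0" using p by simp
  \<comment> \<open>\<open>p - \<delta>\<close> is below the descending slope \<open>p\<close>, and
    it is nonnegative because \<delta> \<le> p.\<close>
  obtain z where z: "z \<in> mspace X" "z \<noteq> x0" "mdist X z x0 < \<rho>" "(p - \<delta>) * mdist X z x0 < \<phi> (t, x0) - \<phi> (t, z)"
    using less_slope_minusD[OF x0, of "p - \<delta>" \<phi> t \<rho>] p \<open>p > 0\<close> assms(3,4) by auto
  define r where "r = mdist X x0 z"
  have r: "r > 0" "mdist X z x0 = r" using z x0 by (auto simp: r_def mdist_commute) (metis less_eq_real_def mdist_nonneg mdist_zero)
  define A where "A = (p + \<delta>) / (2 * r)"
  have A: "A * (2 * r) = p + \<delta>" using r by (simp add: A_def)
  show ?thesis
  proof (rule that[OF z(1)])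
    fix x assume x: "x \<in> mspace X" "mdist X x x0 < \<rho>"
    let ?d = "mdist X x z"
    have "\<phi> (t, x) \<le> \<phi> (t, z) + (p + \<delta>) * ?d" using lip[OF x(1) z(1) x(2) z(3)] by simp
    also have "\<dots> \<le> \<phi> (t, x0) - (p - \<delta>) * r + (p + \<delta>) * ?d" using z(4) r(2) by simp
    also have "\<dots> = \<phi> (t, x0) + A * (2 * r * ?d - 2 * r\<^sup>2) + 2 * \<delta> * r"
    proof -
      have "A * (2 * r * ?d - 2 * r\<^sup>2) = (A * (2 * r)) * (?d - r)" by (simp add: algebra_simps power2_eq_square)
      then show ?thesis unfolding A by (simp add: algebra_simps)
    qed
    also have "\<dots> \<le> \<phi> (t, x0) + A * (?d\<^sup>2 - r\<^sup>2) + 2 * \<delta> * r"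
    proof -
      have "2 * r * ?d \<le> ?d\<^sup>2 + r\<^sup>2" using sum_squares_bound[of r ?d] by simp
      then have "A * (2 * r * ?d - 2 * r\<^sup>2) \<le> A * (?d\<^sup>2 - r\<^sup>2)"
        using r \<open>p > 0\<close> assms(4) by (intro mult_left_mono) (auto simp: A_def)
      then show ?thesis by simp
    qed
    also have "\<dots> \<le> \<phi> (t, x0) + A * (?d\<^sup>2 - r\<^sup>2) + \<delta> * mdist X x x0 + 2 * \<delta> * r"
      using assms(4) by simp
    finally show "\<phi> (t, x) \<le> \<phi> (t, x0) + A * (?d\<^sup>2 - (mdist X x0 z)\<^sup>2) + \<delta> * mdist X x x0 + 2 * \<delta> * r"
      by (simp add: r_def)
  next
    show "A \<ge> 0" "0 < r" "r < \<rho>" using r z(3) \<open>p > 0\<close> assms(4) by (auto simp: A_def)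
    show "\<bar>2 * A * mdist X x0 z - p\<bar> \<le> \<delta>" "2 * A * r \<le> p + \<delta>"
      using A assms(4) by (simp_all add: r_def mult.commute mult.left_commute)
  qed
qed

text \<open>
  The constants are driven by one small \<open>\<sigma>\<close>: all test function data are controlled up to
  \<open>\<delta> = \<sigma>\<^sup>2\<close>, which costs \<open>O(\<sigma>\<^sup>2 r)\<close> on the box of size \<open>\<theta> = \<sigma>r\<close>. The penalties
  \<open>4(t - t\<^sub>0)\<^sup>2 / r\<close> and \<open>4\<sigma> d(x, x\<^sub>0)\<close> beat this on the boundary of the box, while their
  derivatives are only \<open>O(\<sigma>)\<close>.
\<close>

lemma local_max_test_replacement:
  fixes U :: "real \<times> 'a \<Rightarrow> real"
  assumes X: "geodesic_space X" and test: "(\<phi>1, \<phi>2) \<in> sub_test X" and t0: "t0 > 0" and x0: "x0 \<in> mspace X"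
    and max: "\<forall>\<^sub>F q in nhdsin (mtopology_of (open_cyl X)) (t0, x0).
      U q - \<phi>1 q - \<phi>2 q \<le> U (t0, x0) - \<phi>1 (t0, x0) - \<phi>2 (t0, x0)"
    and e: "e > 0"
  obtains z A B N \<theta> \<gamma> where "z \<in> mspace X" "A \<ge> 0" "B \<ge> 0" "N \<ge> 0" "\<theta> > 0" "\<gamma> > 0" "\<theta> < e" "\<theta> < t0"
    "\<bar>2 * A * mdist X x0 z - slope X \<phi>1 (t0, x0)\<bar> \<le> e" "2 * A * \<theta> \<le> e"
    "B \<le> slope_env X \<phi>2 (t0, x0) + e" "2 * N * \<theta> \<le> e"
    "\<And>t x. \<bar>t - t0\<bar> \<le> \<theta> \<Longrightarrow> x \<in> mspace X \<Longrightarrow> mdist X x x0 \<le> \<theta> \<Longrightarrow> \<bar>t - t0\<bar> = \<theta> \<or> mdist X x x0 = \<theta> \<Longrightarrow>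
      U (t, x) \<le> U (t0, x0) + (dt \<phi>1 (t0, x0) + dt \<phi>2 (t0, x0)) * (t - t0) + N * (t - t0)\<^sup>2
        + A * ((mdist X x z)\<^sup>2 - (mdist X x0 z)\<^sup>2) + B * mdist X x x0 - \<gamma>"
proof -
  define p where "p = slope X \<phi>1 (t0, x0)"
  define L where "L = slope_env X \<phi>2 (t0, x0)"
  define a1 where "a1 = dt \<phi>1 (t0, x0)"
  define a2 where "a2 = dt \<phi>2 (t0, x0)"
  have lip: "locally_Lipschitz (open_cyl X) \<phi>1" "locally_Lipschitz (open_cyl X) \<phi>2"
    and cont: "continuous_map (mtopology_of (cyl {0<..} X)) euclideanreal (slope X \<phi>1)"
    and cdt: "continuous_dt X \<phi>1" "continuous_dt X \<phi>2"
    and minus: "slope_minus X \<phi>1 (t0, x0) = p"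
    using test t0 x0 by (auto simp: sub_test_def p_def open_cyl_eq)
  have cdt': "continuous_map (mtopology_of (cyl {0<..} X)) euclideanreal (dt \<phi>1)"
    "continuous_map (mtopology_of (cyl {0<..} X)) euclideanreal (dt \<phi>2)"
    using cdt by (auto simp: continuous_dt_def open_cyl_eq)
  have p0: "p \<ge> 0" by (simp add: p_def slope_nonneg)
  have L0: "L \<ge> 0" unfolding L_def using t0 x0 by (intro slope_env_nonneg) (simp add: open_cyl_eq)
  \<comment> \<open>The factor \<open>8 * (p + 1)\<close> pays for all tolerances at once:
    \<open>\<sigma> * (p + 1)\<close> for the variation of the slope on the box,
    \<open>8 * \<sigma>\<close> for the time penalty, \<open>2 * \<delta> + 4 * \<sigma>\<close> for
    the cone.\<close>
  define \<sigma>' where "\<sigma>' = min e 1 / (8 * (p + 1))"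
  \<comment> \<open>For p > 0 the bound \<sigma> \<le> p yields \<delta> \<le> p, which
    \<open>descent_majorant\<close> requires in that case.\<close>
  define \<sigma> where "\<sigma> = (if p > 0 then min \<sigma>' p else \<sigma>')"
  have "\<sigma>' > 0" using e p0 by (simp add: \<sigma>'_def)
  then have \<sigma>: "\<sigma> > 0" "\<sigma> \<le> \<sigma>'" "p > 0 \<Longrightarrow> \<sigma> \<le> p" using p0 by (auto simp: \<sigma>_def)
  have \<sigma>e: "(p + 1) * \<sigma> * 8 \<le> min e 1"
  proof -
    have "(p + 1) * \<sigma> * 8 \<le> (p + 1) * \<sigma>' * 8" using \<sigma> p0 by simp
    also have "\<dots> = min e 1" using p0 unfolding \<sigma>'_def by (simp add: field_simps)
    finally show ?thesis .
  qed
  have "\<sigma> * 8 \<le> (p + 1) * \<sigma> * 8" using p0 \<sigma> by (simp add: algebra_simps)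
  then have \<sigma>8: "\<sigma> * 8 \<le> e" "\<sigma> * 8 \<le> 1" using \<sigma>e by auto
  define \<delta> where "\<delta> = \<sigma> * \<sigma>"
  have \<delta>: "\<delta> > 0" "\<delta> \<le> \<sigma>" "\<delta> \<le> 1" using \<sigma> \<sigma>8 by (auto simp: \<delta>_def mult_le_one)
  obtain \<rho>1 where \<rho>1: "\<rho>1 > 0" "\<And>s y. s > 0 \<Longrightarrow> y \<in> mspace X \<Longrightarrow> \<bar>s - t0\<bar> < \<rho>1 \<Longrightarrow> mdist X y x0 < \<rho>1 \<Longrightarrow>
      U (s, y) - \<phi>1 (s, y) - \<phi>2 (s, y) \<le> U (t0, x0) - \<phi>1 (t0, x0) - \<phi>2 (t0, x0)"
    using max t0 x0 unfolding open_cyl_eq by (subst (asm) eventually_nhdsin_cyl) auto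
  obtain \<rho>2 where \<rho>2: "\<rho>2 > 0" "\<And>s y. s > 0 \<Longrightarrow> y \<in> mspace X \<Longrightarrow> \<bar>s - t0\<bar> < \<rho>2 \<Longrightarrow> mdist X y x0 < \<rho>2 \<Longrightarrow>
      \<bar>dt \<phi>1 (s, y) - a1\<bar> < \<delta> / 2"
    using continuous_map_cylD[OF cdt'(1) _ x0, of t0 "\<delta> / 2"] t0 \<delta>(1) unfolding a1_def by auto
  obtain \<rho>3 where \<rho>3: "\<rho>3 > 0" "\<And>s y. s > 0 \<Longrightarrow> y \<in> mspace X \<Longrightarrow> \<bar>s - t0\<bar> < \<rho>3 \<Longrightarrow> mdist X y x0 < \<rho>3 \<Longrightarrow>
      \<bar>dt \<phi>2 (s, y) - a2\<bar> < \<delta> / 2"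
    using continuous_map_cylD[OF cdt'(2) _ x0, of t0 "\<delta> / 2"] t0 \<delta>(1) unfolding a2_def by auto
  obtain \<rho>4 where \<rho>4: "\<rho>4 > 0" "\<And>s y. s > 0 \<Longrightarrow> y \<in> mspace X \<Longrightarrow> \<bar>s - t0\<bar> < \<rho>4 \<Longrightarrow> mdist X y x0 < \<rho>4 \<Longrightarrow>
      \<bar>slope X \<phi>1 (s, y) - p\<bar> < \<delta>"
    using continuous_map_cylD[OF cont _ x0, of t0 \<delta>] t0 \<delta>(1) unfolding p_def by auto
  have "slope_env X \<phi>2 (t0, x0) < L + \<delta>" using \<delta> by (simp add: L_def)
  then obtain \<rho>5 where \<rho>5: "\<rho>5 > 0" "\<And>s y. s > 0 \<Longrightarrow> y \<in> mspace X \<Longrightarrow> \<bar>s - t0\<bar> < \<rho>5 \<Longrightarrow> mdist X y x0 < \<rho>5 \<Longrightarrow>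
      slope X \<phi>2 (s, y) < L + \<delta>"
    using slope_env_lessD[OF lip(2) t0 x0] by blast
  define \<rho> where "\<rho> = min t0 (min (min \<rho>1 \<rho>2) (min \<rho>3 (min \<rho>4 \<rho>5)))"
  have \<rho>: "\<rho> > 0" "\<rho> \<le> t0" "\<rho> \<le> \<rho>1" "\<rho> \<le> \<rho>2" "\<rho> \<le> \<rho>3" "\<rho> \<le> \<rho>4" "\<rho> \<le> \<rho>5"
    using \<rho>1(1) \<rho>2(1) \<rho>3(1) \<rho>4(1) \<rho>5(1) t0 by (auto simp: \<rho>_def)
  \<comment> \<open>Half of \<rho>, since \<open>Lipschitz_of_slope_bound\<close> concludes on half
    balls; at most \<open>e\<close>, so that \<theta> < e.\<close>
  define \<rho>' where "\<rho>' = min (\<rho> / 2) e"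
  have \<rho>': "\<rho>' > 0" "\<rho>' \<le> \<rho> / 2" "\<rho>' \<le> e" using \<rho> e by (auto simp: \<rho>'_def)
  have L1: "\<bar>\<phi>1 (t0, x) - \<phi>1 (t0, y)\<bar> \<le> (p + \<delta>) * mdist X x y"
    if "x \<in> mspace X" "y \<in> mspace X" "mdist X x x0 < \<rho>'" "mdist X y x0 < \<rho>'" for x y
  proof (rule Lipschitz_of_slope_bound[OF X lip(1) t0 x0 that(1,2)])
    show "slope X \<phi>1 (t0, z) \<le> p + \<delta>" if "z \<in> mspace X" "mdist X z x0 < \<rho>" for z
      using \<rho>4(2)[of t0 z] that t0 \<rho> by auto
  qed (use that \<rho>' in auto)
  have L2: "\<bar>\<phi>2 (t0, x) - \<phi>2 (t0, x0)\<bar> \<le> (L + \<delta>) * mdist X x x0"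
    if "x \<in> mspace X" "mdist X x x0 < \<rho>'" for x
  proof (rule Lipschitz_of_slope_bound[OF X lip(2) t0 x0 that(1) x0])
    show "slope X \<phi>2 (t0, z) \<le> L + \<delta>" if "z \<in> mspace X" "mdist X z x0 < \<rho>" for z
      using \<rho>5(2)[of t0 z] that t0 \<rho> by auto
  qed (use that \<rho>' \<rho> x0 in auto)
  have "\<delta> \<le> p" if "p > 0" using \<sigma>(3)[OF that] \<delta> by simp
  then obtain z A r where zAr: "z \<in> mspace X" "A \<ge> 0" "0 < r" "r < \<rho>'" "\<bar>2 * A * mdist X x0 z - p\<bar> \<le> \<delta>"
    "2 * A * r \<le> p + \<delta>"
    "\<And>x. x \<in> mspace X \<Longrightarrow> mdist X x x0 < \<rho>' \<Longrightarrow>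
      \<phi>1 (t0, x) \<le> \<phi>1 (t0, x0) + A * ((mdist X x z)\<^sup>2 - (mdist X x0 z)\<^sup>2) + \<delta> * mdist X x x0 + 2 * \<delta> * r"
    using descent_majorant[where \<phi>=\<phi>1 and t=t0, OF X x0 \<rho>'(1) \<delta>(1) L1 p0 _ minus] by blast
  define \<theta> where "\<theta> = \<sigma> * r"
  have "\<theta> \<le> 1 * r" unfolding \<theta>_def using \<sigma>8 zAr by (intro mult_right_mono) auto
  then have \<theta>: "\<theta> > 0" "\<theta> \<le> r" using \<sigma> zAr by (auto simp: \<theta>_def)
  show ?thesis
  \<comment> \<open>\<open>B\<close> collects the constant \<open>L + \<delta>\<close> of \<phi>2
    around \<open>x0\<close>, the term with factor \<delta> in the majorant of \<phi>1, and the
    penalty with factor \<open>4 * \<sigma>\<close>.\<close>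
  proof (rule that[where \<theta> = \<theta> and z = z and A = A and N = "4 / r" and \<gamma> = "\<delta> * r" and B = "L + 2 * \<delta> + 4 * \<sigma>"])
    show "\<bar>2 * A * mdist X x0 z - slope X \<phi>1 (t0, x0)\<bar> \<le> e" using zAr(5) \<delta> \<sigma>8 \<sigma> by (simp add: p_def)
    have "2 * A * \<theta> = \<sigma> * (2 * A * r)" by (simp add: \<theta>_def)
    also have "\<dots> \<le> \<sigma> * (p + 1)" using zAr(6) \<delta> \<sigma> by (intro mult_left_mono) auto
    also have "\<dots> \<le> (p + 1) * \<sigma> * 8" using \<sigma> p0 by (simp add: algebra_simps)
    finally show "2 * A * \<theta> \<le> e" using \<sigma>e min.cobounded1[of e 1] by linarith
    show "L + 2 * \<delta> + 4 * \<sigma> \<le> slope_env X \<phi>2 (t0, x0) + e" using \<delta> \<sigma>8 \<sigma> by (simp add: L_def)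
    show "2 * (4 / r) * \<theta> \<le> e" using zAr \<sigma>8 by (simp add: \<theta>_def)
  next
    fix t x assume tx: "\<bar>t - t0\<bar> \<le> \<theta>" "x \<in> mspace X" "mdist X x x0 \<le> \<theta>" "\<bar>t - t0\<bar> = \<theta> \<or> mdist X x x0 = \<theta>"
    let ?d = "mdist X x x0"
    have b: "\<bar>s - t0\<bar> < \<rho>" "s > 0" if "\<bar>s - t0\<bar> \<le> \<bar>t - t0\<bar>" for s
      using that tx \<theta> zAr \<rho>' \<rho> by auto
    have d: "?d < \<rho>'" "?d < \<rho>" using tx \<theta> zAr \<rho>' \<rho> by auto
    have M: "U (t, x) - \<phi>1 (t, x) - \<phi>2 (t, x) \<le> U (t0, x0) - \<phi>1 (t0, x0) - \<phi>2 (t0, x0)"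
      using \<rho>1(2)[of t x] b[of t] tx d \<rho> by auto
    \<comment> \<open>Time is changed first, at fixed \<open>x\<close>; the spatial estimates are
      then needed at time \<open>t0\<close> alone.\<close>
    have T1: "\<bar>\<phi>1 (t, x) - \<phi>1 (t0, x) - a1 * (t - t0)\<bar> \<le> \<delta> / 2 * \<bar>t - t0\<bar>"
      by (rule dt_linearization[OF cdt(1) tx(2)]) (use \<rho>2(2)[of _ x] b tx d \<rho> in \<open>force simp: less_imp_le\<close>)
    have T2: "\<bar>\<phi>2 (t, x) - \<phi>2 (t0, x) - a2 * (t - t0)\<bar> \<le> \<delta> / 2 * \<bar>t - t0\<bar>"
      by (rule dt_linearization[OF cdt(2) tx(2)]) (use \<rho>3(2)[of _ x] b tx d \<rho> in \<open>force simp: less_imp_le\<close>)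
    have r: "\<delta> / 2 * \<bar>t - t0\<bar> \<le> \<delta> * r / 2" using tx \<theta> \<delta> by simp
    have "\<phi>1 (t, x) - \<phi>1 (t0, x) - a1 * (t - t0) \<le> \<delta> * r / 2"
      by (rule order_trans[OF abs_ge_self order_trans[OF T1 r]])
    moreover have "\<phi>2 (t, x) - \<phi>2 (t0, x) - a2 * (t - t0) \<le> \<delta> * r / 2"
      by (rule order_trans[OF abs_ge_self order_trans[OF T2 r]])
    \<comment> \<open>On either face of the box the penalties amount to at least
      \<open>4 * \<delta> * r\<close>. The majorant of \<phi>1 costs \<open>2 * \<delta> * r\<close>
      and the two linearizations together \<open>\<delta> * r\<close>, which leaves the gap
      \<open>\<delta> * r\<close>.\<close>
    moreover have "4 * \<delta> * r \<le> 4 / r * (t - t0)\<^sup>2 + 4 * \<sigma> * ?d"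
      using tx(4)
    proof
      assume "\<bar>t - t0\<bar> = \<theta>"
      then have "(t - t0)\<^sup>2 = \<theta>\<^sup>2" by (metis power2_abs)
      then have "4 / r * (t - t0)\<^sup>2 = 4 * \<delta> * r"
        using zAr by (simp add: \<theta>_def \<delta>_def power2_eq_square field_simps)
      then show ?thesis using \<sigma> by simp
    next
      assume "?d = \<theta>"
      then have "4 * \<sigma> * ?d = 4 * \<delta> * r" by (simp add: \<theta>_def \<delta>_def)
      moreover have "4 / r * (t - t0)\<^sup>2 \<ge> 0" using zAr(3) by simp
      ultimately show ?thesis by linarith
    qed
    moreover have "\<phi>2 (t0, x) - \<phi>2 (t0, x0) \<le> (L + \<delta>) * ?d" by (rule order_trans[OF abs_ge_self L2[OF tx(2) d(1)]])
    moreover note zAr(7)[OF tx(2) d(1)]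
    moreover have "(a1 + a2) * (t - t0) = a1 * (t - t0) + a2 * (t - t0)"
      "(L + 2 * \<delta> + 4 * \<sigma>) * ?d = (L + \<delta>) * ?d + \<delta> * ?d + 4 * \<sigma> * ?d" by (simp_all add: algebra_simps)
    ultimately show "U (t, x) \<le> U (t0, x0) + (dt \<phi>1 (t0, x0) + dt \<phi>2 (t0, x0)) * (t - t0) + 4 / r * (t - t0)\<^sup>2
        + A * ((mdist X x z)\<^sup>2 - (mdist X x0 z)\<^sup>2) + (L + 2 * \<delta> + 4 * \<sigma>) * ?d - \<delta> * r"
      using M unfolding a1_def[symmetric] a2_def[symmetric] by linarith
  qed (use zAr \<theta> \<rho>' \<rho> L0 \<delta> \<sigma> in auto)
qed

section \<open>Maxima of semicontinuous functions\<close>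

text \<open>If every \<open>p\<close> in \<open>K\<close> is beaten by some \<open>m p\<close>, then
  \<open>F\<close> stays below \<open>F (m p)\<close> near \<open>p\<close>. Finitely many of these
  neighbourhoods cover \<open>K\<close>, and the best of the finitely many points \<open>m p\<close>
  lies in one of them, so another one is better still.\<close>

lemma usc_attains_max:
  fixes F :: "'c \<Rightarrow> ereal"
  assumes K: "compactin (mtopology_of C) K" "K \<noteq> {}"
    and usc: "\<And>p. p \<in> K \<Longrightarrow> Limsup (nhdsin (mtopology_of C) p) F \<le> F p"
  obtains p where "p \<in> K" "\<And>q. q \<in> K \<Longrightarrow> F q \<le> F p"
proof (rule ccontr)
  assume "\<not> thesis"
  then have "\<forall>p\<in>K. \<exists>q\<in>K. F p < F q" using that by (meson not_le)
  then obtain m where m: "\<And>p. p \<in> K \<Longrightarrow> m p \<in> K" "\<And>p. p \<in> K \<Longrightarrow> F p < F (m p)" by metis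
  have sub: "K \<subseteq> mspace C" using compactin_subset_topspace[OF K(1)] by simp
  have "\<exists>S. openin (mtopology_of C) S \<and> p \<in> S \<and> (\<forall>q\<in>S. F q < F (m p))" if "p \<in> K" for p
  proof -
    have "Limsup (nhdsin (mtopology_of C) p) F < F (m p)" using usc[OF that] m(2)[OF that] by simp
    from Limsup_lessD[OF this] show ?thesis using that sub by (auto simp: eventually_nhdsin)
  qed
  then obtain S where S: "\<And>p. p \<in> K \<Longrightarrow> openin (mtopology_of C) (S p)" "\<And>p. p \<in> K \<Longrightarrow> p \<in> S p"
    "\<And>p q. p \<in> K \<Longrightarrow> q \<in> S p \<Longrightarrow> F q < F (m p)" by metis
  have "K \<subseteq> \<Union>(S ` K)" using S(2) by blast
  then obtain \<F> where "finite \<F>" "\<F> \<subseteq> S ` K" "K \<subseteq> \<Union>\<F>"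
    using K(1) S(1) unfolding compactin_def by (metis imageE)
  then obtain K' where K': "finite K'" "K' \<subseteq> K" "K \<subseteq> \<Union>(S ` K')"
    by (metis finite_subset_image)
  then have "K' \<noteq> {}" using K(2) by auto
  then have "Max ((\<lambda>q. F (m q)) ` K') \<in> (\<lambda>q. F (m q)) ` K'" using K'(1) by (intro Max_in) auto
  then obtain p where p: "p \<in> K'" "Max ((\<lambda>q. F (m q)) ` K') = F (m p)" by blast
  have p': "F (m q) \<le> F (m p)" if "q \<in> K'" for q
    unfolding p(2)[symmetric] using K'(1) that by (intro Max_ge) auto
  have "m p \<in> K" using p K' m by blast
  then obtain q where q: "q \<in> K'" "m p \<in> S q" using K'(3) by blast
  then have "F (m p) < F (m q)" using S(3) K'(2) by blast
  with p'[OF q(1)] show False by simp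
qed

text \<open>An open set on which \<open>f\<close> stays below \<open>c\<close> bounds the envelope
  at all of its points, not just at \<open>p\<close>.\<close>

lemma Limsup_upper_env_le:
  assumes "p \<in> mspace C"
  shows "Limsup (nhdsin (mtopology_of C) p) (upper_env C f) \<le> upper_env C f p"
proof (rule ccontr)
  assume "\<not> ?thesis"
  then obtain c where c: "upper_env C f p < c" "c < Limsup (nhdsin (mtopology_of C) p) (upper_env C f)"
    by (meson dense not_le)
  from Limsup_lessD[OF c(1)[unfolded upper_env_def]] obtain S where
    S: "openin (mtopology_of C) S" "p \<in> S" "\<And>q. q \<in> S \<Longrightarrow> ereal (f q) < c"
    using assms by (auto simp: eventually_nhdsin)
  have "upper_env C f q \<le> c" if "q \<in> S" for q
    unfolding upper_env_def using that S
    by (intro Limsup_bounded) (auto simp: eventually_nhdsin less_imp_le)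
  then have "Limsup (nhdsin (mtopology_of C) p) (upper_env C f) \<le> c"
    using S by (intro Limsup_bounded) (auto simp: eventually_nhdsin)
  with c(2) show False by simp
qed

text \<open>\<open>E\<close> may be infinite, so the subtraction is carried out with real numbers
  inserted strictly between the two sides.\<close>

lemma Limsup_minus_real_le:
  fixes E :: "'c \<Rightarrow> ereal"
  assumes "Limsup F E \<le> l" and \<phi>: "(\<phi> \<longlongrightarrow> c) F"
  shows "Limsup F (\<lambda>q. E q - ereal (\<phi> q)) \<le> l - ereal c"
proof (rule ccontr)
  assume "\<not> ?thesis"
  then obtain y where y: "l - ereal c < ereal y" "ereal y < Limsup F (\<lambda>q. E q - ereal (\<phi> q))"
    by (metis ereal_dense2 not_le)
  have "l < ereal (y + c)" using y(1) by (cases l) auto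
  then obtain y' where y': "l < ereal y'" "y' < y + c" using ereal_dense2 by (metis less_ereal.simps(1))
  have "\<forall>\<^sub>F q in F. E q < ereal y'" using assms(1) y'(1) by (intro Limsup_lessD) simp
  moreover have "\<forall>\<^sub>F q in F. y' - y < \<phi> q" using y'(2) by (intro order_tendstoD(1)[OF \<phi>]) simp
  ultimately have "\<forall>\<^sub>F q in F. E q - ereal (\<phi> q) \<le> ereal y"
  proof eventually_elim
    case (elim q) then show ?case by (cases "E q") auto
  qed
  from Limsup_bounded[OF this] y(2) show False by simp
qed

lemma compactin_cyl:
  assumes "compactin (mtopology_of X) K" "{a..b} \<subseteq> S"
  shows "compactin (mtopology_of (cyl S X)) ({a..b} \<times> K)"
  using assms by (auto simp: cyl_def compactin_Times mtopology_of_submetric compactin_subtopology)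

lemma locally_Lipschitz_tendsto:
  assumes "locally_Lipschitz (cyl S X) \<phi>" "t \<in> S" "x \<in> mspace X"
  shows "(\<phi> \<longlongrightarrow> \<phi> (t, x)) (nhdsin (mtopology_of (cyl S X)) (t, x))"
proof -
  obtain r K where r: "r > 0" "K \<ge> 0" "\<And>s s' y y'. s\<in>S \<Longrightarrow> s'\<in>S \<Longrightarrow> y\<in>mspace X \<Longrightarrow> y'\<in>mspace X \<Longrightarrow>
     \<bar>s - t\<bar> < r \<Longrightarrow> \<bar>s' - t\<bar> < r \<Longrightarrow> mdist X y x < r \<Longrightarrow> mdist X y' x < r \<Longrightarrow>
     \<bar>\<phi> (s, y) - \<phi> (s', y')\<bar> \<le> K * (\<bar>s - s'\<bar> + mdist X y y')"
    using locally_Lipschitz_cylD[OF assms] by blast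
  show ?thesis unfolding tendsto_iff eventually_nhdsin_cyl[OF assms(2,3)]
  proof (intro allI impI)
    fix e :: real assume e: "e > 0"
    show "\<exists>r>0. \<forall>s\<in>S. \<forall>y\<in>mspace X. \<bar>s - t\<bar> < r \<longrightarrow> mdist X y x < r \<longrightarrow> dist (\<phi> (s, y)) (\<phi> (t, x)) < e"
    proof (intro exI[of _ "min r (e / (2 * K + 1))"] conjI ballI impI)
      show "0 < min r (e / (2 * K + 1))" using r e by simp
      fix s y assume *: "s \<in> S" "y \<in> mspace X" "\<bar>s - t\<bar> < min r (e / (2 * K + 1))" "mdist X y x < min r (e / (2 * K + 1))"
      then have "\<bar>\<phi> (s, y) - \<phi> (t, x)\<bar> \<le> K * (\<bar>s - t\<bar> + mdist X y x)"
        using r(3)[of s t y x] assms(2,3) r(1) by simp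
      also have "\<dots> \<le> K * (2 * (e / (2 * K + 1)))" using * r by (intro mult_left_mono) auto
      also have "\<dots> < e" using e r by (simp add: field_simps)
      finally show "dist (\<phi> (s, y)) (\<phi> (t, x)) < e" by (simp add: dist_real_def)
    qed
  qed
qed

section \<open>Extended Hamiltonians and the viscosity inequality\<close>

lemma continuous_ext_ham:
  assumes "continuous_ham X H" "x \<in> mspace X"
  shows "continuous_on UNIV (ext_ham H x)"
proof -
  have "continuous_map euclideanreal (mtopology_of (prod_metric X (submetric euclidean_metric {0..})))
      (\<lambda>s. (x, max 0 s))"
    using assms(2) by (auto simp: mtopology_of_submetric continuous_map_in_subtopology intro!: continuous_map_pairedI continuous_intros)
  from continuous_map_compose[OF this assms(1)[unfolded continuous_ham_def]]
  have "continuous_on UNIV (\<lambda>s. H x (max 0 s))" by (simp add: o_def)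
  moreover have "ext_ham H x = (\<lambda>s. H x (max 0 s))" by (auto simp: ext_ham_def fun_eq_iff max_def)
  ultimately show ?thesis by simp
qed

text \<open>Over a compact interval the infimum is attained, so the viscosity inequality can be
  stated at a single momentum \<open>s\<close>, which is what passes to a limit. Attainment also
  makes the real-valued \<open>INF\<close> a genuine infimum.\<close>

lemma ham_lower_attained:
  assumes "continuous_ham X H" "x \<in> mspace X" "\<eta> \<ge> 0"
  obtains s where "\<bar>s - p\<bar> \<le> \<eta>" "ham_lower H \<eta> x p = ext_ham H x s"
    "\<And>s'. \<bar>s' - p\<bar> \<le> \<eta> \<Longrightarrow> ham_lower H \<eta> x p \<le> ext_ham H x s'"
proof -
  have eq: "{s. \<bar>s - p\<bar> \<le> \<eta>} = cball p \<eta>" by (auto simp: dist_real_def)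
  have "\<exists>s\<in>cball p \<eta>. \<forall>s'\<in>cball p \<eta>. ext_ham H x s \<le> ext_ham H x s'"
    using assms(3) by (intro continuous_attains_inf continuous_on_subset[OF continuous_ext_ham[OF assms(1,2)]]) auto
  then obtain s where s: "s \<in> cball p \<eta>" "\<And>s'. s' \<in> cball p \<eta> \<Longrightarrow> ext_ham H x s \<le> ext_ham H x s'" by blast
  have "ham_lower H \<eta> x p = ext_ham H x s"
    unfolding ham_lower_def eq using s by (intro cInf_eq_minimum) auto
  with s show ?thesis by (intro that[of s]) (auto simp: dist_real_def)
qed

text \<open>The viscosity inequality alone, for an extended real function that need not be an
  envelope. It applies to the upper limit function directly, and local boundedness can be treated
  apart.\<close>

definition visc_subsolution :: "'a metric \<Rightarrow> ('a \<Rightarrow> real \<Rightarrow> real) \<Rightarrow> (real \<times> 'a \<Rightarrow> ereal) \<Rightarrow> bool" where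
  "visc_subsolution X H E \<longleftrightarrow>
     (\<forall>(\<phi>1, \<phi>2)\<in>sub_test X. \<forall>(t, x)\<in>mspace (open_cyl X).
        local_max_at (open_cyl X) (\<lambda>q. E q - ereal (\<phi>1 q) - ereal (\<phi>2 q)) (t, x) \<longrightarrow>
        dt \<phi>1 (t, x) + dt \<phi>2 (t, x) + ham_lower H (slope_env X \<phi>2 (t, x)) x (slope X \<phi>1 (t, x)) \<le> 0)"

lemma mv_subsolution_iff:
  "mv_subsolution X H u \<longleftrightarrow> locally_bounded (closed_cyl X) u \<and> visc_subsolution X H (upper_env (closed_cyl X) u)"
  by (simp add: mv_subsolution_def visc_subsolution_def)

lemma subsolution_at_local_max:
  assumes X: "geodesic_space X" and H: "continuous_ham X H" and sol: "visc_subsolution X H E"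
    and "z \<in> mspace X" "w \<in> mspace X" "A \<ge> 0" "B \<ge> 0"
    and h: "\<And>t. (h has_real_derivative h' t) (at t)" "continuous_on UNIV h'"
    and tx: "t > 0" "x \<in> mspace X"
    and max: "local_max_at (open_cyl X) (\<lambda>q. E q - ereal (sq_dist_fun X A z q)
      - ereal (time_dist_fun X h B w q)) (t, x)"
  obtains s where "\<bar>s - 2 * A * mdist X x z\<bar> \<le> B" "h' t + ext_ham H x s \<le> 0"
proof -
  let ?\<phi> = "sq_dist_fun X A z" let ?\<psi> = "time_dist_fun X h B w"
  have in_open: "(t, x) \<in> mspace (open_cyl X)" using tx by (simp add: open_cyl_eq)
  have "(?\<phi>, ?\<psi>) \<in> sub_test X" by (rule sq_time_dist_sub_test) (use assms in auto)
  then have ineq: "dt ?\<phi> (t, x) + dt ?\<psi> (t, x) + ham_lower H (slope_env X ?\<psi> (t, x)) x (slope X ?\<phi> (t, x)) \<le> 0"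
    using sol max in_open unfolding visc_subsolution_def by blast
  obtain s where s: "\<bar>s - slope X ?\<phi> (t, x)\<bar> \<le> slope_env X ?\<psi> (t, x)"
    "ham_lower H (slope_env X ?\<psi> (t, x)) x (slope X ?\<phi> (t, x)) = ext_ham H x s"
    using ham_lower_attained[OF H tx(2) slope_env_nonneg[OF in_open]] by metis
  have "slope_env X ?\<psi> (t, x) \<le> B"
    by (rule slope_env_le[OF in_open slope_time_dist_fun_le]) (use assms in auto)
  with s ineq show ?thesis
    using assms by (intro that[of s]) (auto simp: slope_sq_dist_fun dt_sq_dist_fun dt_time_dist_fun[where h' = h'])
qed

lemma usc_cyl_minus_test:
  fixes E :: "real \<times> 'a \<Rightarrow> ereal"
  assumes usc: "Limsup (nhdsin (mtopology_of (cyl S X)) (t, x)) E \<le> E (t, x)" and tx: "t \<in> S" "x \<in> mspace X"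
    and "z \<in> mspace X" "w \<in> mspace X"
    and h: "\<And>t. (h has_real_derivative h' t) (at t)" "continuous_on UNIV h'"
  shows "Limsup (nhdsin (mtopology_of (cyl S X)) (t, x))
      (\<lambda>q. E q - ereal (sq_dist_fun X A z q) - ereal (time_dist_fun X h B w q))
    \<le> E (t, x) - ereal (sq_dist_fun X A z (t, x)) - ereal (time_dist_fun X h B w (t, x))"
  by (intro Limsup_minus_real_le usc locally_Lipschitz_tendsto tx locally_Lipschitz_sq_dist_fun
      locally_Lipschitz_time_dist_fun[OF _ h] assms)

section \<open>Gromov-Hausdorff approximations\<close>

text \<open>The upper limit and the convergence of the Hamiltonians are phrased with full sequences,
  while compactness yields subsequences; the gaps are filled with the limit. The last property keeps
  times nonnegative.\<close>

lemma real_subsequence_extension: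
  fixes \<tau> :: "nat \<Rightarrow> real"
  assumes r: "strict_mono (r :: nat \<Rightarrow> nat)" and lim: "\<tau> \<longlonglongrightarrow> t"
  obtains \<tau>' where "\<tau>' \<longlonglongrightarrow> t" "\<And>k. \<tau>' (r k) = \<tau> k" "\<And>n. \<tau>' n = t \<or> \<tau>' n \<in> range \<tau>"
proof -
  define \<tau>' where "\<tau>' n = (if n \<in> range r then \<tau> (inv r n) else t)" for n
  have inj: "inj r" using r by (rule strict_mono_imp_inj_on)
  have r': "\<tau>' (r k) = \<tau> k" for k using inj by (simp add: \<tau>'_def)
  have "\<tau>' n = t \<or> \<tau>' n \<in> range \<tau>" for n by (simp add: \<tau>'_def)
  moreover have "\<tau>' \<longlonglongrightarrow> t"
  proof (rule LIMSEQ_I)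
    fix e :: real assume "e > 0"
    obtain K where K: "\<And>k. k \<ge> K \<Longrightarrow> norm (\<tau> k - t) < e" using LIMSEQ_D[OF lim \<open>e > 0\<close>] by auto
    have "norm (\<tau>' n - t) < e" if "n \<ge> r K" for n
    proof (cases "n \<in> range r")
      case True
      then obtain k where k: "n = r k" by blast
      then have "k \<ge> K" using that r by (simp add: strict_mono_less_eq)
      then show ?thesis using K by (simp add: k r')
    qed (use \<open>e > 0\<close> in \<open>simp add: \<tau>'_def\<close>)
    then show "\<exists>no. \<forall>n\<ge>no. norm (\<tau>' n - t) < e" by blast
  qed
  ultimately show ?thesis using that r' by blast
qed

text \<open>Only the geometry is fixed here. Solutions and Hamiltonians stay parameters, because
  supersolutions are treated by the same lemmas with their negatives.\<close>

locale gh_approximation =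
  fixes X :: "nat \<Rightarrow> 'a metric" and Y :: "'b metric" and f :: "nat \<Rightarrow> 'a \<Rightarrow> 'b" and f' :: "nat \<Rightarrow> 'b \<Rightarrow> 'a"
    and \<epsilon> :: "nat \<Rightarrow> real"
  assumes X: "lc_geodesic_space (X n)" and Y: "lc_geodesic_space Y"
    and isometry: "eps_isometry (\<epsilon> n) (X n) Y (f n)" and \<epsilon>: "\<epsilon> \<longlonglongrightarrow> 0"
    and inverse: "eps_inverse (\<epsilon> n) (X n) Y (f n) (f' n)"
begin

lemma geodesic: "geodesic_space (X n)" "geodesic_space Y"
  using X Y by (auto simp: lc_geodesic_space_def)

lemma compact_balls: "x \<in> mspace (X n) \<Longrightarrow> compactin (mtopology_of (X n)) (mcball_of (X n) x r)"
  "y \<in> mspace Y \<Longrightarrow> compactin (mtopology_of Y) (mcball_of Y y r)"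
  using X Y by (auto simp: lc_geodesic_space_def)

lemma f_in: "x \<in> mspace (X n) \<Longrightarrow> f n x \<in> mspace Y"
  using isometry[of n] by (auto simp: eps_isometry_def)

lemma f'_in: "y \<in> mspace Y \<Longrightarrow> f' n y \<in> mspace (X n)"
  using inverse[of n] by (auto simp: eps_inverse_def eps_isometry_def)

lemma f_f'_dist: "y \<in> mspace Y \<Longrightarrow> mdist Y (f n (f' n y)) y \<le> \<epsilon> n"
  using inverse[of n] by (auto simp: eps_inverse_def)

text \<open>One \<open>\<epsilon> n\<close> is the distortion of \<open>f n\<close>, the other
  bounds the distance between \<open>f n (f' n z)\<close> and \<open>z\<close>.\<close>

lemma dist_transfer:
  assumes "x \<in> mspace (X n)" "z \<in> mspace Y"
  shows "\<bar>mdist (X n) x (f' n z) - mdist Y (f n x) z\<bar> \<le> 2 * \<epsilon> n"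
proof -
  have "\<bar>mdist Y (f n x) (f n (f' n z)) - mdist (X n) x (f' n z)\<bar> \<le> \<epsilon> n"
    using isometry[of n] assms f'_in by (auto simp: eps_isometry_def)
  moreover have "\<bar>mdist Y (f n (f' n z)) (f n x) - mdist Y z (f n x)\<bar> \<le> mdist Y (f n (f' n z)) z"
    using assms f_in f'_in by (intro mdist_diff_le) auto
  ultimately show ?thesis using f_f'_dist[OF assms(2), of n] by (simp add: mdist_commute)
qed

lemma mem_space_seqs_iff:
  assumes "x \<in> mspace Y"
  shows "\<xi> \<in> space_seqs X Y f x \<longleftrightarrow> (\<forall>n. \<xi> n \<in> mspace (X n)) \<and> (\<lambda>n. mdist Y (f n (\<xi> n)) x) \<longlonglongrightarrow> 0"
proof -
  interpret M: Metric_space "mspace Y" "mdist Y" by simp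
  show ?thesis
    using assms f_in unfolding space_seqs_def mtopology_of_def M.limitin_metric_dist_null by auto
qed

lemma recovery_tendsto: "y \<in> mspace Y \<Longrightarrow> (\<lambda>n. mdist Y (f n (f' n y)) y) \<longlonglongrightarrow> 0"
  by (rule tendsto_sandwich[OF _ _ tendsto_const \<epsilon>]) (auto intro!: always_eventually f_f'_dist)

text \<open>The gaps are filled with the points \<open>f' n y\<close>, whose images under
  \<open>f n\<close> tend to \<open>y\<close>.\<close>

lemma subsequence_extension:
  assumes r: "strict_mono r" and y: "y \<in> mspace Y" and \<zeta>: "\<And>k. \<zeta> k \<in> mspace (X (r k))"
    and lim: "(\<lambda>k. mdist Y (f (r k) (\<zeta> k)) y) \<longlonglongrightarrow> 0"
  obtains \<xi> where "\<xi> \<in> space_seqs X Y f y" "\<And>k. \<xi> (r k) = \<zeta> k"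
proof -
  define \<xi> where "\<xi> n = (if n \<in> range r then \<zeta> (inv r n) else f' n y)" for n
  have inj: "inj r" using r by (rule strict_mono_imp_inj_on)
  have r': "\<xi> (r k) = \<zeta> k" for k using inj by (simp add: \<xi>_def)
  have "\<xi> n \<in> mspace (X n)" for n
    using \<zeta> f'_in[OF y, of n] by (cases "n \<in> range r") (auto simp: r', auto simp: \<xi>_def)
  moreover have "(\<lambda>n. mdist Y (f n (\<xi> n)) y) \<longlonglongrightarrow> 0"
  proof (rule LIMSEQ_I)
    fix e :: real assume "e > 0"
    obtain K where K: "\<And>k. k \<ge> K \<Longrightarrow> mdist Y (f (r k) (\<zeta> k)) y < e"
      using LIMSEQ_D[OF lim \<open>e > 0\<close>] by auto
    obtain N where N: "\<And>n. n \<ge> N \<Longrightarrow> mdist Y (f n (f' n y)) y < e"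
      using LIMSEQ_D[OF recovery_tendsto[OF y] \<open>e > 0\<close>] by auto
    have "mdist Y (f n (\<xi> n)) y < e" if "n \<ge> max N (r K)" for n
    proof (cases "n \<in> range r")
      case True
      then obtain k where k: "n = r k" by blast
      then have "k \<ge> K" using that r by (simp add: strict_mono_less_eq)
      then show ?thesis using K by (simp add: k r')
    next
      case False then show ?thesis using N that by (simp add: \<xi>_def)
    qed
    then show "\<exists>no. \<forall>n\<ge>no. norm (mdist Y (f n (\<xi> n)) y - 0) < e"
      by (intro exI[of _ "max N (r K)"]) simp
  qed
  ultimately have "\<xi> \<in> space_seqs X Y f y" by (simp add: mem_space_seqs_iff[OF y])
  then show ?thesis using that r' by blast
qed

text \<open>A supremum over full sequences also dominates limsups along subsequences, since these
  extend to full sequences.\<close>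

lemma limsup_le_upper_limit_fun:
  assumes r: "strict_mono r" and y: "y \<in> mspace Y" and \<zeta>: "\<And>k. \<zeta> k \<in> mspace (X (r k))"
    and lim: "(\<lambda>k. mdist Y (f (r k) (\<zeta> k)) y) \<longlonglongrightarrow> 0"
    and \<tau>: "\<tau> \<longlonglongrightarrow> t" "\<And>k. \<tau> k \<ge> 0"
  shows "limsup (\<lambda>k. upper_env (closed_cyl (X (r k))) (u (r k)) (\<tau> k, \<zeta> k)) \<le> upper_limit_fun X Y f u (t, y)"
proof -
  obtain \<xi> where \<xi>: "\<xi> \<in> space_seqs X Y f y" "\<And>k. \<xi> (r k) = \<zeta> k"
    using subsequence_extension[OF r y \<zeta> lim] by blast
  obtain \<tau>' where \<tau>': "\<tau>' \<in> time_seqs t" "\<And>k. \<tau>' (r k) = \<tau> k"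
  proof -
    obtain \<tau>' where \<tau>': "\<tau>' \<longlonglongrightarrow> t" "\<And>k. \<tau>' (r k) = \<tau> k" "\<And>n. \<tau>' n = t \<or> \<tau>' n \<in> range \<tau>"
      by (rule real_subsequence_extension[OF r \<tau>(1)]) blast
    have "t \<ge> 0" using \<tau> by (intro LIMSEQ_le_const[OF \<tau>(1)]) auto
    with \<tau>' \<tau>(2) have "\<tau>' n \<ge> 0" for n by (metis rangeE)
    with \<tau>'(1) have "\<tau>' \<in> time_seqs t" by (simp add: time_seqs_def)
    with \<tau>'(2) that show ?thesis by blast
  qed
  have "limsup ((\<lambda>n. upper_env (closed_cyl (X n)) (u n) (\<tau>' n, \<xi> n)) \<circ> r)
      \<le> limsup (\<lambda>n. upper_env (closed_cyl (X n)) (u n) (\<tau>' n, \<xi> n))"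
    by (rule limsup_subseq_mono[OF r])
  also have "\<dots> \<le> upper_limit_fun X Y f u (t, y)"
    unfolding upper_limit_fun_def prod.case using \<xi> \<tau>' by (intro SUP_upper2[of "(\<tau>', \<xi>)"]) auto
  finally show ?thesis using \<xi> \<tau>' by (simp add: o_def)
qed

text \<open>The points lie in different spaces, so compactness is taken from a closed ball of
  \<open>Y\<close> that contains their images.\<close>

lemma bounded_subsequence:
  fixes r :: "nat \<Rightarrow> nat"
  assumes "y \<in> mspace Y" "\<And>k. \<zeta> k \<in> mspace (X (r k))" "\<And>k. mdist Y (f (r k) (\<zeta> k)) y \<le> R"
  obtains q :: "nat \<Rightarrow> nat" and x where "strict_mono q" "x \<in> mspace Y" "(\<lambda>k. mdist Y (f (r (q k)) (\<zeta> (q k))) x) \<longlonglongrightarrow> 0"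
proof -
  interpret M: Metric_space "mspace Y" "mdist Y" by simp
  have "compactin M.mtopology (mcball_of Y y R)" using compact_balls(2)[OF assms(1)] by (simp add: mtopology_of_def)
  moreover have "range (\<lambda>k. f (r k) (\<zeta> k)) \<subseteq> mcball_of Y y R"
    using assms f_in by (auto simp: mdist_commute)
  ultimately have "\<exists>l (q :: nat \<Rightarrow> nat). l \<in> mcball_of Y y R \<and> strict_mono q \<and>
      limitin M.mtopology ((\<lambda>k. f (r k) (\<zeta> k)) \<circ> q) l sequentially"
    unfolding M.compactin_sequentially by (elim conjE allE[of _ "\<lambda>k. f (r k) (\<zeta> k)"]) blast
  then obtain l and q :: "nat \<Rightarrow> nat" where "l \<in> mcball_of Y y R" "strict_mono q"
    "limitin M.mtopology ((\<lambda>k. f (r k) (\<zeta> k)) \<circ> q) l sequentially" by blast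
  then show ?thesis using that unfolding M.limitin_metric_dist_null by (auto simp: o_def)
qed

lemma dist_transfer_tendsto:
  assumes r: "strict_mono r" and y: "y \<in> mspace Y" and z: "z \<in> mspace Y" and \<zeta>: "\<And>k. \<zeta> k \<in> mspace (X (r k))"
    and lim: "(\<lambda>k. mdist Y (f (r k) (\<zeta> k)) y) \<longlonglongrightarrow> 0"
  shows "(\<lambda>k. mdist (X (r k)) (\<zeta> k) (f' (r k) z)) \<longlonglongrightarrow> mdist Y y z"
proof (rule LIM_zero_cancel, rule Lim_null_comparison)
  show "(\<lambda>k. 2 * \<epsilon> (r k) + mdist Y (f (r k) (\<zeta> k)) y) \<longlonglongrightarrow> 0"
    using tendsto_add[OF tendsto_mult_left[OF LIMSEQ_subseq_LIMSEQ[OF \<epsilon> r], of 2] lim] by (simp add: o_def)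
  have "\<bar>mdist (X (r k)) (\<zeta> k) (f' (r k) z) - mdist Y y z\<bar> \<le> 2 * \<epsilon> (r k) + mdist Y (f (r k) (\<zeta> k)) y" for k
    using dist_transfer[OF \<zeta> z, of k] mdist_diff_le[OF f_in[OF \<zeta>] y z, of k] by linarith
  then show "\<forall>\<^sub>F k in sequentially. norm (mdist (X (r k)) (\<zeta> k) (f' (r k) z) - mdist Y y z)
      \<le> 2 * \<epsilon> (r k) + mdist Y (f (r k) (\<zeta> k)) y" by simp
qed

text \<open>Suppose that the inequality fails for all n \<ge> m. Then, for large n, no penalized
  maximum over the boxes in \<open>X n\<close> is interior, since the viscosity inequality there
  would be an instance of what was excluded. Along a subsequence the boundary maxima converge to a
  boundary point in \<open>Y\<close>, where the gap \<gamma> keeps the limit function low; but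
  points approximating \<open>(t0, x0)\<close> force the maximal values to stay higher.\<close>

lemma frequently_approximate_inequality:
  assumes sol: "\<And>n. visc_subsolution (X n) (H n) (upper_env (closed_cyl (X n)) (u n))" and H: "\<And>n. continuous_ham (X n) (H n)"
    and fin: "finite_fun (closed_cyl Y) (upper_limit_fun X Y f u)"
    and test: "(\<phi>1, \<phi>2) \<in> sub_test Y" and t0: "t0 > 0" and x0: "x0 \<in> mspace Y"
    and max: "local_max_at (open_cyl Y) (\<lambda>q. upper_limit_fun X Y f u q - ereal (\<phi>1 q) - ereal (\<phi>2 q)) (t0, x0)"
    and e: "e > 0"
  shows "\<exists>n\<ge>m. \<exists>\<xi>\<in>mspace (X n). \<exists>s. mdist Y (f n \<xi>) x0 \<le> 2 * e
    \<and> \<bar>s - slope Y \<phi>1 (t0, x0)\<bar> \<le> slope_env Y \<phi>2 (t0, x0) + 4 * e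
    \<and> dt \<phi>1 (t0, x0) + dt \<phi>2 (t0, x0) + ext_ham (H n) \<xi> s \<le> e"
proof (rule ccontr)
  assume neg: "\<not> ?thesis"
  define a where "a = dt \<phi>1 (t0, x0) + dt \<phi>2 (t0, x0)"
  define V where "V = upper_limit_fun X Y f u"
  define U where "U q = real_of_ereal (V q)" for q
  define E where "E n = upper_env (closed_cyl (X n)) (u n)" for n
  have VU: "V (t, x) = ereal (U (t, x))" if "t \<ge> 0" "x \<in> mspace Y" for t x
    using fin that unfolding finite_fun_def U_def V_def closed_cyl_eq by (auto simp: ereal_real)
  have "\<forall>\<^sub>F q in nhdsin (mtopology_of (open_cyl Y)) (t0, x0).
      U q - \<phi>1 q - \<phi>2 q \<le> U (t0, x0) - \<phi>1 (t0, x0) - \<phi>2 (t0, x0)"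
  proof -
    have "\<forall>\<^sub>F q in nhdsin (mtopology_of (open_cyl Y)) (t0, x0).
      V q - ereal (\<phi>1 q) - ereal (\<phi>2 q) \<le> V (t0, x0) - ereal (\<phi>1 (t0, x0)) - ereal (\<phi>2 (t0, x0))"
      using max t0 x0 by (subst (asm) local_max_at_iff) (auto simp: open_cyl_eq V_def)
    then show ?thesis
      unfolding open_cyl_eq using t0 x0
      by (subst (asm) eventually_nhdsin_cyl; simp; subst eventually_nhdsin_cyl; simp add: VU)
  qed
  from local_max_test_replacement[OF geodesic(2) test t0 x0 this e]
  obtain z A B N \<theta> \<gamma> where z: "z \<in> mspace Y" and pos: "A \<ge> 0" "B \<ge> 0" "N \<ge> 0" "\<theta> > 0" "\<gamma> > 0"
    and \<theta>: "\<theta> < e" "\<theta> < t0" and p: "\<bar>2 * A * mdist Y x0 z - slope Y \<phi>1 (t0, x0)\<bar> \<le> e" "2 * A * \<theta> \<le> e"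
    and B: "B \<le> slope_env Y \<phi>2 (t0, x0) + e" and N: "2 * N * \<theta> \<le> e"
    and bd: "\<And>t x. \<bar>t - t0\<bar> \<le> \<theta> \<Longrightarrow> x \<in> mspace Y \<Longrightarrow> mdist Y x x0 \<le> \<theta> \<Longrightarrow> \<bar>t - t0\<bar> = \<theta> \<or> mdist Y x x0 = \<theta> \<Longrightarrow>
      U (t, x) \<le> U (t0, x0) + a * (t - t0) + N * (t - t0)\<^sup>2
        + A * ((mdist Y x z)\<^sup>2 - (mdist Y x0 z)\<^sup>2) + B * mdist Y x x0 - \<gamma>"
    unfolding a_def by blast
  define h where "h t = a * (t - t0) + N * (t - t0)\<^sup>2" for t
  define h' where "h' t = a + 2 * N * (t - t0)" for t
  have h: "\<And>t. (h has_real_derivative h' t) (at t)" "continuous_on UNIV h'"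
    unfolding h_def h'_def by (auto intro!: derivative_eq_intros continuous_intros)
  \<comment> \<open>Vertex of the cone and centre of the squared distance in \<open>X n\<close>, the
    counterparts of \<open>x0\<close> and \<open>z\<close>.\<close>
  define w where "w n = f' n x0" for n
  define \<zeta> where "\<zeta> n = f' n z" for n
  have w: "w n \<in> mspace (X n)" and \<zeta>: "\<zeta> n \<in> mspace (X n)" for n
    using f'_in x0 z by (auto simp: w_def \<zeta>_def)
  define Q where "Q n = {t0 - \<theta>..t0 + \<theta>} \<times> mcball_of (X n) (w n) \<theta>" for n
  define F where "F n q = E n q - ereal (sq_dist_fun (X n) A (\<zeta> n) q) - ereal (time_dist_fun (X n) h B (w n) q)" for n q
  have Q_iff: "(t, x) \<in> Q n \<longleftrightarrow> \<bar>t - t0\<bar> \<le> \<theta> \<and> x \<in> mspace (X n) \<and> mdist (X n) x (w n) \<le> \<theta>" for t x n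
    using w by (auto simp: Q_def mdist_commute)
  have ex: "\<exists>p. p \<in> Q n \<and> (\<forall>q\<in>Q n. F n q \<le> F n p)" for n
  proof -
    have sub: "Q n \<subseteq> mspace (cyl {0..} (X n))" using \<theta> by (auto simp: Q_def)
    have cpt: "compactin (mtopology_of (cyl {0..} (X n))) (Q n)" unfolding Q_def
      by (rule compactin_cyl[OF compact_balls(1)[OF w]]) (use \<theta> in auto)
    have ne: "Q n \<noteq> {}" using w pos Q_iff[of t0 "w n" n] by auto
    have usc: "Limsup (nhdsin (mtopology_of (cyl {0..} (X n))) p) (F n) \<le> F n p" if "p \<in> Q n" for p
    proof -
      obtain t x where [simp]: "p = (t, x)" by fastforce
      have tx: "t \<in> {0..}" "x \<in> mspace (X n)" using sub that by auto
      show ?thesis unfolding F_def[abs_def] \<open>p = (t, x)\<close>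
        by (rule usc_cyl_minus_test[OF _ tx \<zeta> w h])
          (use tx in \<open>simp add: E_def closed_cyl_eq Limsup_upper_env_le\<close>)
    qed
    show ?thesis by (rule usc_attains_max[OF cpt ne usc]) blast+
  qed
  have "\<exists>P. \<forall>n. P n \<in> Q n \<and> (\<forall>q\<in>Q n. F n q \<le> F n (P n))"
    by (rule choice) (use ex in blast)
  then obtain P where P: "\<And>n. P n \<in> Q n" "\<And>n q. q \<in> Q n \<Longrightarrow> F n q \<le> F n (P n)" by blast
  define T where "T n = fst (P n)" for n
  define x where "x n = snd (P n)" for n
  have PT: "P n = (T n, x n)" for n by (simp add: T_def x_def)
  have Tx: "\<bar>T n - t0\<bar> \<le> \<theta>" "x n \<in> mspace (X n)" "mdist (X n) (x n) (w n) \<le> \<theta>" for n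
    using P(1)[of n] by (auto simp: PT Q_iff)
  have T0: "T n > 0" for n using Tx(1)[of n] \<theta> by linarith
  \<comment> \<open>One limit for two demands: \<open>2 * \<epsilon> n \<le> e\<close> for the
    position, and \<open>8 * A * \<epsilon> n \<le> e\<close> for the slope, because distances to
    the centre are off by at most \<open>\<theta> + 4 * \<epsilon> n\<close>.\<close>
  have "(\<lambda>n. (2 + 8 * A) * \<epsilon> n) \<longlonglongrightarrow> 0" using tendsto_mult_left[OF \<epsilon>] by simp
  then obtain m' where m'': "\<And>n. n \<ge> m' \<Longrightarrow> \<bar>(2 + 8 * A) * \<epsilon> n\<bar> < e"
    using LIMSEQ_D[OF _ e, of "\<lambda>n. (2 + 8 * A) * \<epsilon> n" 0] by auto
  have \<epsilon>0: "\<epsilon> n > 0" for n using isometry[of n] by (simp add: eps_isometry_def)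
  have m': "2 * \<epsilon> n \<le> e" "8 * A * \<epsilon> n \<le> e" if "n \<ge> m'" for n
  proof -
    have "2 * \<epsilon> n + 8 * A * \<epsilon> n < e" using m''[OF that] by (simp add: algebra_simps)
    moreover have "0 \<le> 8 * A * \<epsilon> n" using \<epsilon>0[of n] pos(1) by simp
    ultimately show "2 * \<epsilon> n \<le> e" "8 * A * \<epsilon> n \<le> e" using \<epsilon>0[of n] by linarith+
  qed
  have fx: "mdist Y (f n (x n)) x0 \<le> \<theta> + 2 * \<epsilon> n" for n
    using dist_transfer[OF Tx(2)[of n] x0] Tx(3)[of n] unfolding w_def by linarith
  \<comment> \<open>An interior maximum would produce a momentum that \<open>neg\<close> rules
    out.\<close>
  have boundary: "\<bar>T n - t0\<bar> = \<theta> \<or> mdist (X n) (x n) (w n) = \<theta>" if n: "n \<ge> max m m'" for n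
  proof (rule ccontr)
    assume "\<not> ?thesis"
    then have lt: "\<bar>T n - t0\<bar> < \<theta>" "mdist (X n) (x n) (w n) < \<theta>" using Tx[of n] by linarith+
    define \<rho> where "\<rho> = min (\<theta> - \<bar>T n - t0\<bar>) (\<theta> - mdist (X n) (x n) (w n))"
    have "(t, y) \<in> Q n" if "y \<in> mspace (X n)" "\<bar>t - T n\<bar> < \<rho>" "mdist (X n) y (x n) < \<rho>" for t y
      using that mdist_triangle[OF that(1) Tx(2)[of n] w[of n]] lt by (auto simp: Q_iff \<rho>_def)
    then have "\<forall>\<^sub>F q in nhdsin (mtopology_of (open_cyl (X n))) (T n, x n). F n q \<le> F n (T n, x n)"
      unfolding open_cyl_eq using T0[of n] Tx(2)[of n] lt P(2)[of _ n]
      by (subst eventually_nhdsin_cyl) (auto simp: PT \<rho>_def intro!: exI[of _ \<rho>])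
    then have "local_max_at (open_cyl (X n)) (F n) (T n, x n)"
      using T0[of n] Tx(2)[of n] by (subst local_max_at_iff) (auto simp: open_cyl_eq)
    then obtain s where s: "\<bar>s - 2 * A * mdist (X n) (x n) (\<zeta> n)\<bar> \<le> B" "h' (T n) + ext_ham (H n) (x n) s \<le> 0"
      using subsolution_at_local_max[OF geodesic(1) H sol \<zeta> w pos(1,2) h T0[of n] Tx(2)[of n]]
      unfolding F_def[abs_def] E_def by blast
    have 1: "mdist Y (f n (x n)) x0 \<le> 2 * e" using fx[of n] \<theta> m'(1)[of n] n by simp
    have "\<bar>mdist (X n) (x n) (\<zeta> n) - mdist Y x0 z\<bar> \<le> \<theta> + 4 * \<epsilon> n"
      using dist_transfer[OF Tx(2)[of n] z] mdist_diff_le[OF f_in[OF Tx(2)[of n]] x0 z] fx[of n]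
      unfolding \<zeta>_def by linarith
    then have "2 * A * \<bar>mdist (X n) (x n) (\<zeta> n) - mdist Y x0 z\<bar> \<le> 2 * A * (\<theta> + 4 * \<epsilon> n)"
      using pos(1) by (intro mult_left_mono) auto
    moreover have "2 * A * \<bar>mdist (X n) (x n) (\<zeta> n) - mdist Y x0 z\<bar> = \<bar>2 * A * mdist (X n) (x n) (\<zeta> n) - 2 * A * mdist Y x0 z\<bar>"
      using pos(1) by (simp add: abs_mult flip: right_diff_distrib)
    moreover have "2 * A * (\<theta> + 4 * \<epsilon> n) \<le> 2 * e" using p(2) m'(2)[of n] n by (simp add: algebra_simps)
    \<comment> \<open>The tolerance \<open>4 * e\<close> is made up of twice \<open>e\<close> for
      the distance to the centre, \<open>e\<close> for the slope of the majorant and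
      \<open>e\<close> from \<open>B\<close>.\<close>
    ultimately have 2: "\<bar>s - slope Y \<phi>1 (t0, x0)\<bar> \<le> slope_env Y \<phi>2 (t0, x0) + 4 * e"
      using s(1) p(1) B by linarith
    have "2 * N * \<bar>T n - t0\<bar> \<le> 2 * N * \<theta>" using Tx(1) pos(3) by (intro mult_left_mono) auto
    then have "\<bar>2 * N * (T n - t0)\<bar> \<le> e" using N pos(3) by (simp add: abs_mult)
    then have "a + ext_ham (H n) (x n) s \<le> e" using s(2) unfolding h'_def by linarith
    then show False using neg n 1 2 Tx(2)[of n] unfolding a_def by auto
  qed
  define \<Psi> where "\<Psi> n t y = A * (mdist (X n) y (\<zeta> n))\<^sup>2 + (h t + B * mdist (X n) y (w n))" for n t y
  have F_eq: "F n (t, y) = E n (t, y) - ereal (\<Psi> n t y)" for n t y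
    by (cases "E n (t, y)") (auto simp: F_def \<Psi>_def sq_dist_fun_def time_dist_fun_def)
  \<comment> \<open>Along a sequence that nearly realizes \<open>V (t0, x0)\<close>, at most
    \<gamma>/2 is lost in \<open>E\<close> and the penalty exceeds its limit by at most \<gamma>/4.
    The total 3\<gamma>/4 stays below the gap \<gamma>.\<close>
  define c where "c = U (t0, x0) - 3 * \<gamma> / 4 - A * (mdist Y x0 z)\<^sup>2"
  \<comment> \<open>A limsup above a level yields only infinitely many n, hence the passage to a
    subsequence later.\<close>
  have freq: "\<exists>\<^sub>F n in sequentially. n \<ge> max m m' \<and> ereal (c + \<Psi> n (T n) (x n)) \<le> E n (T n, x n)"
  proof -
    have "ereal (U (t0, x0) - \<gamma> / 2) < V (t0, x0)" using VU[of t0 x0] t0 x0 pos by simp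
    then obtain \<tau> \<xi> where \<tau>: "\<tau> \<in> time_seqs t0" and \<xi>: "\<xi> \<in> space_seqs X Y f x0"
      and ls: "ereal (U (t0, x0) - \<gamma> / 2) < limsup (\<lambda>n. E n (\<tau> n, \<xi> n))"
      unfolding V_def upper_limit_fun_def prod.case less_SUP_iff E_def by auto
    have \<xi>': "\<And>n. \<xi> n \<in> mspace (X n)" "(\<lambda>n. mdist Y (f n (\<xi> n)) x0) \<longlonglongrightarrow> 0"
      using \<xi> by (auto simp: mem_space_seqs_iff[OF x0])
    have \<tau>': "\<tau> \<longlonglongrightarrow> t0" using \<tau> by (simp add: time_seqs_def)
    have lim: "(\<lambda>n. mdist (X n) (\<xi> n) (w n)) \<longlonglongrightarrow> 0" "(\<lambda>n. mdist (X n) (\<xi> n) (\<zeta> n)) \<longlonglongrightarrow> mdist Y x0 z"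
      using dist_transfer_tendsto[OF strict_mono_id x0 x0, of \<xi>] dist_transfer_tendsto[OF strict_mono_id x0 z, of \<xi>] \<xi>' x0
      by (auto simp: w_def \<zeta>_def)
    have "(\<lambda>n. \<Psi> n (\<tau> n) (\<xi> n)) \<longlonglongrightarrow> A * (mdist Y x0 z)\<^sup>2 + (a * (t0 - t0) + N * (t0 - t0)\<^sup>2 + B * 0)"
      unfolding \<Psi>_def h_def by (intro tendsto_intros lim \<tau>')
    then have "\<forall>\<^sub>F n in sequentially. \<Psi> n (\<tau> n) (\<xi> n) < A * (mdist Y x0 z)\<^sup>2 + \<gamma> / 4"
      using pos by (intro order_tendstoD(2)) auto
    moreover have "\<forall>\<^sub>F n in sequentially. dist (\<tau> n) t0 < \<theta>" using tendstoD[OF \<tau>' pos(4)] .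
    moreover have "\<forall>\<^sub>F n in sequentially. mdist (X n) (\<xi> n) (w n) < \<theta>" using order_tendstoD(2)[OF lim(1) pos(4)] .
    moreover have "\<forall>\<^sub>F n in sequentially. n \<ge> max m m'" by (rule eventually_ge_at_top)
    moreover have "\<exists>\<^sub>F n in sequentially. ereal (U (t0, x0) - \<gamma> / 2) < E n (\<tau> n, \<xi> n)"
    proof (rule ccontr)
      assume "\<not> ?thesis"
      then have "\<forall>\<^sub>F n in sequentially. E n (\<tau> n, \<xi> n) \<le> ereal (U (t0, x0) - \<gamma> / 2)"
        by (simp add: not_frequently not_less)
      from Limsup_bounded[OF this] ls show False by simp
    qed
    ultimately have "\<exists>\<^sub>F n in sequentially. ereal (U (t0, x0) - \<gamma> / 2) < E n (\<tau> n, \<xi> n) \<and>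
        \<Psi> n (\<tau> n) (\<xi> n) < A * (mdist Y x0 z)\<^sup>2 + \<gamma> / 4 \<and> dist (\<tau> n) t0 < \<theta> \<and>
        mdist (X n) (\<xi> n) (w n) < \<theta> \<and> n \<ge> max m m'"
      by (intro frequently_eventually_frequently eventually_conj)
    moreover have "n \<ge> max m m' \<and> ereal (c + \<Psi> n (T n) (x n)) \<le> E n (T n, x n)"
      if n: "ereal (U (t0, x0) - \<gamma> / 2) < E n (\<tau> n, \<xi> n) \<and>
        \<Psi> n (\<tau> n) (\<xi> n) < A * (mdist Y x0 z)\<^sup>2 + \<gamma> / 4 \<and> dist (\<tau> n) t0 < \<theta> \<and>
        mdist (X n) (\<xi> n) (w n) < \<theta> \<and> n \<ge> max m m'" for n
    proof -
      have "(\<tau> n, \<xi> n) \<in> Q n" using n \<xi>'(1) by (simp add: Q_iff dist_real_def)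
      then have *: "E n (\<tau> n, \<xi> n) - ereal (\<Psi> n (\<tau> n) (\<xi> n)) \<le> E n (T n, x n) - ereal (\<Psi> n (T n) (x n))"
        using P(2)[of "(\<tau> n, \<xi> n)" n] by (simp add: PT F_eq)
      \<comment> \<open>\<open>E\<close> may be infinite here: the value \<infinity> satisfies the
        claim, and -\<infinity> contradicts the lower bound at
        \<open>(\<tau> n, \<xi> n)\<close>.\<close>
      have "ereal (c + \<Psi> n (T n) (x n)) \<le> E n (T n, x n)"
      proof (cases "E n (T n, x n)")
        case (real v)
        with * n obtain v' where v': "E n (\<tau> n, \<xi> n) = ereal v'" by (cases "E n (\<tau> n, \<xi> n)") auto
        have "v' - \<Psi> n (\<tau> n) (\<xi> n) \<le> v - \<Psi> n (T n) (x n)" "U (t0, x0) - \<gamma> / 2 < v'"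
          using * n unfolding real v' by simp_all
        moreover have "\<Psi> n (\<tau> n) (\<xi> n) < A * (mdist Y x0 z)\<^sup>2 + \<gamma> / 4" using n by blast
        ultimately show ?thesis unfolding real c_def ereal_less_eq by linarith
      next
        case MInf
        with * n show ?thesis by (cases "E n (\<tau> n, \<xi> n)") auto
      qed simp
      with n show ?thesis by blast
    qed
    ultimately show ?thesis by (rule frequently_elim1)
  qed
  define S where "S = {n. n \<ge> max m m' \<and> ereal (c + \<Psi> n (T n) (x n)) \<le> E n (T n, x n)}"
  have "infinite S"
    using freq unfolding S_def by (simp add: frequently_cofinite cofinite_eq_sequentially[symmetric])
  from infinite_enumerate[OF this] obtain r :: "nat \<Rightarrow> nat" where r1: "strict_mono r" and r2: "\<forall>k. r k \<in> S" by blast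
  have r: "strict_mono r" "\<And>k. r k \<ge> max m m'"
    "\<And>k. ereal (c + \<Psi> (r k) (T (r k)) (x (r k))) \<le> E (r k) (T (r k), x (r k))"
    using r1 r2 by (simp_all add: S_def)
  have bdd: "mdist Y (f (r k) (x (r k))) x0 \<le> \<theta> + e" for k
    using fx[of "r k"] m'(1)[of "r k"] r(2)[of k] by simp
  obtain q :: "nat \<Rightarrow> nat" and xb where q: "strict_mono q" "xb \<in> mspace Y" "(\<lambda>k. mdist Y (f (r (q k)) (x (r (q k)))) xb) \<longlonglongrightarrow> 0"
    by (rule bounded_subsequence[where \<zeta> = "\<lambda>k. x (r k)" and r = r, OF x0 Tx(2) bdd]) blast
  have Tin: "T (r (q k)) \<in> {t0 - \<theta>..t0 + \<theta>}" for k using Tx(1)[of "r (q k)"] by auto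
  obtain tb and q' :: "nat \<Rightarrow> nat" where q': "tb \<in> {t0 - \<theta>..t0 + \<theta>}" "strict_mono q'" "((\<lambda>k. T (r (q k))) \<circ> q') \<longlonglongrightarrow> tb"
    by (rule seq_compactE[where f = "\<lambda>k. T (r (q k))", OF compact_Icc[of "t0 - \<theta>" "t0 + \<theta>", unfolded compact_eq_seq_compact_metric]])
      (use Tin in blast)+
  define R where "R k = r (q (q' k))" for k
  have R: "strict_mono R" using r(1) q(1) q'(2) by (auto simp: R_def strict_mono_def)
  have limT: "(\<lambda>k. T (R k)) \<longlonglongrightarrow> tb" using q'(3) by (simp add: o_def R_def)
  have limx: "(\<lambda>k. mdist Y (f (R k) (x (R k))) xb) \<longlonglongrightarrow> 0"
    using LIMSEQ_subseq_LIMSEQ[OF q(3) q'(2)] by (simp add: o_def R_def)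
  have lim: "(\<lambda>k. mdist (X (R k)) (x (R k)) (w (R k))) \<longlonglongrightarrow> mdist Y xb x0"
    "(\<lambda>k. mdist (X (R k)) (x (R k)) (\<zeta> (R k))) \<longlonglongrightarrow> mdist Y xb z"
    using dist_transfer_tendsto[OF R q(2) x0 _ limx] dist_transfer_tendsto[OF R q(2) z _ limx] Tx(2)
    by (auto simp: w_def \<zeta>_def)
  \<comment> \<open>The alternative between the two kinds of faces is written as one equation for a
    maximum, which passes to the limit.\<close>
  have "max \<bar>T (R k) - t0\<bar> (mdist (X (R k)) (x (R k)) (w (R k))) = \<theta>" for k
    using boundary[of "R k"] r(2)[of "q (q' k)"] Tx[of "R k"] by (auto simp: R_def)
  moreover have "(\<lambda>k. max \<bar>T (R k) - t0\<bar> (mdist (X (R k)) (x (R k)) (w (R k)))) \<longlonglongrightarrow> max \<bar>tb - t0\<bar> (mdist Y xb x0)"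
    by (intro tendsto_intros lim limT)
  ultimately have "max \<bar>tb - t0\<bar> (mdist Y xb x0) = \<theta>" by (simp add: LIMSEQ_const_iff)
  then have "\<bar>tb - t0\<bar> \<le> \<theta>" "mdist Y xb x0 \<le> \<theta>" "\<bar>tb - t0\<bar> = \<theta> \<or> mdist Y xb x0 = \<theta>" by auto
  from bd[OF this(1) q(2) this(2,3)]
  have upper: "U (tb, xb) \<le> U (t0, x0) + h tb + A * ((mdist Y xb z)\<^sup>2 - (mdist Y x0 z)\<^sup>2) + B * mdist Y xb x0 - \<gamma>"
    by (simp add: h_def)
  have "(\<lambda>k. c + \<Psi> (R k) (T (R k)) (x (R k))) \<longlonglongrightarrow> c + (A * (mdist Y xb z)\<^sup>2 + (a * (tb - t0) + N * (tb - t0)\<^sup>2 + B * mdist Y xb x0))"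
    unfolding \<Psi>_def h_def by (intro tendsto_intros lim limT)
  then have "(\<lambda>k. ereal (c + \<Psi> (R k) (T (R k)) (x (R k)))) \<longlonglongrightarrow> ereal (c + (A * (mdist Y xb z)\<^sup>2 + (h tb + B * mdist Y xb x0)))"
    by (simp add: h_def)
  then have "ereal (c + (A * (mdist Y xb z)\<^sup>2 + (h tb + B * mdist Y xb x0))) = limsup (\<lambda>k. ereal (c + \<Psi> (R k) (T (R k)) (x (R k))))"
    by (rule lim_imp_Limsup[OF sequentially_bot, symmetric])
  also have "\<dots> \<le> limsup (\<lambda>k. E (R k) (T (R k), x (R k)))"
    using r(3) by (intro Limsup_mono always_eventually) (auto simp: R_def)
  also have "\<dots> \<le> V (tb, xb)"
    unfolding E_def V_def using Tx(2) T0 by (intro limsup_le_upper_limit_fun[OF R q(2) _ limx limT]) (auto simp: less_imp_le)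
  also have "\<dots> = ereal (U (tb, xb))" using q'(1) \<theta> q(2) by (intro VU) auto
  finally have "c + (A * (mdist Y xb z)\<^sup>2 + (h tb + B * mdist Y xb x0)) \<le> U (tb, xb)" by simp
  with upper pos(5) show False by (simp add: c_def right_diff_distrib)
qed

end

section \<open>Limits of the viscosity inequality and of the initial condition\<close>

lemma frequently_diagonal:
  assumes "\<And>k m. \<exists>n\<ge>m. Q k n"
  obtains r :: "nat \<Rightarrow> nat" where "strict_mono r" "\<And>k. Q k (r k)"
proof -
  have "\<exists>r. \<forall>k. Q k (r k) \<and> r k < r (Suc k)"
  proof (rule dependent_nat_choice)
    show "\<exists>n. Q 0 n" using assms by blast
    show "\<exists>n'. Q (Suc k) n' \<and> n < n'" for n k using assms[of "Suc n" "Suc k"] by auto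
  qed
  then show ?thesis using that by (auto simp: strict_mono_Suc_iff)
qed

context gh_approximation
begin

text \<open>With tolerances tending to 0 the momenta stay in a bounded interval. A convergent
  subsequence, completed to a full sequence, can be inserted into the convergence of the
  Hamiltonians. The limit momentum lies within \<open>L\<close> of \<open>p\<close>, so it competes
  in the infimum.\<close>

lemma limit_ham_lower:
  assumes freq: "\<And>e m. e > 0 \<Longrightarrow> \<exists>n\<ge>m. \<exists>\<xi>\<in>mspace (X n). \<exists>s. mdist Y (f n \<xi>) x0 \<le> 2 * e
      \<and> \<bar>s - p\<bar> \<le> L + 4 * e \<and> a + ext_ham (H n) \<xi> s \<le> e"
    and x0: "x0 \<in> mspace Y" and L: "L \<ge> 0" and Hinf: "continuous_ham Y Hinf"
    and conv: "\<And>p \<xi> \<pi>. \<xi> \<in> space_seqs X Y f x0 \<Longrightarrow> \<pi> \<longlonglongrightarrow> p \<Longrightarrow>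
      (\<lambda>n. ext_ham (H n) (\<xi> n) (\<pi> n)) \<longlonglongrightarrow> ext_ham Hinf x0 p"
  shows "a + ham_lower Hinf L x0 p \<le> 0"
proof -
  \<comment> \<open>Tolerances at most 1, so that all momenta lie within \<open>L + 4\<close> of
    \<open>p\<close>.\<close>
  define d :: "nat \<Rightarrow> real" where "d k = inverse (real (Suc k))" for k
  have d: "d \<longlonglongrightarrow> 0" "\<And>k. d k > 0" "\<And>k. d k \<le> 1"
    unfolding d_def[abs_def] by (rule LIMSEQ_inverse_real_of_nat) (auto simp: field_simps)
  define Q where "Q k n \<longleftrightarrow> (\<exists>\<xi> s. \<xi> \<in> mspace (X n) \<and> mdist Y (f n \<xi>) x0 \<le> 2 * d k
      \<and> \<bar>s - p\<bar> \<le> L + 4 * d k \<and> a + ext_ham (H n) \<xi> s \<le> d k)" for k n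
  have "\<exists>n\<ge>m. Q k n" for k m using freq[OF d(2)[of k], of m] unfolding Q_def by blast
  then obtain r where r: "strict_mono r" "\<And>k. Q k (r k)" using frequently_diagonal[of Q] by blast
  from r(2) have "\<forall>k. \<exists>\<xi> s. \<xi> \<in> mspace (X (r k)) \<and> mdist Y (f (r k) \<xi>) x0 \<le> 2 * d k
      \<and> \<bar>s - p\<bar> \<le> L + 4 * d k \<and> a + ext_ham (H (r k)) \<xi> s \<le> d k" by (simp add: Q_def)
  then obtain \<zeta> s where \<zeta>: "\<And>k. \<zeta> k \<in> mspace (X (r k))" "\<And>k. mdist Y (f (r k) (\<zeta> k)) x0 \<le> 2 * d k"
    and s: "\<And>k. \<bar>s k - p\<bar> \<le> L + 4 * d k" "\<And>k. a + ext_ham (H (r k)) (\<zeta> k) (s k) \<le> d k"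
    unfolding choice_iff by blast
  have sin: "\<forall>k. s k \<in> {p - (L + 4)..p + (L + 4)}"
  proof
    fix k show "s k \<in> {p - (L + 4)..p + (L + 4)}" using s(1)[of k] d(3)[of k] by (auto simp: abs_le_iff)
  qed
  obtain s0 and q :: "nat \<Rightarrow> nat" where q: "strict_mono q" "(s \<circ> q) \<longlonglongrightarrow> s0"
    by (rule seq_compactE[where f = s, OF compact_Icc[of "p - (L + 4)" "p + (L + 4)", unfolded compact_eq_seq_compact_metric]])
      (use sin in blast)+
  define R where "R k = r (q k)" for k
  have R: "strict_mono R" using r(1) q(1) by (auto simp: R_def strict_mono_def)
  have dq: "(\<lambda>k. d (q k)) \<longlonglongrightarrow> 0" using LIMSEQ_subseq_LIMSEQ[OF d(1) q(1)] by (simp add: o_def)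
  have sq: "(\<lambda>k. s (q k)) \<longlonglongrightarrow> s0" using q(2) by (simp add: o_def)
  have "(\<lambda>k. mdist Y (f (R k) (\<zeta> (q k))) x0) \<longlonglongrightarrow> 0"
    by (rule tendsto_sandwich[OF _ _ tendsto_const tendsto_mult_right_zero[OF dq, of 2]])
      (use \<zeta>(2) in \<open>auto intro!: always_eventually simp: R_def\<close>)
  then obtain \<xi> where \<xi>: "\<xi> \<in> space_seqs X Y f x0" "\<And>k. \<xi> (R k) = \<zeta> (q k)"
    using subsequence_extension[OF R x0, of "\<lambda>k. \<zeta> (q k)"] \<zeta>(1) by (auto simp: R_def)
  obtain \<pi> where \<pi>: "\<pi> \<longlonglongrightarrow> s0" "\<And>k. \<pi> (R k) = s (q k)"
    by (rule real_subsequence_extension[OF R sq]) blast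
  have "(\<lambda>k. ext_ham (H (R k)) (\<zeta> (q k)) (s (q k))) \<longlonglongrightarrow> ext_ham Hinf x0 s0"
    using LIMSEQ_subseq_LIMSEQ[OF conv[OF \<xi>(1) \<pi>(1)] R] by (simp add: o_def \<xi>(2) \<pi>(2))
  from tendsto_add[OF tendsto_const[of a] this] dq
  have 1: "a + ext_ham Hinf x0 s0 \<le> 0"
    by (rule LIMSEQ_le) (use s(2) in \<open>auto simp: R_def\<close>)
  have "(\<lambda>k. \<bar>s (q k) - p\<bar>) \<longlonglongrightarrow> \<bar>s0 - p\<bar>" by (intro tendsto_intros sq)
  moreover have "(\<lambda>k. L + 4 * d (q k)) \<longlonglongrightarrow> L + 4 * 0" by (intro tendsto_intros dq)
  ultimately have "\<bar>s0 - p\<bar> \<le> L + 4 * 0" by (rule LIMSEQ_le) (use s(1) in auto)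
  moreover obtain s1 where "\<And>s'. \<bar>s' - p\<bar> \<le> L \<Longrightarrow> ham_lower Hinf L x0 p \<le> ext_ham Hinf x0 s'"
    using ham_lower_attained[OF Hinf x0 L] by metis
  ultimately have "ham_lower Hinf L x0 p \<le> ext_ham Hinf x0 s0" by simp
  with 1 show ?thesis by linarith
qed

lemma visc_subsolution_upper_limit:
  assumes sol: "\<And>n. visc_subsolution (X n) (H n) (upper_env (closed_cyl (X n)) (u n))"
    and H: "\<And>n. continuous_ham (X n) (H n)" and Hinf: "continuous_ham Y Hinf"
    and conv: "\<And>x p \<xi> \<pi>. x \<in> mspace Y \<Longrightarrow> \<xi> \<in> space_seqs X Y f x \<Longrightarrow> \<pi> \<longlonglongrightarrow> p \<Longrightarrow>
      (\<lambda>n. ext_ham (H n) (\<xi> n) (\<pi> n)) \<longlonglongrightarrow> ext_ham Hinf x p"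
    and fin: "finite_fun (closed_cyl Y) (upper_limit_fun X Y f u)"
  shows "visc_subsolution Y Hinf (upper_limit_fun X Y f u)"
  unfolding visc_subsolution_def
proof (clarify)
  fix \<phi>1 \<phi>2 t x
  assume test: "(\<phi>1, \<phi>2) \<in> sub_test Y" and tx: "(t, x) \<in> mspace (open_cyl Y)"
    and max: "local_max_at (open_cyl Y) (\<lambda>q. upper_limit_fun X Y f u q - ereal (\<phi>1 q) - ereal (\<phi>2 q)) (t, x)"
  have t: "t > 0" and x: "x \<in> mspace Y" using tx by (auto simp: open_cyl_eq)
  show "dt \<phi>1 (t, x) + dt \<phi>2 (t, x) + ham_lower Hinf (slope_env Y \<phi>2 (t, x)) x (slope Y \<phi>1 (t, x)) \<le> 0"
    by (rule limit_ham_lower[OF frequently_approximate_inequality[OF sol H fin test t x max] x slope_env_nonneg[OF tx] Hinf conv[OF x]])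
qed

text \<open>The initial data along \<xi> are compared with those at \<open>f' n x\<close>, where
  convergence is known; the common modulus controls the difference because the distance between
  \<open>\<xi> n\<close> and \<open>f' n x\<close> tends to 0.\<close>

lemma upper_limit_initial:
  assumes \<eta>: "modulus_of_continuity \<eta>"
    and g: "\<And>n x y. x \<in> mspace (X n) \<Longrightarrow> y \<in> mspace (X n) \<Longrightarrow> \<bar>g n x - g n y\<bar> \<le> \<eta> (mdist (X n) x y)"
    and ginf: "\<And>x. x \<in> mspace Y \<Longrightarrow> (\<lambda>n. g n (f' n x)) \<longlonglongrightarrow> ginf x"
    and E: "\<And>n x. x \<in> mspace (X n) \<Longrightarrow> E n (0, x) \<le> ereal (g n x)"
    and x: "x \<in> mspace Y" and \<xi>: "\<xi> \<in> space_seqs X Y f x"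
  shows "limsup (\<lambda>n. E n (0, \<xi> n)) \<le> ereal (ginf x)"
proof -
  have \<xi>': "\<And>n. \<xi> n \<in> mspace (X n)" "(\<lambda>n. mdist Y (f n (\<xi> n)) x) \<longlonglongrightarrow> 0"
    using \<xi> by (auto simp: mem_space_seqs_iff[OF x])
  have d: "(\<lambda>n. mdist (X n) (\<xi> n) (f' n x)) \<longlonglongrightarrow> 0"
    using dist_transfer_tendsto[OF strict_mono_id x x, of \<xi>] \<xi>' x by auto
  \<comment> \<open>The distances may vanish, so continuity at 0 within \<open>{0..}\<close> is
    used, which combines the limit from the right with \<open>\<eta> 0 = 0\<close>.\<close>
  have "(\<eta> \<longlongrightarrow> \<eta> 0) (at 0 within {0..})"
    using \<eta> unfolding modulus_of_continuity_def by (simp add: at_within_Ici_at_right)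
  then have "(\<lambda>n. \<eta> (mdist (X n) (\<xi> n) (f' n x))) \<longlonglongrightarrow> \<eta> 0"
    by (intro continuous_within_tendsto_compose[of 0 "{0..}" \<eta>] d) (auto simp: continuous_within)
  then have \<eta>0: "(\<lambda>n. \<eta> (mdist (X n) (\<xi> n) (f' n x))) \<longlonglongrightarrow> 0"
    using \<eta> by (simp add: modulus_of_continuity_def)
  have "(\<lambda>n. g n (\<xi> n) - g n (f' n x)) \<longlonglongrightarrow> 0"
    by (rule Lim_null_comparison[OF _ \<eta>0]) (use g \<xi>'(1) f'_in[OF x] in auto)
  from tendsto_add[OF this ginf[OF x]] have "(\<lambda>n. g n (\<xi> n)) \<longlonglongrightarrow> ginf x" by simp
  then have "limsup (\<lambda>n. ereal (g n (\<xi> n))) = ereal (ginf x)"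
    by (intro lim_imp_Limsup) auto
  moreover have "limsup (\<lambda>n. E n (0, \<xi> n)) \<le> limsup (\<lambda>n. ereal (g n (\<xi> n)))"
    using E \<xi>'(1) by (intro Limsup_mono always_eventually) auto
  ultimately show ?thesis by simp
qed

text \<open>Witnessed by the constant time \<open>s\<close> and the points
  \<open>f' n y\<close>.\<close>

lemma upper_limit_fun_ge:
  assumes M: "\<And>n x. x \<in> mspace (X n) \<Longrightarrow> u n (s, x) \<ge> c" and s: "s \<ge> 0" and y: "y \<in> mspace Y"
  shows "ereal c \<le> upper_limit_fun X Y f u (s, y)"
proof -
  have "ereal c \<le> upper_env (closed_cyl (X n)) (u n) (s, f' n y)" for n
    using M[OF f'_in[OF y]] upper_env_ge[of "(s, f' n y)" "closed_cyl (X n)" "u n"] f'_in[OF y] s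
    by (simp add: closed_cyl_eq) (meson ereal_less_eq(3) order_trans)
  then have "ereal c \<le> limsup (\<lambda>n. upper_env (closed_cyl (X n)) (u n) (s, f' n y))"
    by (intro le_Limsup) auto
  also have "\<dots> \<le> upper_limit_fun X Y f u (s, y)"
    using limsup_le_upper_limit_fun[OF strict_mono_id y, of "\<lambda>n. f' n y" "\<lambda>n. s" s u] f'_in[OF y] recovery_tendsto[OF y] s
    by simp
  finally show ?thesis .
qed

text \<open>Constant momenta along the points \<open>f' n y\<close> carry monotonicity over to
  \<open>Y\<close>, where the growth estimate in time needs it.\<close>

lemma limit_ham_mono:
  assumes mono: "\<And>n x p q. x \<in> mspace (X n) \<Longrightarrow> p \<le> q \<Longrightarrow> ext_ham (H n) x p \<le> ext_ham (H n) x q"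
    and conv: "\<And>x p \<xi> \<pi>. x \<in> mspace Y \<Longrightarrow> \<xi> \<in> space_seqs X Y f x \<Longrightarrow> \<pi> \<longlonglongrightarrow> p \<Longrightarrow>
      (\<lambda>n. ext_ham (H n) (\<xi> n) (\<pi> n)) \<longlonglongrightarrow> ext_ham Hinf x p"
    and y: "y \<in> mspace Y" and "p \<le> q"
  shows "ext_ham Hinf y p \<le> ext_ham Hinf y q"
proof -
  have \<xi>: "(\<lambda>n. f' n y) \<in> space_seqs X Y f y"
    using f'_in[OF y] recovery_tendsto[OF y] by (simp add: mem_space_seqs_iff[OF y])
  show ?thesis
    by (rule LIMSEQ_le[OF conv[OF y \<xi> tendsto_const] conv[OF y \<xi> tendsto_const]])
      (use mono f'_in[OF y] \<open>p \<le> q\<close> in auto)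
qed

end

section \<open>Growth in time and local boundedness of the limit\<close>

text \<open>
  Comparison of \<open>V\<close> with \<open>K t + \<kappa> d(y, y\<^sub>0)\<close> as \<open>\<kappa> \<rightarrow> \<infinity>\<close>. The additional term \<open>exp (N (t - T))\<close>
  excludes maxima at the terminal time \<open>T + 1\<close>, at the price of the constant \<open>1\<close> in the bound.
\<close>

lemma visc_subsolution_time_growth:
  fixes V :: "real \<times> 'b \<Rightarrow> real"
  assumes Y: "lc_geodesic_space Y" and H: "continuous_ham Y H"
    and mono: "\<And>x p q. x \<in> mspace Y \<Longrightarrow> p \<le> q \<Longrightarrow> ext_ham H x p \<le> ext_ham H x q"
    and usc: "\<And>p. p \<in> mspace (cyl {0..} Y) \<Longrightarrow> Limsup (nhdsin (mtopology_of (cyl {0..} Y)) p) (\<lambda>q. ereal (V q)) \<le> ereal (V p)"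
    and sol: "visc_subsolution Y H (\<lambda>q. ereal (V q))"
    and y0: "y0 \<in> mspace Y" and s: "0 < s" "s < T"
    and K: "K \<ge> 0" "\<And>y. y \<in> mspace Y \<Longrightarrow> mdist Y y y0 \<le> 1 \<Longrightarrow> - ext_ham H y 0 \<le> K"
  shows "V (T, y0) - K * (T - s) - 1 \<le> V (s, y0)"
proof -
  \<comment> \<open>The box reaches beyond \<open>T\<close>: the exponential is 1 at
    \<open>T\<close>, where the comparison value is taken, and large at \<open>T + 1\<close>, where
    maxima have to be excluded.\<close>
  define Q where "Q = {s..T + 1} \<times> mcball_of Y y0 1"
  have Q_iff: "(t, y) \<in> Q \<longleftrightarrow> s \<le> t \<and> t \<le> T + 1 \<and> y \<in> mspace Y \<and> mdist Y y y0 \<le> 1" for t y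
    using y0 by (auto simp: Q_def mdist_commute)
  have cpt: "compactin (mtopology_of (cyl {0..} Y)) Q" unfolding Q_def
    by (rule compactin_cyl) (use Y y0 s in \<open>auto simp: lc_geodesic_space_def\<close>)
  have ne: "Q \<noteq> {}" using Q_iff[of T y0] y0 s by auto
  have sub: "p \<in> mspace (cyl {0..} Y)" if "p \<in> Q" for p using that s by (auto simp: Q_def)
  obtain pm where pm: "\<And>q. q \<in> Q \<Longrightarrow> ereal (V q) \<le> ereal (V pm)"
    by (rule usc_attains_max[OF cpt ne usc[OF sub]]) blast+
  define S where "S = V pm"
  have S: "V q \<le> S" if "q \<in> Q" for q using pm[OF that] by (simp add: S_def)
  define V0 where "V0 = V (T, y0)"
  have "V0 \<le> S" using S[of "(T, y0)"] y0 s by (simp add: V0_def Q_iff)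
  \<comment> \<open>\<open>exp N \<ge> 1 + N = S - V0 + 2\<close> outweighs both the largest
    possible gain \<open>S - V0\<close> over \<open>(T, y0)\<close> and the 1 lost there.\<close>
  define N where "N = S - V0 + 1"
  define h where "h t = K * t + exp (N * (t - T))" for t
  define h' where "h' t = K + N * exp (N * (t - T))" for t
  have "N > 0" using \<open>V0 \<le> S\<close> by (simp add: N_def)
  have h: "\<And>t. (h has_real_derivative h' t) (at t)" "continuous_on UNIV h'"
    unfolding h_def h'_def by (auto intro!: derivative_eq_intros continuous_intros)
  \<comment> \<open>The lower bound on \<kappa> makes the cone too high at distance 1 for a lateral
    maximum, so that only the initial face of the box remains.\<close>
  have key: "\<exists>y\<in>mspace Y. mdist Y y y0 \<le> 1 \<and> V0 - K * (T - s) - 1 \<le> V (s, y) - \<kappa> * mdist Y y y0"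
    if \<kappa>: "\<kappa> \<ge> 0" "\<kappa> > S - V0 + K * T + 1" for \<kappa>
  proof -
    define F where "F q = ereal (V q) - ereal (sq_dist_fun Y 0 y0 q) - ereal (time_dist_fun Y h \<kappa> y0 q)" for q
    have F_eq: "F (t, y) = ereal (V (t, y) - h t - \<kappa> * mdist Y y y0)" for t y
      by (simp add: F_def sq_dist_fun_def time_dist_fun_def)
    have "Limsup (nhdsin (mtopology_of (cyl {0..} Y)) p) F \<le> F p" if "p \<in> Q" for p
    proof -
      obtain t x where [simp]: "p = (t, x)" by fastforce
      have tx: "t \<in> {0..}" "x \<in> mspace Y" using sub[OF that] by auto
      show ?thesis unfolding F_def[abs_def] \<open>p = (t, x)\<close>
        by (rule usc_cyl_minus_test[OF usc tx y0 y0 h]) (use tx in simp)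
    qed
    from usc_attains_max[OF cpt ne this] obtain P where P: "P \<in> Q" "\<And>q. q \<in> Q \<Longrightarrow> F q \<le> F P" by blast
    obtain t y where ty: "P = (t, y)" by fastforce
    have tyQ: "s \<le> t" "t \<le> T + 1" "y \<in> mspace Y" "mdist Y y y0 \<le> 1" using P(1) by (auto simp: ty Q_iff)
    have "F (T, y0) \<le> F (t, y)" using P(2)[of "(T, y0)"] y0 s by (simp add: Q_iff ty)
    then have ge: "V0 - K * T - 1 \<le> V (t, y) - h t - \<kappa> * mdist Y y y0"
      using y0 by (simp add: F_eq V0_def h_def)
    have VS: "V (t, y) \<le> S" using S[of "(t, y)"] P(1) by (simp add: ty)
    have Kt: "K * t \<ge> 0" using K(1) tyQ s by simp
    have lm: "\<kappa> * mdist Y y y0 \<ge> 0" using \<kappa> by simp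
    have "mdist Y y y0 \<noteq> 1"
    proof
      assume "mdist Y y y0 = 1"
      then have "V0 - K * T - 1 \<le> S - K * t - exp (N * (t - T)) - \<kappa>" using ge VS by (simp add: h_def)
      then show False using \<kappa>(2) Kt exp_gt_zero[of "N * (t - T)"] by linarith
    qed
    then have d1: "mdist Y y y0 < 1" using tyQ by simp
    have tT: "t < T + 1"
    proof (rule ccontr)
      assume "\<not> ?thesis"
      then have t: "t = T + 1" using tyQ by simp
      have "1 + N \<le> exp N" by (rule exp_ge_add_one_self)
      then show False using ge VS lm K(1) by (simp add: t h_def N_def algebra_simps)
    qed
    have "t = s"
    proof (rule ccontr)
      assume "t \<noteq> s"
      then have ts: "t > s" using tyQ by simp
      define \<rho> where "\<rho> = min (min (t - s) (T + 1 - t)) (1 - mdist Y y y0)"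
      have "(t', y') \<in> Q" if "y' \<in> mspace Y" "\<bar>t' - t\<bar> < \<rho>" "mdist Y y' y < \<rho>" for t' y'
        using that mdist_triangle[OF that(1) tyQ(3) y0] d1 by (auto simp: Q_iff \<rho>_def)
      then have "\<forall>\<^sub>F q in nhdsin (mtopology_of (open_cyl Y)) (t, y). F q \<le> F (t, y)"
        unfolding open_cyl_eq using ts s tyQ d1 tT P(2)
        by (subst eventually_nhdsin_cyl) (auto simp: ty \<rho>_def intro!: exI[of _ \<rho>])
      then have lmax: "local_max_at (open_cyl Y) F (t, y)"
        using ts s tyQ by (subst local_max_at_iff) (auto simp: open_cyl_eq)
      have G: "geodesic_space Y" and t0: "t > 0" using Y ts s by (auto simp: lc_geodesic_space_def)
      obtain s' where "h' t + ext_ham H y s' \<le> 0"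
        by (rule subsolution_at_local_max[OF G H sol y0 y0 order_refl \<kappa>(1) h t0 tyQ(3) lmax[unfolded F_def[abs_def]]])
      \<comment> \<open>A negative \<open>s'\<close> gives the value at 0 by the extension, a
        nonnegative one is covered by monotonicity. Together with \<open>h' t > K\<close> this
        contradicts the choice of \<open>K\<close>.\<close>
      moreover have "ext_ham H y 0 \<le> ext_ham H y s'"
        using mono[OF tyQ(3), of 0 s'] by (cases "s' \<ge> 0") (auto simp: ext_ham_def)
      moreover have "0 < N * exp (N * (t - T))" using \<open>N > 0\<close> by simp
      ultimately show False using K(2)[OF tyQ(3,4)] by (simp add: h'_def)
    qed
    then have "V0 - K * T - 1 \<le> V (s, y) - h s - \<kappa> * mdist Y y y0" using ge by simp
    then have "V0 - K * (T - s) - 1 \<le> V (s, y) - \<kappa> * mdist Y y y0"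
      using exp_gt_zero[of "N * (s - T)"] unfolding h_def right_diff_distrib by linarith
    with tyQ show ?thesis by blast
  qed
  show ?thesis
  proof (rule ccontr)
    assume "\<not> ?thesis"
    then have lt: "ereal (V (s, y0)) < ereal (V0 - K * (T - s) - 1)" by (simp add: V0_def)
    have "(s, y0) \<in> mspace (cyl {0..} Y)" using s y0 by simp
    from Limsup_lessD[OF le_less_trans[OF usc[OF this] lt]]
    obtain \<rho> where \<rho>: "\<rho> > 0" "\<And>y. y \<in> mspace Y \<Longrightarrow> mdist Y y y0 < \<rho> \<Longrightarrow> V (s, y) < V0 - K * (T - s) - 1"
      using s y0 by (subst (asm) eventually_nhdsin_cyl) force+
    define D where "D = S - (V0 - K * (T - s) - 1)"
    \<comment> \<open>The first entry forces \<open>y\<close> into the \<rho>-ball, where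
      \<open>V\<close> at time \<open>s\<close> is below the level in question; the second meets the
      demand of \<open>key\<close>.\<close>
    define \<kappa> where "\<kappa> = max (\<bar>D\<bar> / \<rho> + 1) (S - V0 + K * T + 2)"
    have l: "\<kappa> > 0" "\<kappa> > S - V0 + K * T + 1" "\<kappa> > \<bar>D\<bar> / \<rho>"
      using \<rho>(1) by (auto simp: \<kappa>_def less_max_iff_disj add_nonneg_pos)
    obtain y where y: "y \<in> mspace Y" "mdist Y y y0 \<le> 1" "V0 - K * (T - s) - 1 \<le> V (s, y) - \<kappa> * mdist Y y y0"
      using key[of \<kappa>] l by auto
    have "V (s, y) \<le> S" using S[of "(s, y)"] y s by (simp add: Q_iff)
    then have "\<kappa> * mdist Y y y0 \<le> \<bar>D\<bar>" using y(3) by (simp add: D_def)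
    moreover have "\<bar>D\<bar> < \<kappa> * \<rho>" using l(3) \<rho>(1) by (simp add: pos_divide_less_eq)
    ultimately have "\<kappa> * mdist Y y y0 < \<kappa> * \<rho>" by linarith
    then have "mdist Y y y0 < \<rho>" using l(1) by simp
    with \<rho>(2) y have "V (s, y) < V0 - K * (T - s) - 1" by blast
    moreover have "\<kappa> * mdist Y y y0 \<ge> 0" using l by simp
    ultimately show False using y(3) by linarith
  qed
qed

text \<open>Local maxima are taken over open subsets of the open cylinder, so values at time 0 do
  not matter.\<close>

lemma visc_subsolution_cong:
  assumes "\<And>p. p \<in> mspace (open_cyl X) \<Longrightarrow> E p = E' p"
  shows "visc_subsolution X H E = visc_subsolution X H E'"
proof -
  have "local_max_at (open_cyl X) (\<lambda>q. E q - ereal (\<phi>1 q) - ereal (\<phi>2 q)) p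
      = local_max_at (open_cyl X) (\<lambda>q. E' q - ereal (\<phi>1 q) - ereal (\<phi>2 q)) p" for \<phi>1 \<phi>2 p
  proof -
    have "E q = E' q" if "openin (mtopology_of (open_cyl X)) U" "q \<in> U" for U q
      using openin_subset[OF that(1)] that(2) by (intro assms) auto
    then show ?thesis unfolding local_max_at_def
      by (intro ex_cong1 conj_cong refl ball_cong arg_cong2[where f = "(\<le>)"]) simp_all
  qed
  then show ?thesis unfolding visc_subsolution_def by simp
qed

text \<open>The definition of a solution takes the envelope of a real function; for the real version
  of a finite semicontinuous limit this recovers the limit function itself.\<close>

lemma upper_env_real_usc:
  assumes "finite_fun C V" "usc_fun C V" "p \<in> mspace C"
  shows "upper_env C (\<lambda>q. real_of_ereal (V q)) p = V p"
proof -
  have eq: "ereal (real_of_ereal (V q)) = V q" if "q \<in> mspace C" for q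
    using assms(1) that by (auto simp: finite_fun_def ereal_real)
  have "upper_env C (\<lambda>q. real_of_ereal (V q)) p = Limsup (nhdsin (mtopology_of C) p) V"
    unfolding upper_env_def
    by (rule Limsup_eq, subst eventually_nhdsin_metric[OF assms(3)]) (auto intro!: exI[of _ 1] eq)
  moreover have "\<dots> \<le> V p" using assms by (simp add: usc_fun_def)
  ultimately show ?thesis
    using upper_env_ge[OF assms(3), of "\<lambda>q. real_of_ereal (V q)"] eq[OF assms(3)] by simp
qed

lemma locally_boundedI:
  assumes "\<And>p. p \<in> mspace C \<Longrightarrow> \<exists>c. \<forall>\<^sub>F q in nhdsin (mtopology_of C) p. \<bar>f q\<bar> \<le> c"
  shows "locally_bounded C f"
  unfolding locally_bounded_def
proof
  fix p assume p: "p \<in> mspace C"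
  then obtain c S where "openin (mtopology_of C) S" "p \<in> S" "\<forall>q\<in>S. \<bar>f q\<bar> \<le> c"
    using assms[OF p] by (auto simp: eventually_nhdsin)
  then show "\<exists>U. openin (mtopology_of C) U \<and> p \<in> U \<and> bounded (f ` U)"
    by (intro exI[of _ S]) (auto simp: bounded_iff)
qed

context gh_approximation
begin

text \<open>Local boundedness is kept apart, since its proof relies on a nondecreasing Hamiltonian,
  while the reduction of supersolutions works with the negative one.\<close>

lemma subsolution_stability:
  assumes sol: "\<And>n. visc_subsolution (X n) (H n) (upper_env (closed_cyl (X n)) (u n))"
    and H: "\<And>n. continuous_ham (X n) (H n)" and Hinf: "continuous_ham Y Hinf"
    and conv: "\<And>x p \<xi> \<pi>. x \<in> mspace Y \<Longrightarrow> \<xi> \<in> space_seqs X Y f x \<Longrightarrow> \<pi> \<longlonglongrightarrow> p \<Longrightarrow>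
      (\<lambda>n. ext_ham (H n) (\<xi> n) (\<pi> n)) \<longlonglongrightarrow> ext_ham Hinf x p"
    and \<eta>: "modulus_of_continuity \<eta>"
    and g: "\<And>n x y. x \<in> mspace (X n) \<Longrightarrow> y \<in> mspace (X n) \<Longrightarrow> \<bar>g n x - g n y\<bar> \<le> \<eta> (mdist (X n) x y)"
    and ginf: "\<And>x. x \<in> mspace Y \<Longrightarrow> (\<lambda>n. g n (f' n x)) \<longlonglongrightarrow> ginf x"
    and init: "\<And>n x. x \<in> mspace (X n) \<Longrightarrow> upper_env (closed_cyl (X n)) (u n) (0, x) \<le> ereal (g n x)"
    and init_cont: "\<And>x. x \<in> mspace Y \<Longrightarrow>
        (SUP (\<tau>, \<xi>)\<in>time_seqs 0 \<times> space_seqs X Y f x.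
           limsup (\<lambda>n. upper_env (closed_cyl (X n)) (u n) (\<tau> n, \<xi> n)))
        \<le> (SUP \<xi>\<in>space_seqs X Y f x. limsup (\<lambda>n. upper_env (closed_cyl (X n)) (u n) (0, \<xi> n)))"
    and fin: "finite_fun (closed_cyl Y) (upper_limit_fun X Y f u)"
    and usc: "usc_fun (closed_cyl Y) (upper_limit_fun X Y f u)"
  shows "visc_subsolution Y Hinf (upper_env (closed_cyl Y) (\<lambda>p. real_of_ereal (upper_limit_fun X Y f u p)))"
    and "\<And>x. x \<in> mspace Y \<Longrightarrow> real_of_ereal (upper_limit_fun X Y f u (0, x)) \<le> ginf x"
proof -
  have eq: "upper_env (closed_cyl Y) (\<lambda>p. real_of_ereal (upper_limit_fun X Y f u p)) q = upper_limit_fun X Y f u q"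
    if "q \<in> mspace (open_cyl Y)" for q
    using that by (intro upper_env_real_usc[OF fin usc]) (auto simp: open_cyl_eq closed_cyl_eq)
  have "visc_subsolution Y Hinf (upper_env (closed_cyl Y) (\<lambda>p. real_of_ereal (upper_limit_fun X Y f u p)))
      \<longleftrightarrow> visc_subsolution Y Hinf (upper_limit_fun X Y f u)"
    by (rule visc_subsolution_cong) (rule eq)
  with visc_subsolution_upper_limit[OF sol H Hinf conv fin]
  show "visc_subsolution Y Hinf (upper_env (closed_cyl Y) (\<lambda>p. real_of_ereal (upper_limit_fun X Y f u p)))" by blast
next
  fix x assume x: "x \<in> mspace Y"
  have "upper_limit_fun X Y f u (0, x) \<le> (SUP \<xi>\<in>space_seqs X Y f x. limsup (\<lambda>n. upper_env (closed_cyl (X n)) (u n) (0, \<xi> n)))"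
    using init_cont[OF x] by (simp add: upper_limit_fun_def)
  also have "\<dots> \<le> ereal (ginf x)"
    by (rule SUP_least, rule upper_limit_initial[OF \<eta> g ginf init x])
  finally have le: "upper_limit_fun X Y f u (0, x) \<le> ereal (ginf x)" .
  show "real_of_ereal (upper_limit_fun X Y f u (0, x)) \<le> ginf x"
  proof -
    have "(0, x) \<in> mspace (closed_cyl Y)" using x by (simp add: closed_cyl_eq)
    then have "\<bar>upper_limit_fun X Y f u (0, x)\<bar> \<noteq> \<infinity>" by (rule bspec[OF fin[unfolded finite_fun_def]])
    with le show ?thesis by (cases "upper_limit_fun X Y f u (0, x)") auto
  qed
qed

text \<open>Upper semicontinuity bounds the limit from above. From below, the uniform bounds on
  \<open>u n\<close> settle positive times; the growth estimate leads from time 1 back to small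
  times, and semicontinuity carries the bound on to time 0.\<close>

lemma locally_bounded_upper_limit:
  assumes sol: "visc_subsolution Y Hinf (upper_limit_fun X Y f u)" and Hinf: "continuous_ham Y Hinf"
    and mono: "\<And>x p q. x \<in> mspace Y \<Longrightarrow> p \<le> q \<Longrightarrow> ext_ham Hinf x p \<le> ext_ham Hinf x q"
    and bounded: "\<And>T1 T2. 0 < T1 \<Longrightarrow> T1 < T2 \<Longrightarrow>
        \<exists>M>0. \<forall>n. \<forall>s\<in>{T1..T2}. \<forall>x\<in>mspace (X n). \<bar>u n (s, x)\<bar> \<le> M"
    and fin: "finite_fun (closed_cyl Y) (upper_limit_fun X Y f u)"
    and usc: "usc_fun (closed_cyl Y) (upper_limit_fun X Y f u)"
  shows "locally_bounded (closed_cyl Y) (\<lambda>p. real_of_ereal (upper_limit_fun X Y f u p))"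
proof (rule locally_boundedI)
  define V where "V p = real_of_ereal (upper_limit_fun X Y f u p)" for p
  have V: "upper_limit_fun X Y f u p = ereal (V p)" if "p \<in> mspace (closed_cyl Y)" for p
    using fin that by (auto simp: finite_fun_def V_def ereal_real)
  have uscV: "Limsup (nhdsin (mtopology_of (closed_cyl Y)) p) (\<lambda>q. ereal (V q)) \<le> ereal (V p)"
    if "p \<in> mspace (closed_cyl Y)" for p
    unfolding V[OF that, symmetric] using upper_env_real_usc[OF fin usc that]
    unfolding V_def upper_env_def by (rule eq_refl)
  have solV: "visc_subsolution Y Hinf (\<lambda>q. ereal (V q))"
    using sol by (subst visc_subsolution_cong[of _ _ "upper_limit_fun X Y f u"]) (auto simp: V open_cyl_eq closed_cyl_eq)
  have lower: "\<exists>M. \<forall>s\<in>{T1..T2}. \<forall>y\<in>mspace Y. - M \<le> V (s, y)" if T: "0 < T1" "T1 < T2" for T1 T2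
  proof -
    obtain M where M: "\<And>n s x. s \<in> {T1..T2} \<Longrightarrow> x \<in> mspace (X n) \<Longrightarrow> \<bar>u n (s, x)\<bar> \<le> M"
      using bounded[OF T] by blast
    have "- M \<le> V (s, y)" if "s \<in> {T1..T2}" "y \<in> mspace Y" for s y
    proof -
      have "ereal (- M) \<le> upper_limit_fun X Y f u (s, y)"
        using M[OF that(1)] that \<open>0 < T1\<close> by (intro upper_limit_fun_ge) (auto simp: abs_le_iff minus_le_iff)
      then show ?thesis using that \<open>0 < T1\<close> by (simp add: V closed_cyl_eq)
    qed
    then show ?thesis by blast
  qed
  fix p assume p: "p \<in> mspace (closed_cyl Y)"
  obtain t x where [simp]: "p = (t, x)" by fastforce
  have tx: "t \<ge> 0" "x \<in> mspace Y" using p by (auto simp: closed_cyl_eq)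
  have "Limsup (nhdsin (mtopology_of (closed_cyl Y)) p) (\<lambda>q. ereal (V q)) < ereal (V p + 1)"
    using uscV[OF p] by (rule le_less_trans) simp
  from Limsup_lessD[OF this] have up: "\<forall>\<^sub>F q in nhdsin (mtopology_of (closed_cyl Y)) p. V q < V p + 1" by simp
  have "\<exists>c. \<forall>\<^sub>F q in nhdsin (mtopology_of (closed_cyl Y)) p. c \<le> V q"
  proof (cases "t > 0")
    case True
    then obtain M where "\<forall>s\<in>{t / 2..2 * t}. \<forall>y\<in>mspace Y. - M \<le> V (s, y)"
      using lower[of "t / 2" "2 * t"] by auto
    then have "\<forall>\<^sub>F q in nhdsin (mtopology_of (closed_cyl Y)) p. - M \<le> V q"
      using True tx unfolding closed_cyl_eq \<open>p = (t, x)\<close>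
      by (subst eventually_nhdsin_cyl) (auto intro!: exI[of _ "t / 2"] simp: abs_less_iff)
    then show ?thesis by blast
  next
    case False
    then have t: "t = 0" using tx by simp
    \<comment> \<open>Continuity at momentum 0 bounds the growth rate on the ball of radius 2, which
      contains the unit balls around all points within 1 of \<open>x\<close>.\<close>
    have "continuous_map (mtopology_of Y) (mtopology_of (prod_metric Y (submetric euclidean_metric {0..}))) (\<lambda>y. (y, 0::real))"
      by (auto simp: mtopology_of_submetric continuous_map_in_subtopology intro!: continuous_map_pairedI)
    from continuous_map_compose[OF this Hinf[unfolded continuous_ham_def]]
    have "continuous_map (mtopology_of Y) euclideanreal (\<lambda>y. Hinf y 0)" by (simp add: o_def)
    moreover have "compactin (mtopology_of Y) (mcball_of Y x 2)" using compact_balls(2)[OF tx(2)] .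
    ultimately have "compactin euclideanreal ((\<lambda>y. Hinf y 0) ` mcball_of Y x 2)"
      by (intro image_compactin)
    then have "bounded ((\<lambda>y. Hinf y 0) ` mcball_of Y x 2)" by (simp add: compact_imp_bounded)
    then obtain K where "\<forall>y\<in>mcball_of Y x 2. \<bar>Hinf y 0\<bar> \<le> K" by (auto simp: bounded_iff)
    then have K: "\<And>y. y \<in> mcball_of Y x 2 \<Longrightarrow> \<bar>Hinf y 0\<bar> \<le> K" by blast
    have K0: "K \<ge> 0" using K[of x] tx by simp
    obtain M where "\<forall>s\<in>{1..2}. \<forall>y\<in>mspace Y. - M \<le> V (s, y)" using lower[of 1 2] by auto
    then have M: "\<And>y. y \<in> mspace Y \<Longrightarrow> - M \<le> V (1, y)" by simp
    \<comment> \<open>The bound \<open>- M\<close> at time 1, less the growth \<open>K\<close> over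
      at most one unit of time and the constant 1 of the growth estimate.\<close>
    define c where "c = - M - K - 1"
    have pos: "c \<le> V (s, y)" if "0 < s" "s < 1" "y \<in> mspace Y" "mdist Y y x < 1" for s y
    proof -
      have "V (1, y) - K * (1 - s) - 1 \<le> V (s, y)"
      proof (rule visc_subsolution_time_growth[OF Y Hinf mono _ solV that(3,1,2) K0])
        fix y' assume y': "y' \<in> mspace Y" "mdist Y y' y \<le> 1"
        then have "y' \<in> mcball_of Y x 2"
          using mdist_triangle[OF y'(1) that(3) tx(2)] that(4) tx by (simp add: mdist_commute)
        from K[OF this] show "- ext_ham Hinf y' 0 \<le> K" by (simp add: ext_ham_def abs_le_iff)
      qed (use uscV in \<open>simp_all add: closed_cyl_eq\<close>)
      moreover have "K * (1 - s) \<le> K" using K0 that by (simp add: mult_left_le)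
      ultimately show ?thesis using M[OF that(3)] by (simp add: c_def)
    qed
    \<comment> \<open>By upper semicontinuity a smaller value at time 0 would push \<open>V\<close>
      below \<open>c\<close> at small positive times as well.\<close>
    have zero: "c \<le> V (0, y)" if y: "y \<in> mspace Y" "mdist Y y x < 1" for y
    proof (rule ccontr)
      assume "\<not> ?thesis"
      then have "ereal (V (0, y)) < ereal c" by simp
      moreover have "(0, y) \<in> mspace (closed_cyl Y)" using y by (simp add: closed_cyl_eq)
      ultimately have "Limsup (nhdsin (mtopology_of (closed_cyl Y)) (0, y)) (\<lambda>q. ereal (V q)) < ereal c"
        using uscV le_less_trans by blast
      from Limsup_lessD[OF this] obtain r where r: "r > 0"
        "\<And>s. s \<ge> 0 \<Longrightarrow> \<bar>s\<bar> < r \<Longrightarrow> V (s, y) < c"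
        using y unfolding closed_cyl_eq by (subst (asm) eventually_nhdsin_cyl) force+
      define s where "s = min (r / 2) (1 / 2)"
      have "s \<le> r / 2" "s \<le> 1 / 2" "0 < s" using r(1) unfolding s_def by (simp_all only: min.cobounded1 min.cobounded2)
      then have "0 < s" "s < 1" "s < r" using r(1) by linarith+
      with pos[of s y] r(2)[of s] y show False by simp
    qed
    have near: "c \<le> V (s, y)" if "s \<ge> 0" "\<bar>s\<bar> < 1" "y \<in> mspace Y" "mdist Y y x < 1" for s y
      using pos[of s y] zero[of y] that by (cases "s = 0") simp_all
    have m0: "0 \<in> {0::real..}" by simp
    have "\<forall>\<^sub>F q in nhdsin (mtopology_of (closed_cyl Y)) p. c \<le> V q"
      unfolding closed_cyl_eq \<open>p = (t, x)\<close> t eventually_nhdsin_cyl[OF m0 tx(2)]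
      by (intro exI[of _ 1]) (simp add: near)
    then show ?thesis by blast
  qed
  then obtain c where "\<forall>\<^sub>F q in nhdsin (mtopology_of (closed_cyl Y)) p. c \<le> V q" by blast
  then have "\<forall>\<^sub>F q in nhdsin (mtopology_of (closed_cyl Y)) p. \<bar>V q\<bar> \<le> \<bar>c\<bar> + \<bar>V p + 1\<bar>"
    using up by eventually_elim linarith
  then show "\<exists>c. \<forall>\<^sub>F q in nhdsin (mtopology_of (closed_cyl Y)) p. \<bar>real_of_ereal (upper_limit_fun X Y f u q)\<bar> \<le> c"
    unfolding V_def by (rule exI)
qed

end

section \<open>Reduction of supersolutions to subsolutions\<close>

lemma ext_ham_uminus: "ext_ham (\<lambda>x p. - H x p) x p = - ext_ham H x p"
  by (simp add: ext_ham_def)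

lemma ham_upper_eq: "ham_upper H \<eta> x p = - ham_lower (\<lambda>x p. - H x p) \<eta> x p"
  by (simp add: ham_upper_def ham_lower_def ext_ham_uminus Inf_real_def image_image)

lemma continuous_ham_uminus:
  assumes "continuous_ham X H" shows "continuous_ham X (\<lambda>x p. - H x p)"
  using assms unfolding continuous_ham_def case_prod_unfold by (rule continuous_map_minus)

lemma lower_env_eq: "lower_env C f p = - upper_env C (\<lambda>q. - f q) p"
  by (simp add: lower_env_def upper_env_def ereal_Limsup_uminus flip: uminus_ereal.simps)

lemma lower_limit_fun_eq: "lower_limit_fun X Y f u p = - upper_limit_fun X Y f (\<lambda>n q. - u n q) p"
proof -
  have "liminf (\<lambda>n. lower_env (closed_cyl (X n)) (u n) (\<tau> n, \<xi> n))
     = - limsup (\<lambda>n. upper_env (closed_cyl (X n)) (\<lambda>q. - u n q) (\<tau> n, \<xi> n))" for \<tau> \<xi>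
    by (simp add: lower_env_eq ereal_Liminf_uminus)
  then show ?thesis
    by (simp add: lower_limit_fun_def upper_limit_fun_def case_prod_unfold ereal_INF_uminus_eq)
qed

lemma locally_Lipschitz_uminus: "locally_Lipschitz C (\<lambda>q. - \<phi> q) = locally_Lipschitz C \<phi>"
  by (simp add: locally_Lipschitz_def Lipschitz_continuous_map_def dist_minus)

lemma slope_uminus: "slope X (\<lambda>q. - \<phi> q) = slope X \<phi>"
  by (simp add: slope_def abs_minus_commute fun_eq_iff)

lemma slope_plus_uminus: "slope_plus X (\<lambda>q. - \<phi> q) = slope_minus X \<phi>"
  by (simp add: slope_minus_def slope_plus_def fun_eq_iff)

lemma dt_uminus:
  assumes "continuous_dt X \<phi>" "p \<in> mspace (open_cyl X)"
  shows "dt (\<lambda>q. - \<phi> q) p = - dt \<phi> p"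
proof -
  obtain t x where p: "p = (t, x)" by fastforce
  have "(\<lambda>s. \<phi> (s, x)) differentiable (at t)" using assms by (auto simp: continuous_dt_def p)
  then have "((\<lambda>s. \<phi> (s, x)) has_real_derivative dt \<phi> (t, x)) (at t)"
    by (simp add: dt_def DERIV_deriv_iff_real_differentiable)
  from DERIV_minus[OF this] show ?thesis by (simp add: dt_def p DERIV_imp_deriv)
qed

lemma continuous_dt_uminusI:
  assumes "continuous_dt X \<phi>" shows "continuous_dt X (\<lambda>q. - \<phi> q)"
  unfolding continuous_dt_def
proof
  show "\<forall>(t, x)\<in>mspace (open_cyl X). (\<lambda>s. - \<phi> (s, x)) differentiable (at t)"
    using assms by (auto simp: continuous_dt_def intro!: differentiable_minus)
  have "continuous_map (mtopology_of (open_cyl X)) euclideanreal (\<lambda>p. - dt \<phi> p)"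
    using assms unfolding continuous_dt_def by (intro continuous_map_minus) blast
  then show "continuous_map (mtopology_of (open_cyl X)) euclideanreal (dt (\<lambda>q. - \<phi> q))"
    by (rule continuous_map_eq) (simp add: dt_uminus[OF assms])
qed

text \<open>Negation exchanges ascending and descending slopes and preserves all other
  conditions.\<close>

lemma super_test_uminus:
  "(\<lambda>q. - \<phi>1 q, \<lambda>q. - \<phi>2 q) \<in> super_test X \<longleftrightarrow> (\<phi>1, \<phi>2) \<in> sub_test X"
proof -
  have "continuous_dt X (\<lambda>q. - \<phi> q) \<longleftrightarrow> continuous_dt X \<phi>" for \<phi>
    using continuous_dt_uminusI[of X \<phi>] continuous_dt_uminusI[of X "\<lambda>q. - \<phi> q"] by auto
  then show ?thesis
    by (simp add: super_test_def sub_test_def locally_Lipschitz_uminus slope_uminus slope_plus_uminus)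
qed

lemma locally_bounded_uminus: "locally_bounded C (\<lambda>q. - u q) = locally_bounded C u"
proof -
  have "bounded ((\<lambda>q. - u q) ` U) = bounded (u ` U)" for U by (auto simp: bounded_iff)
  then show ?thesis by (simp add: locally_bounded_def)
qed

text \<open>Negation is an involution of pairs of functions, so the quantifier over supersolution
  pairs may run over negated subsolution pairs; then all signs flip together.\<close>

lemma mv_supersolution_iff:
  "mv_supersolution X H u \<longleftrightarrow> mv_subsolution X (\<lambda>x p. - H x p) (\<lambda>q. - u q)"
proof -
  let ?E = "upper_env (closed_cyl X) (\<lambda>q. - u q)"
  let ?H = "\<lambda>x p. - H x p"
  have min_max: "local_min_at (open_cyl X) (\<lambda>q. lower_env (closed_cyl X) u q - ereal (- \<phi>1 q) - ereal (- \<phi>2 q)) p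
      \<longleftrightarrow> local_max_at (open_cyl X) (\<lambda>q. ?E q - ereal (\<phi>1 q) - ereal (\<phi>2 q)) p" for \<phi>1 \<phi>2 p
  proof -
    have "lower_env (closed_cyl X) u q - ereal (- \<phi>1 q) - ereal (- \<phi>2 q)
        = - (?E q - ereal (\<phi>1 q) - ereal (\<phi>2 q))" for q
      unfolding lower_env_eq by (cases "?E q") auto
    then show ?thesis by (simp add: local_min_at_def local_max_at_def)
  qed
  have dt: "dt (\<lambda>q. - \<phi>1 q) p = - dt \<phi>1 p" "dt (\<lambda>q. - \<phi>2 q) p = - dt \<phi>2 p"
    if "(\<phi>1, \<phi>2) \<in> sub_test X" "p \<in> mspace (open_cyl X)" for \<phi>1 \<phi>2 p
    using that by (auto simp: sub_test_def intro: dt_uminus)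
  have ineq: "0 \<le> dt (\<lambda>q. - \<phi>1 q) p + dt (\<lambda>q. - \<phi>2 q) p + ham_upper H \<eta> x r
      \<longleftrightarrow> dt \<phi>1 p + dt \<phi>2 p + ham_lower ?H \<eta> x r \<le> 0"
    if "(\<phi>1, \<phi>2) \<in> sub_test X" "p \<in> mspace (open_cyl X)" for \<phi>1 \<phi>2 p \<eta> x r
    unfolding dt[OF that] ham_upper_eq by linarith
  have env: "slope_env X (\<lambda>q. - \<phi> q) = slope_env X \<phi>" for \<phi>
    by (simp add: slope_env_def slope_uminus fun_eq_iff)
  have "mv_supersolution X H u \<longleftrightarrow> locally_bounded (closed_cyl X) u \<and>
     (\<forall>\<phi>1 \<phi>2 t x. (\<lambda>q. - \<phi>1 q, \<lambda>q. - \<phi>2 q) \<in> super_test X \<longrightarrow> (t, x) \<in> mspace (open_cyl X) \<longrightarrow>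
        local_min_at (open_cyl X) (\<lambda>q. lower_env (closed_cyl X) u q - ereal (- \<phi>1 q) - ereal (- \<phi>2 q)) (t, x) \<longrightarrow>
        dt (\<lambda>q. - \<phi>1 q) (t, x) + dt (\<lambda>q. - \<phi>2 q) (t, x)
          + ham_upper H (slope_env X (\<lambda>q. - \<phi>2 q) (t, x)) x (slope X (\<lambda>q. - \<phi>1 q) (t, x)) \<ge> 0)" (is "_ \<longleftrightarrow> _ \<and> ?R")
  proof -
    have "P \<phi>1 \<phi>2" if "\<And>\<phi>1 \<phi>2. P (\<lambda>q. - \<phi>1 q) (\<lambda>q. - \<phi>2 q)" for P :: "(real \<times> 'a \<Rightarrow> real) \<Rightarrow> (real \<times> 'a \<Rightarrow> real) \<Rightarrow> bool" and \<phi>1 \<phi>2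
      using that[of "\<lambda>q. - \<phi>1 q" "\<lambda>q. - \<phi>2 q"] by simp
    then have all: "(\<forall>\<phi>1 \<phi>2. P \<phi>1 \<phi>2) \<longleftrightarrow> (\<forall>\<phi>1 \<phi>2. P (\<lambda>q. - \<phi>1 q) (\<lambda>q. - \<phi>2 q))"
      for P :: "(real \<times> 'a \<Rightarrow> real) \<Rightarrow> (real \<times> 'a \<Rightarrow> real) \<Rightarrow> bool" by blast
    show ?thesis
      unfolding mv_supersolution_def Ball_def split_paired_All case_prod_conv
      by (subst all) (simp only: all_simps)
  qed
  also have "?R \<longleftrightarrow> visc_subsolution X ?H ?E"
    unfolding super_test_uminus min_max env slope_uminus visc_subsolution_def Ball_def split_paired_All case_prod_conv
    by (auto simp: ineq)
  finally show ?thesis by (simp add: mv_subsolution_iff locally_bounded_uminus)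
qed

theorem theorem1p1:
  fixes X :: "nat \<Rightarrow> 'a metric" and Y :: "'b metric"
    and H :: "nat \<Rightarrow> 'a \<Rightarrow> real \<Rightarrow> real" and Hinf :: "'b \<Rightarrow> real \<Rightarrow> real"
    and g :: "nat \<Rightarrow> 'a \<Rightarrow> real" and ginf :: "'b \<Rightarrow> real"
    and \<epsilon> :: "nat \<Rightarrow> real" and f :: "nat \<Rightarrow> 'a \<Rightarrow> 'b" and f' :: "nat \<Rightarrow> 'b \<Rightarrow> 'a"
    and u :: "nat \<Rightarrow> real \<times> 'a \<Rightarrow> real" and \<eta> :: "real \<Rightarrow> real"
  assumes spaces: "\<And>n. lc_geodesic_space (X n)" "lc_geodesic_space Y"
    and hamiltonians: "\<And>n. continuous_ham (X n) (H n)" "continuous_ham Y Hinf"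
    and initial_data: "\<And>n. continuous_map (mtopology_of (X n)) euclideanreal (g n)"
      "continuous_map (mtopology_of Y) euclideanreal ginf"
    and i: "\<And>n. eps_isometry (\<epsilon> n) (X n) Y (f n)" "\<epsilon> \<longlonglongrightarrow> 0"
    and ii: "\<And>n x p q. x \<in> mspace (X n) \<Longrightarrow> p \<le> q \<Longrightarrow> ext_ham (H n) x p \<le> ext_ham (H n) x q"
    and iii: "\<And>x p \<xi> \<pi>. x \<in> mspace Y \<Longrightarrow> \<xi> \<in> space_seqs X Y f x \<Longrightarrow> \<pi> \<longlonglongrightarrow> p \<Longrightarrow>
        (\<lambda>n. ext_ham (H n) (\<xi> n) (\<pi> n)) \<longlonglongrightarrow> ext_ham Hinf x p"
    and v: "\<And>T1 T2. 0 < T1 \<Longrightarrow> T1 < T2 \<Longrightarrow>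
        \<exists>M>0. \<forall>n. \<forall>s\<in>{T1..T2}. \<forall>x\<in>mspace (X n). \<bar>u n (s, x)\<bar> \<le> M"
    and vi: "modulus_of_continuity \<eta>"
      "\<And>n x y. x \<in> mspace (X n) \<Longrightarrow> y \<in> mspace (X n) \<Longrightarrow>
        \<bar>g n x - g n y\<bar> \<le> \<eta> (mdist (X n) x y)"
      "\<And>n. eps_inverse (\<epsilon> n) (X n) Y (f n) (f' n)"
      "\<And>x. x \<in> mspace Y \<Longrightarrow> (\<lambda>n. g n (f' n x)) \<longlonglongrightarrow> ginf x"
  shows
    "((\<forall>n. mv_subsolution_ivp (X n) (H n) (g n) (u n)) \<and>
      (\<forall>n. \<forall>x\<in>mspace (X n). upper_env (closed_cyl (X n)) (u n) (0, x) \<le> ereal (g n x)) \<and>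
      (\<forall>x\<in>mspace Y.
        (SUP (\<tau>, \<xi>)\<in>time_seqs 0 \<times> space_seqs X Y f x.
           limsup (\<lambda>n. upper_env (closed_cyl (X n)) (u n) (\<tau> n, \<xi> n)))
        \<le> (SUP \<xi>\<in>space_seqs X Y f x.
             limsup (\<lambda>n. upper_env (closed_cyl (X n)) (u n) (0, \<xi> n)))) \<and>
      finite_fun (closed_cyl Y) (upper_limit_fun X Y f u) \<and>
      usc_fun (closed_cyl Y) (upper_limit_fun X Y f u)
      \<longrightarrow> mv_subsolution_ivp Y Hinf ginf (\<lambda>p. real_of_ereal (upper_limit_fun X Y f u p)))
   \<and>
     ((\<forall>n. mv_supersolution_ivp (X n) (H n) (g n) (u n)) \<and>
      (\<forall>n. \<forall>x\<in>mspace (X n). lower_env (closed_cyl (X n)) (u n) (0, x) \<ge> ereal (g n x)) \<and>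
      (\<forall>x\<in>mspace Y.
        (INF (\<tau>, \<xi>)\<in>time_seqs 0 \<times> space_seqs X Y f x.
           liminf (\<lambda>n. lower_env (closed_cyl (X n)) (u n) (\<tau> n, \<xi> n)))
        \<ge> (INF \<xi>\<in>space_seqs X Y f x.
             liminf (\<lambda>n. lower_env (closed_cyl (X n)) (u n) (0, \<xi> n)))) \<and>
      finite_fun (closed_cyl Y) (lower_limit_fun X Y f u) \<and>
      lsc_fun (closed_cyl Y) (lower_limit_fun X Y f u) \<and>
      locally_bounded (closed_cyl Y) (\<lambda>p. real_of_ereal (lower_limit_fun X Y f u p))
      \<longrightarrow> mv_supersolution_ivp Y Hinf ginf (\<lambda>p. real_of_ereal (lower_limit_fun X Y f u p)))"
proof -
  interpret gh_approximation X Y f f' \<epsilon>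
    by unfold_locales (use spaces i vi(3) in auto)
  show ?thesis
  proof (intro conjI impI; elim conjE)
    assume sol: "\<forall>n. mv_subsolution_ivp (X n) (H n) (g n) (u n)"
      and init: "\<forall>n. \<forall>x\<in>mspace (X n). upper_env (closed_cyl (X n)) (u n) (0, x) \<le> ereal (g n x)"
      and init_cont: "\<forall>x\<in>mspace Y.
        (SUP (\<tau>, \<xi>)\<in>time_seqs 0 \<times> space_seqs X Y f x.
           limsup (\<lambda>n. upper_env (closed_cyl (X n)) (u n) (\<tau> n, \<xi> n)))
        \<le> (SUP \<xi>\<in>space_seqs X Y f x.
             limsup (\<lambda>n. upper_env (closed_cyl (X n)) (u n) (0, \<xi> n)))"
      and fin: "finite_fun (closed_cyl Y) (upper_limit_fun X Y f u)"
      and usc: "usc_fun (closed_cyl Y) (upper_limit_fun X Y f u)"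
    have sol': "visc_subsolution (X n) (H n) (upper_env (closed_cyl (X n)) (u n))" for n
      using sol by (simp add: mv_subsolution_ivp_def mv_subsolution_iff)
    note stab = subsolution_stability[OF sol' hamiltonians iii vi(1,2,4) init[rule_format] init_cont[rule_format] fin usc]
    have bdd: "locally_bounded (closed_cyl Y) (\<lambda>p. real_of_ereal (upper_limit_fun X Y f u p))"
      by (rule locally_bounded_upper_limit[OF visc_subsolution_upper_limit[OF sol' hamiltonians iii fin] hamiltonians(2)
          limit_ham_mono[OF ii iii] v fin usc])
    show "mv_subsolution_ivp Y Hinf ginf (\<lambda>p. real_of_ereal (upper_limit_fun X Y f u p))"
      unfolding mv_subsolution_ivp_def mv_subsolution_iff by (intro conjI ballI bdd stab)
  next
    assume sol: "\<forall>n. mv_supersolution_ivp (X n) (H n) (g n) (u n)"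
      and init: "\<forall>n. \<forall>x\<in>mspace (X n). lower_env (closed_cyl (X n)) (u n) (0, x) \<ge> ereal (g n x)"
      and init_cont: "\<forall>x\<in>mspace Y.
        (INF (\<tau>, \<xi>)\<in>time_seqs 0 \<times> space_seqs X Y f x.
           liminf (\<lambda>n. lower_env (closed_cyl (X n)) (u n) (\<tau> n, \<xi> n)))
        \<ge> (INF \<xi>\<in>space_seqs X Y f x.
             liminf (\<lambda>n. lower_env (closed_cyl (X n)) (u n) (0, \<xi> n)))"
      and fin: "finite_fun (closed_cyl Y) (lower_limit_fun X Y f u)"
      and lsc: "lsc_fun (closed_cyl Y) (lower_limit_fun X Y f u)"
      and bdd: "locally_bounded (closed_cyl Y) (\<lambda>p. real_of_ereal (lower_limit_fun X Y f u p))"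
    define u' where "u' = (\<lambda>n q. - u n q)"
    define V where "V = upper_limit_fun X Y f u'"
    have u'_eq: "lower_env C (u n) p = - upper_env C (u' n) p" for C n p
      by (simp add: lower_env_eq u'_def)
    have V_eq: "lower_limit_fun X Y f u p = - V p" for p
      by (simp add: lower_limit_fun_eq V_def u'_def)
    have liminf_eq: "liminf (\<lambda>n. lower_env (closed_cyl (X n)) (u n) (\<tau> n, \<xi> n))
        = - limsup (\<lambda>n. upper_env (closed_cyl (X n)) (u' n) (\<tau> n, \<xi> n))" for \<tau> \<xi>
      by (simp add: u'_eq ereal_Liminf_uminus)
    have liminf_eq0: "liminf (\<lambda>n. lower_env (closed_cyl (X n)) (u n) (0, \<xi> n))
        = - limsup (\<lambda>n. upper_env (closed_cyl (X n)) (u' n) (0, \<xi> n))" for \<xi>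
      by (rule liminf_eq)
    have sol': "visc_subsolution (X n) (\<lambda>x p. - H n x p) (upper_env (closed_cyl (X n)) (u' n))" for n
      using sol by (simp add: mv_supersolution_ivp_def mv_supersolution_iff mv_subsolution_iff u'_def)
    have g': "\<bar>- g n x - - g n y\<bar> \<le> \<eta> (mdist (X n) x y)" if "x \<in> mspace (X n)" "y \<in> mspace (X n)" for n x y
      using vi(2)[OF that] by (simp add: abs_minus_commute)
    have ginf': "(\<lambda>n. - g n (f' n x)) \<longlonglongrightarrow> - ginf x" if "x \<in> mspace Y" for x
      by (intro tendsto_minus vi(4) that)
    have conv: "(\<lambda>n. ext_ham (\<lambda>x p. - H n x p) (\<xi> n) (\<pi> n)) \<longlonglongrightarrow> ext_ham (\<lambda>x p. - Hinf x p) x p"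
      if "x \<in> mspace Y" "\<xi> \<in> space_seqs X Y f x" "\<pi> \<longlonglongrightarrow> p" for x p \<xi> \<pi>
      unfolding ext_ham_uminus by (intro tendsto_minus iii that)
    have init': "upper_env (closed_cyl (X n)) (u' n) (0, x) \<le> ereal (- g n x)" if "x \<in> mspace (X n)" for n x
      using init[rule_format, OF that] unfolding u'_eq
      by (cases "upper_env (closed_cyl (X n)) (u' n) (0, x)") auto
    have init_cont': "(SUP (\<tau>, \<xi>)\<in>time_seqs 0 \<times> space_seqs X Y f x.
           limsup (\<lambda>n. upper_env (closed_cyl (X n)) (u' n) (\<tau> n, \<xi> n)))
        \<le> (SUP \<xi>\<in>space_seqs X Y f x. limsup (\<lambda>n. upper_env (closed_cyl (X n)) (u' n) (0, \<xi> n)))"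
      if "x \<in> mspace Y" for x
      using init_cont[rule_format, OF that] unfolding liminf_eq liminf_eq0
      by (simp add: case_prod_unfold ereal_INF_uminus_eq)
    have fin': "finite_fun (closed_cyl Y) V"
      using fin by (simp add: finite_fun_def V_eq)
    have usc': "usc_fun (closed_cyl Y) V"
    proof -
      have "lower_limit_fun X Y f u = (\<lambda>p. - V p)" by (rule ext) (rule V_eq)
      with lsc show ?thesis by (simp add: usc_fun_def lsc_fun_def ereal_Liminf_uminus)
    qed
    \<comment> \<open>Stability applied to the negatives of \<open>u\<close>, \<open>H\<close> and
      \<open>g\<close>. Local boundedness is not part of its conclusion and comes from the
      assumption \<open>bdd\<close>.\<close>
    note stab = subsolution_stability[OF sol' continuous_ham_uminus[OF hamiltonians(1)] continuous_ham_uminus[OF hamiltonians(2)]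
        conv vi(1) g' ginf' init' init_cont' fin'[unfolded V_def] usc'[unfolded V_def], folded V_def]
    have real_eq: "real_of_ereal (lower_limit_fun X Y f u p) = - real_of_ereal (V p)" for p
      by (simp add: V_eq)
    have bddV: "locally_bounded (closed_cyl Y) (\<lambda>p. real_of_ereal (V p))"
      using bdd by (simp add: real_eq locally_bounded_uminus)
    have ge: "ginf x \<le> - real_of_ereal (V (0, x))" if "x \<in> mspace Y" for x
    proof -
      have "real_of_ereal (V (0, x)) \<le> - ginf x" by (rule stab(2); (assumption | rule that))
      then show ?thesis by simp
    qed
    have sol_lim: "visc_subsolution Y (\<lambda>x p. - Hinf x p) (upper_env (closed_cyl Y) (\<lambda>p. real_of_ereal (V p)))"
      by (rule stab(1); assumption)
    show "mv_supersolution_ivp Y Hinf ginf (\<lambda>p. real_of_ereal (lower_limit_fun X Y f u p))"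
      unfolding mv_supersolution_ivp_def mv_supersolution_iff mv_subsolution_iff real_eq minus_minus
      by (intro conjI ballI bddV sol_lim ge)
  qed
qed

end
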